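(* There exist a homogeneous $A$-hypergeometric system $H_A(\beta)$ with $\operatorname{rank}L=1$, a generic direction $w$, a fake exponent $v$ of $H_A(\beta)$ in the direction $w$, and a proper ordered negative support family $\mathcal N\subsetneq\mathcal N_v$ such that (in $S_0=\mathbb C[s]$) $J_{\mathcal N}^{\mathrm{amb}}=\langle s\rangle$ and $J_{\mathcal N}^{\mathrm{intr}}=\mathbb C[s]$, and hence $\mathfrak D_{\mathcal N}(e)\simeq\mathbb C[s]/\langle s\rangle$. In particular, the obstruction $\mathfrak D_{\mathcal N}(e)$ has dimension one over $\mathbb C$, the intrinsic coefficient space at $v$ for $\mathcal N$ is zero, and the ambient coefficient space at $v$ for $\mathcal N$ has dimension one.
   Context: System. $\mathbb N=\{0,1,2,\dots\}$. $A=(a_{ij})\in\mathbb Z^{d\times n}$ has rank $d$ and its columns lie in an affine hyperplane not containing the origin ("homogeneous"). $L=\ker_{\mathbb Z}(A)$, $r=\operatorname{rank}L=n-d$. For $u\in L$ write $u=u_+-u_-$ with $u_\pm\in\mathbb N^n$ of disjoint support. $I_A=\langle\partial^{u_+}-\partial^{u_-}\mid u\in L\rangle\subseteq\mathbb C[\partial_1,\dots,\partial_n]$. For $\beta\in\mathbb C^d$, $H_A(\beta)$ is the left ideal of the Weyl algebra in $x_1,\dots,x_n$ generated by $I_A$ and $\sum_j a_{ij}x_j\partial_j-\beta_i$ $(1\le i\le d)$. $\operatorname{in}_w$ takes terms of largest $w$-weight; $\operatorname{in}_{(-w,w)}$ is the initial ideal in the Weyl algebra for weights $-w$ on $x$,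 $w$ on $\partial$. A direction $w\in\mathbb R^n$ is generic if $\operatorname{in}_w(I_A)$ is a monomial ideal and $w$ lies in the interior of a full-dimensional cone of the small Gröbner fan of $H_A(\beta)$ (so $\operatorname{in}_{(-w',w')}(H_A(\beta))$ is constant for $w'$ in that interior). For $z\in\mathbb C^n$, $p\in\mathbb N^n$: $[z]_p=\prod_j z_j(z_j-1)\cdots(z_j-p_j+1)$. A fake exponent of $H_A(\beta)$ in the direction $w$ is $v\in\mathbb C^n$ with $Av=\beta$ and $[v]_p=0$ for every monomial $\partial^p\in\operatorname{in}_w(I_A)$. Negative supports. $\operatorname{nsupp}(z)=\{j\mid z_j\in\mathbb Z_{<0}\}$. For $u\in L$, $I_u=\operatorname{nsupp}(v+u)$; $I_0=\operatorname{nsupp}(v)$; $\mathcal S(v)=\{I_u\mid u\in L\}$. The distinguished collection is $\mathcal N_v=\{I\in\mathcal S(v)\mid w\cdot u\ge0\text{ for every }u\in L\text{ with }I_u=I\}$. A negative support family for $v$ is a set $\mathcal N$ with $I_0\in\mathcal N\subseteq\mathcal N_v$; it is ordered if $I\in\mathcal N$, $J\in\mathcal S(v)$, $J\subseteq I$ imply $J\in\mathcal N$. $K_{\mathcal N}=\bigcap_{I\in\mathcal N}I$. Obstruction module. $\widehat R=\mathbb C[[t_1,\dots,t_n]]$, $t^J=\prod_{j\in J}t_j$, $e=t^{I_0\setminus K_{\mathcal N}}$, $U=\langle At\rangle$ (entries of $At$), $M_{\mathcal N}=\langle t^{I\setminus K_{\mathcal N}}\mid I\in\mathcal N\rangle$,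 $P_{\mathcal N}(t)=\langle t^{(I\cup J)\setminus K_{\mathcal N}}\mid I\in\mathcal N,J\in\mathcal S(v)\setminus\mathcal N\rangle$. $\mathfrak D_{\mathcal N}(e)=\dfrac{(U+P_{\mathcal N}(t)):e}{(UM_{\mathcal N}+P_{\mathcal N}(t)):e}$, a module over $\widehat R/U\simeq\mathbb C[[s_1,\dots,s_r]]$ via $t_j\mapsto(Bs)_j$, where $B$ is an $n\times r$ integer matrix whose columns form a $\mathbb Z$-basis of $L$ (Gale dual). The two ideals. $S_0=\mathbb C[s_1,\dots,s_r]$; $\ell_j=(Bs)_j$, $\ell^Y=\prod_{j\in Y}\ell_j$ ($\ell^\varnothing=1$), $E=I_0\setminus K_{\mathcal N}$. Let $\{G_1,\dots,G_g\}$ be the inclusion-minimal members of $\{I\setminus K_{\mathcal N}\mid I\in\mathcal N\}$ and $\{H_1,\dots,H_h\}$ the inclusion-minimal members of $\{(I\cup J)\setminus K_{\mathcal N}\mid I\in\mathcal N,\ J\in\mathcal S(v)\setminus\mathcal N\}$. Each $H_a$ contains some $G_i$; choose such an index $\iota(a)$. $F_{\mathcal N}=\bigoplus_{i}S_0(-|G_i|)\eta_i$, and $Z_{\mathcal N}\subseteq F_{\mathcal N}$ is generated by $\ell^{G_j\setminus G_i}\eta_i-\ell^{G_i\setminus G_j}\eta_j$ $(i<j)$ and $\ell^{H_a\setminus G_{\iota(a)}}\eta_{\iota(a)}$ $(1\le a\le h)$. Choose $i$ with $G_i\subseteq E$ and put $\epsilon_{\mathcal N}=\ell^{E\setminus G_i}\overline{\eta_i}\in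 F_{\mathcal N}/Z_{\mathcal N}$ (independent of the choices). $J_{\mathcal N}^{\mathrm{amb}}=\operatorname{Ann}_{S_0}(\epsilon_{\mathcal N})$, $J_{\mathcal N}^{\mathrm{intr}}=\langle\ell^{H_1},\dots,\ell^{H_h}\rangle:\ell^E$. Coefficient spaces (for $\mathcal N$ ordered). The ambient coefficient space at $v$ for $\mathcal N$ (the coefficients of $x^v$ obtained by the Okuyama–Saito ambient perturbation) is the full coefficient space: all polynomials $p_0(\log x)$ for which there is a formal series $\sum_{u\in L}x^{v+u}p_u(\log x)$, $p_u\in\mathbb C[y_1,\dots,y_n]$, annihilated by $H_A(\beta)$, with $I_u\in\mathcal N$ whenever $p_u\ne0$. For the intrinsic one, put $a_u(s)=[v+Bs]_{u_-}/[v+Bs+u]_{u_+}$ and $\Psi_{\mathcal N}(x,s)=\ell^{E}\sum_{u\in L,\,I_u\in\mathcal N}a_u(s)x^{v+Bs+u}$; for a homogeneous ideal $I\subseteq\mathbb C[s]$ put $I^\perp=\{q(\partial_s)\mid(q(\partial_s)f)|_{s=0}=0\ \forall f\in I\}$. The intrinsic coefficient space at $v$ for $\mathcal N$ is the space of coefficients of $x^v$ in the series $q(\partial_s)\Psi_{\mathcal N}(x,s)|_{s=0}$ with $q\in\langle\ell^{H_1},\dots,\ell^{H_h}\rangle^\perp$. *)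

theory Defs
  imports
    "HOL-Analysis.Abstract_Euclidean_Space"
    "HOL-Algebra.Ideal_Product"
    "Jordan_Normal_Form.DL_Rank"
    "Jordan_Normal_Form.Matrix_Kernel"
begin

unbundle no vec_syntax
hide_type (open) Finite_Cartesian_Product.vec
hide_const (open) Finite_Cartesian_Product.vec Polynomial.smult Modules.module

section \<open>Power series, polynomials and the Weyl algebra in \<open>n\<close> variables\<close>

text \<open>
  Indices run over \<open>0, \<dots>, n - 1\<close>. A monomial is given by its exponent vector in
  \<^term>\<open>carrier_vec n\<close>, and a power series or polynomial by its coefficient function.
  Both rings share the same operations, so that \<open>\<complex>[s]\<close> is a subring of \<open>\<complex>[[s]]\<close>.
\<close>

type_synonym coeffs = "nat vec \<Rightarrow> complex"

definition mfps_ring :: "nat \<Rightarrow> coeffs ring" where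
  "mfps_ring n =
     \<lparr>carrier = {f. \<forall>p. f p \<noteq> 0 \<longrightarrow> p \<in> carrier_vec n},
      mult = (\<lambda>f g p. \<Sum>q \<in> {q. q \<le> p}. f q * g (p - q)),
      one = (\<lambda>p. if p = 0\<^sub>v n then 1 else 0),
      zero = (\<lambda>p. 0),
      add = (\<lambda>f g p. f p + g p)\<rparr>"

definition mpoly_ring :: "nat \<Rightarrow> coeffs ring" where
  "mpoly_ring n = (mfps_ring n)\<lparr>carrier := {f \<in> carrier (mfps_ring n). finite {p. f p \<noteq> 0}}\<rparr>"

definition mmonom :: "nat vec \<Rightarrow> coeffs" where
  "mmonom p = (\<lambda>q. if q = p then 1 else 0)"

definition mconst :: "nat \<Rightarrow> complex \<Rightarrow> coeffs" where
  "mconst n c = (\<lambda>q. if q = 0\<^sub>v n then c else 0)"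

definition linform :: "nat \<Rightarrow> (nat \<Rightarrow> complex) \<Rightarrow> coeffs" where
  "linform n c = (\<lambda>p. \<Sum>j<n. c j * mmonom (unit_vec n j) p)"

text \<open>The element \<open>\<Sum> P (p, q) x\<^sup>p \<partial>\<^sup>q\<close> (normally ordered). The product is the Leibniz rule
  \<open>\<partial>\<^sup>b x\<^sup>c = \<Sum>\<^sub>k k! (b choose k) (c choose k) x\<^sup>c\<^sup>-\<^sup>k \<partial>\<^sup>b\<^sup>-\<^sup>k\<close> in each variable.\<close>

type_synonym weyl = "nat vec \<times> nat vec \<Rightarrow> complex"

definition weyl_mult :: "weyl \<Rightarrow> weyl \<Rightarrow> weyl" where
  "weyl_mult P Q m =
     (\<Sum>(a, b) \<in> {m. P m \<noteq> 0}. \<Sum>(c, e) \<in> {m. Q m \<noteq> 0}.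
        \<Sum>k \<in> {k. k \<le> b \<and> k \<le> c \<and> (a + (c - k), (b - k) + e) = m}.
          P (a, b) * Q (c, e) *
          (\<Prod>i<dim_vec k. of_nat (fact (k $ i) * (b $ i choose k $ i) * (c $ i choose k $ i))))"

definition weyl_ring :: "nat \<Rightarrow> weyl ring" where
  "weyl_ring n =
     \<lparr>carrier = {P. finite {m. P m \<noteq> 0} \<and> {m. P m \<noteq> 0} \<subseteq> carrier_vec n \<times> carrier_vec n},
      mult = weyl_mult,
      one = (\<lambda>m. if m = (0\<^sub>v n, 0\<^sub>v n) then 1 else 0),
      zero = (\<lambda>m. 0),
      add = (\<lambda>P Q m. P m + Q m)\<rparr>"

definition left_ideal :: "'a set \<Rightarrow> 'a ring \<Rightarrow> bool" where
  "left_ideal I R \<longleftrightarrow> additive_subgroup I R \<and> (\<forall>x \<in> carrier R. \<forall>a \<in> I. x \<otimes>\<^bsub>R\<^esub> a \<in> I)"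

definition lgenideal :: "'a ring \<Rightarrow> 'a set \<Rightarrow> 'a set" where
  "lgenideal R S = \<Inter>{I. left_ideal I R \<and> S \<subseteq> I}"


section \<open>Ideal quotients and quotient modules\<close>

definition colon :: "'a ring \<Rightarrow> 'a set \<Rightarrow> 'a \<Rightarrow> 'a set" where
  "colon R I e = {f \<in> carrier R. f \<otimes>\<^bsub>R\<^esub> e \<in> I}"

text \<open>The fields \<^const>\<open>mult\<close> and \<^const>\<open>one\<close> of a module record carry no meaning.\<close>

definition ideal_module :: "'a ring \<Rightarrow> 'a set \<Rightarrow> ('a, 'a) module" where
  "ideal_module R X = \<lparr>carrier = X, mult = mult R, one = one R, zero = zero R, add = add R,
     smult = mult R\<rparr>"

definition quot_module :: "('a, 'b) module \<Rightarrow> 'b set \<Rightarrow> ('a, 'b set) module" where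
  "quot_module M Z = \<lparr>carrier = a_rcosets\<^bsub>M\<^esub> Z, mult = undefined, one = undefined,
     zero = Z, add = set_add M, smult = (\<lambda>a C. \<Union>x \<in> C. Z +>\<^bsub>M\<^esub> (a \<odot>\<^bsub>M\<^esub> x))\<rparr>"

definition complex_space :: "nat \<Rightarrow> (coeffs, 'b) module \<Rightarrow> (complex, 'b) module" where
  "complex_space n M = \<lparr>carrier = carrier M, mult = mult M, one = one M, zero = zero M,
     add = add M, smult = (\<lambda>c. smult M (mconst n c))\<rparr>"

definition has_complex_dim :: "(complex, 'b) module \<Rightarrow> nat \<Rightarrow> bool" where
  "has_complex_dim V k \<longleftrightarrow> vectorspace class_ring V \<and> vectorspace.fin_dim class_ring V \<and>
     vectorspace.dim class_ring V = k"

text \<open>\<open>M\<close> and \<open>N\<close> are isomorphic over \<open>\<sigma> : T \<rightarrow> T'\<close>, where \<open>T\<close> acts on \<open>M\<close> and \<open>T'\<close> on \<open>N\<close>. If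
  \<open>\<sigma>\<close> is onto \<open>T'\<close> and its kernel annihilates \<open>M\<close>, this is isomorphism of \<open>T'\<close>-modules.\<close>

definition isomorphic_over ::
    "'a set \<Rightarrow> ('a \<Rightarrow> 'b) \<Rightarrow> ('a, 'c) module \<Rightarrow> ('b, 'e) module \<Rightarrow> bool" where
  "isomorphic_over T \<sigma> M N \<longleftrightarrow> (\<exists>\<phi>. bij_betw \<phi> (carrier M) (carrier N) \<and>
     (\<forall>x \<in> carrier M. \<forall>y \<in> carrier M. \<phi> (x \<oplus>\<^bsub>M\<^esub> y) = \<phi> x \<oplus>\<^bsub>N\<^esub> \<phi> y) \<and>
     (\<forall>a \<in> T. \<forall>x \<in> carrier M. \<phi> (a \<odot>\<^bsub>M\<^esub> x) = \<sigma> a \<odot>\<^bsub>N\<^esub> \<phi> x))"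


section \<open>The hypergeometric system\<close>

text \<open>The lattice \<open>L\<close> is \<^term>\<open>mat_kernel A\<close>.\<close>

definition homogeneous_matrix :: "nat \<Rightarrow> nat \<Rightarrow> int mat \<Rightarrow> bool" where
  "homogeneous_matrix d n A \<longleftrightarrow> A \<in> carrier_mat d n \<and>
     vec_space.rank d (map_mat rat_of_int A) = d \<and>
     (\<exists>h \<in> carrier_vec d. \<exists>\<gamma>::real. h \<noteq> 0\<^sub>v d \<and> \<gamma> \<noteq> 0 \<and>
        (\<forall>j<n. h \<bullet> map_vec real_of_int (col A j) = \<gamma>))"

definition gale_dual :: "int mat \<Rightarrow> int mat \<Rightarrow> bool" where
  "gale_dual A B \<longleftrightarrow> dim_row B = dim_col A \<and>
     bij_betw (\<lambda>c. B *\<^sub>v c) (carrier_vec (dim_col B)) (mat_kernel A)"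

definition lattice_rank :: "int mat \<Rightarrow> nat \<Rightarrow> bool" where
  "lattice_rank A r \<longleftrightarrow> (\<exists>B. gale_dual A B \<and> dim_col B = r)"

definition pos_part :: "int vec \<Rightarrow> nat vec" where
  "pos_part u = map_vec nat u"

definition neg_part :: "int vec \<Rightarrow> nat vec" where
  "neg_part u = map_vec nat (- u)"

definition toric_ideal :: "int mat \<Rightarrow> coeffs set" where
  "toric_ideal A = (let R = mpoly_ring (dim_col A) in
     Idl\<^bsub>R\<^esub> {mmonom (pos_part u) \<ominus>\<^bsub>R\<^esub> mmonom (neg_part u) | u. u \<in> mat_kernel A})"

definition weyl_of_d :: "nat \<Rightarrow> coeffs \<Rightarrow> weyl" where
  "weyl_of_d n f = (\<lambda>(p, q). if p = 0\<^sub>v n then f q else 0)"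

definition euler_op :: "int mat \<Rightarrow> complex vec \<Rightarrow> nat \<Rightarrow> weyl" where
  "euler_op A \<beta> i = (let n = dim_col A in
     (\<lambda>m. (\<Sum>j<n. if m = (unit_vec n j, unit_vec n j) then of_int (A $$ (i, j)) else 0)
          - (if m = (0\<^sub>v n, 0\<^sub>v n) then \<beta> $ i else 0)))"

definition hypergeometric_ideal :: "int mat \<Rightarrow> complex vec \<Rightarrow> weyl set" where
  "hypergeometric_ideal A \<beta> = lgenideal (weyl_ring (dim_col A))
     (weyl_of_d (dim_col A) ` toric_ideal A \<union> euler_op A \<beta> ` {..<dim_row A})"


section \<open>Initial ideals, generic directions, fake exponents\<close>

text \<open>Weight vectors live in \<^term>\<open>topspace (Euclidean_space n)\<close>, the library's \<open>\<real>\<^sup>n\<close> for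
  a variable \<open>n\<close>: functions on \<open>\<nat>\<close> that vanish from \<open>n\<close> on.\<close>

definition wdot :: "(nat \<Rightarrow> real) \<Rightarrow> int vec \<Rightarrow> real" where
  "wdot w u = (\<Sum>j<dim_vec u. w j * of_int (u $ j))"

definition init_form :: "('m \<Rightarrow> real) \<Rightarrow> ('m \<Rightarrow> complex) \<Rightarrow> 'm \<Rightarrow> complex" where
  "init_form wt f = (\<lambda>m. if \<forall>m'. f m' \<noteq> 0 \<longrightarrow> wt m' \<le> wt m then f m else 0)"

definition poly_init_ideal :: "nat \<Rightarrow> (nat \<Rightarrow> real) \<Rightarrow> coeffs set \<Rightarrow> coeffs set" where
  "poly_init_ideal n w I = Idl\<^bsub>mpoly_ring n\<^esub> (init_form (\<lambda>p. wdot w (map_vec int p)) ` I)"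

definition weyl_init_ideal :: "nat \<Rightarrow> (nat \<Rightarrow> real) \<Rightarrow> weyl set \<Rightarrow> weyl set" where
  "weyl_init_ideal n w I = lgenideal (weyl_ring n)
     (init_form (\<lambda>(p, q). wdot w (map_vec int q) - wdot w (map_vec int p)) ` I)"

definition monomial_ideal :: "nat \<Rightarrow> coeffs set \<Rightarrow> bool" where
  "monomial_ideal n I \<longleftrightarrow> (\<exists>S \<subseteq> carrier_vec n. I = Idl\<^bsub>mpoly_ring n\<^esub> (mmonom ` S))"

text \<open>The cones of the small Groebner fan are the closures of the classes of weights that give
  the same initial ideal.\<close>

definition small_groebner_fan :: "nat \<Rightarrow> weyl set \<Rightarrow> (nat \<Rightarrow> real) set set" where
  "small_groebner_fan n I =
     {Euclidean_space n closure_of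
        {w' \<in> topspace (Euclidean_space n). weyl_init_ideal n w' I = weyl_init_ideal n w I}
      | w. w \<in> topspace (Euclidean_space n)}"

text \<open>A cone is full-dimensional iff its interior is nonempty.\<close>

definition generic_direction :: "int mat \<Rightarrow> complex vec \<Rightarrow> (nat \<Rightarrow> real) \<Rightarrow> bool" where
  "generic_direction A \<beta> w \<longleftrightarrow> (let n = dim_col A in
     w \<in> topspace (Euclidean_space n) \<and>
     monomial_ideal n (poly_init_ideal n w (toric_ideal A)) \<and>
     (\<exists>C \<in> small_groebner_fan n (hypergeometric_ideal A \<beta>).
        w \<in> Euclidean_space n interior_of C))"

definition falling :: "complex vec \<Rightarrow> nat vec \<Rightarrow> complex" where
  "falling z p = (\<Prod>j<dim_vec p. \<Prod>k<p $ j. z $ j - of_nat k)"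

definition fake_exponent ::
    "int mat \<Rightarrow> complex vec \<Rightarrow> (nat \<Rightarrow> real) \<Rightarrow> complex vec \<Rightarrow> bool" where
  "fake_exponent A \<beta> w v \<longleftrightarrow> v \<in> carrier_vec (dim_col A) \<and> map_mat of_int A *\<^sub>v v = \<beta> \<and>
     (\<forall>p \<in> carrier_vec (dim_col A).
        mmonom p \<in> poly_init_ideal (dim_col A) w (toric_ideal A) \<longrightarrow> falling v p = 0)"


section \<open>Negative supports\<close>

definition nsupp :: "complex vec \<Rightarrow> nat set" where
  "nsupp z = {j. j < dim_vec z \<and> (\<exists>m::int. m < 0 \<and> z $ j = of_int m)}"

definition nsupp_at :: "complex vec \<Rightarrow> int vec \<Rightarrow> nat set" where
  "nsupp_at v u = nsupp (v + map_vec of_int u)"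

definition nsupps :: "int mat \<Rightarrow> complex vec \<Rightarrow> nat set set" where
  "nsupps A v = nsupp_at v ` mat_kernel A"

definition distinguished :: "int mat \<Rightarrow> (nat \<Rightarrow> real) \<Rightarrow> complex vec \<Rightarrow> nat set set" where
  "distinguished A w v =
     {I \<in> nsupps A v. \<forall>u \<in> mat_kernel A. nsupp_at v u = I \<longrightarrow> 0 \<le> wdot w u}"

definition neg_support_family ::
    "int mat \<Rightarrow> (nat \<Rightarrow> real) \<Rightarrow> complex vec \<Rightarrow> nat set set \<Rightarrow> bool" where
  "neg_support_family A w v N \<longleftrightarrow> nsupp v \<in> N \<and> N \<subseteq> distinguished A w v"

definition ordered_family :: "int mat \<Rightarrow> complex vec \<Rightarrow> nat set set \<Rightarrow> bool" where
  "ordered_family A v N \<longleftrightarrow> (\<forall>I \<in> N. \<forall>J \<in> nsupps A v. J \<subseteq> I \<longrightarrow> J \<in> N)"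

text \<open>Below, \<open>K\<^sub>N\<close> is written \<^term>\<open>\<Inter>N\<close>, and \<open>E\<close> is \<^term>\<open>nsupp v - \<Inter>N\<close>.\<close>

definition mixed_supports :: "int mat \<Rightarrow> complex vec \<Rightarrow> nat set set \<Rightarrow> nat set set" where
  "mixed_supports A v N = {(I \<union> J) - \<Inter>N | I J. I \<in> N \<and> J \<in> nsupps A v - N}"

definition incl_minimal :: "nat set set \<Rightarrow> nat set set" where
  "incl_minimal F = {X \<in> F. \<forall>Y \<in> F. Y \<subseteq> X \<longrightarrow> Y = X}"

definition min_G :: "nat set set \<Rightarrow> nat set set" where
  "min_G N = incl_minimal ((\<lambda>I. I - \<Inter>N) ` N)"

definition min_H :: "int mat \<Rightarrow> complex vec \<Rightarrow> nat set set \<Rightarrow> nat set set" where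
  "min_H A v N = incl_minimal (mixed_supports A v N)"


section \<open>The obstruction module\<close>

definition t_prod :: "nat \<Rightarrow> nat set \<Rightarrow> coeffs" where
  "t_prod n J = (\<Otimes>\<^bsub>mfps_ring n\<^esub> j \<in> J. mmonom (unit_vec n j))"

definition ideal_U :: "int mat \<Rightarrow> coeffs set" where
  "ideal_U A = (let n = dim_col A in
     Idl\<^bsub>mfps_ring n\<^esub> ((\<lambda>i. linform n (\<lambda>j. of_int (A $$ (i, j)))) ` {..<dim_row A}))"

definition ideal_M :: "nat \<Rightarrow> nat set set \<Rightarrow> coeffs set" where
  "ideal_M n N = Idl\<^bsub>mfps_ring n\<^esub> ((\<lambda>I. t_prod n (I - \<Inter>N)) ` N)"

definition ideal_P :: "int mat \<Rightarrow> complex vec \<Rightarrow> nat set set \<Rightarrow> coeffs set" where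
  "ideal_P A v N = (let n = dim_col A in
     Idl\<^bsub>mfps_ring n\<^esub> (t_prod n ` mixed_supports A v N))"

definition obstruction ::
    "int mat \<Rightarrow> complex vec \<Rightarrow> nat set set \<Rightarrow> (coeffs, coeffs set) module" where
  "obstruction A v N = (let n = dim_col A; R = mfps_ring n; e = t_prod n (nsupp v - \<Inter>N);
       U = ideal_U A; M = ideal_M n N; P = ideal_P A v N in
     quot_module
       (ideal_module R (colon R (U <+>\<^bsub>R\<^esub> P) e))
       (colon R ((U \<cdot>\<^bsub>R\<^esub> M) <+>\<^bsub>R\<^esub> P) e))"

definition ell :: "int mat \<Rightarrow> nat \<Rightarrow> coeffs" where
  "ell B j = linform (dim_col B) (\<lambda>i. of_int (B $$ (j, i)))"

definition ell_prod :: "int mat \<Rightarrow> nat set \<Rightarrow> coeffs" where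
  "ell_prod B Y = (\<Otimes>\<^bsub>mpoly_ring (dim_col B)\<^esub> j \<in> Y. ell B j)"

text \<open>The substitution \<open>t\<^sub>j \<mapsto> (Bs)\<^sub>j\<close> from \<open>\<complex>[t]\<close> onto \<open>\<complex>[s]\<close>. The action of \<open>\<complex>[s] \<subseteq> \<complex>[[s]] \<simeq> R/U\<close>
  on the obstruction module is the action of \<open>\<complex>[t]\<close> transported along it.\<close>

definition gale_subst :: "int mat \<Rightarrow> coeffs \<Rightarrow> coeffs" where
  "gale_subst B f = (let S = mpoly_ring (dim_col B) in
     \<Oplus>\<^bsub>S\<^esub> p \<in> {p. f p \<noteq> 0}. mconst (dim_col B) (f p) \<otimes>\<^bsub>S\<^esub>
       (\<Otimes>\<^bsub>S\<^esub> j \<in> {..<dim_row B}. ell B j [^]\<^bsub>S\<^esub> (p $ j)))"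


section \<open>The ambient and intrinsic ideals\<close>

text \<open>The basis of the free module is indexed by the sets \<open>G\<^sub>i\<close> themselves. The grading shifts
  of \<open>F\<close> are omitted, as they do not affect annihilators.\<close>

definition free_F :: "nat \<Rightarrow> nat set set \<Rightarrow> (coeffs, nat set \<Rightarrow> coeffs) module" where
  "free_F r N = ring.func_space (mpoly_ring r) (min_G N)"

definition eta :: "nat \<Rightarrow> nat set set \<Rightarrow> nat set \<Rightarrow> nat set \<Rightarrow> coeffs" where
  "eta r N G = (\<lambda>G' \<in> min_G N. if G' = G then \<one>\<^bsub>mpoly_ring r\<^esub> else \<zero>\<^bsub>mpoly_ring r\<^esub>)"

definition relations_Z :: "int mat \<Rightarrow> int mat \<Rightarrow> complex vec \<Rightarrow> nat set set \<Rightarrow>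
    (nat set \<Rightarrow> nat set) \<Rightarrow> (nat set \<Rightarrow> coeffs) set" where
  "relations_Z A B v N \<iota> = (let r = dim_col B; F = free_F r N in
     module.span (mpoly_ring r) F
       ({(ell_prod B (G' - G) \<odot>\<^bsub>F\<^esub> eta r N G) \<ominus>\<^bsub>F\<^esub> (ell_prod B (G - G') \<odot>\<^bsub>F\<^esub> eta r N G')
         | G G'. G \<in> min_G N \<and> G' \<in> min_G N \<and> G \<noteq> G'} \<union>
        {ell_prod B (H - \<iota> H) \<odot>\<^bsub>F\<^esub> eta r N (\<iota> H) | H. H \<in> min_H A v N}))"

text \<open>\<open>\<iota>\<close> is the choice of some \<open>G\<^sub>i \<subseteq> H\<close> for each \<open>H\<close>, and \<open>G\<close> the choice of some \<open>G\<^sub>i \<subseteq> E\<close>.\<close>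

definition admissible_choice :: "int mat \<Rightarrow> complex vec \<Rightarrow> nat set set \<Rightarrow>
    (nat set \<Rightarrow> nat set) \<Rightarrow> nat set \<Rightarrow> bool" where
  "admissible_choice A v N \<iota> G \<longleftrightarrow> (\<forall>H \<in> min_H A v N. \<iota> H \<in> min_G N \<and> \<iota> H \<subseteq> H) \<and>
     G \<in> min_G N \<and> G \<subseteq> nsupp v - \<Inter>N"

definition epsilon :: "int mat \<Rightarrow> int mat \<Rightarrow> complex vec \<Rightarrow> nat set set \<Rightarrow>
    (nat set \<Rightarrow> nat set) \<Rightarrow> nat set \<Rightarrow> (nat set \<Rightarrow> coeffs) set" where
  "epsilon A B v N \<iota> G = (let r = dim_col B; F = free_F r N in
     relations_Z A B v N \<iota> +>\<^bsub>F\<^esub> (ell_prod B ((nsupp v - \<Inter>N) - G) \<odot>\<^bsub>F\<^esub> eta r N G))"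

definition ideal_J_amb :: "int mat \<Rightarrow> int mat \<Rightarrow> complex vec \<Rightarrow> nat set set \<Rightarrow>
    (nat set \<Rightarrow> nat set) \<Rightarrow> nat set \<Rightarrow> coeffs set" where
  "ideal_J_amb A B v N \<iota> G = (let r = dim_col B;
       Q = quot_module (free_F r N) (relations_Z A B v N \<iota>) in
     {f \<in> carrier (mpoly_ring r). f \<odot>\<^bsub>Q\<^esub> epsilon A B v N \<iota> G = \<zero>\<^bsub>Q\<^esub>})"

definition ideal_ell_H :: "int mat \<Rightarrow> int mat \<Rightarrow> complex vec \<Rightarrow> nat set set \<Rightarrow> coeffs set" where
  "ideal_ell_H A B v N = Idl\<^bsub>mpoly_ring (dim_col B)\<^esub> (ell_prod B ` min_H A v N)"

definition ideal_J_intr :: "int mat \<Rightarrow> int mat \<Rightarrow> complex vec \<Rightarrow> nat set set \<Rightarrow> coeffs set" where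
  "ideal_J_intr A B v N =
     colon (mpoly_ring (dim_col B)) (ideal_ell_H A B v N) (ell_prod B (nsupp v - \<Inter>N))"


section \<open>Coefficient spaces\<close>

text \<open>A formal series \<open>\<Sum>\<^sub>u x\<^sup>v\<^sup>+\<^sup>u p\<^sub>u(log x)\<close>, with \<open>u\<close> ranging over \<open>\<int>\<^sup>n\<close>, is given by \<open>u \<mapsto> p\<^sub>u\<close>; the
  polynomial \<open>p\<^sub>u\<close> is in the variables \<open>y\<^sub>j = log x\<^sub>j\<close>. The Weyl algebra acts by
  \<open>\<partial>\<^sub>j (x\<^sup>z p) = x\<^sup>z\<^sup>-\<^sup>e\<^sup>j (z\<^sub>j p + \<partial>p/\<partial>y\<^sub>j)\<close>.\<close>

type_synonym log_series = "int vec \<Rightarrow> coeffs"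

definition mderiv :: "nat \<Rightarrow> coeffs \<Rightarrow> coeffs" where
  "mderiv j f = (\<lambda>p. of_nat (p $ j + 1) * f (p + unit_vec (dim_vec p) j))"

definition series_deriv :: "complex vec \<Rightarrow> nat \<Rightarrow> log_series \<Rightarrow> log_series" where
  "series_deriv v j \<phi> = (\<lambda>u. let u' = u + unit_vec (dim_vec u) j in
     (\<lambda>p. (v $ j + of_int (u' $ j)) * \<phi> u' p + mderiv j (\<phi> u') p))"

definition multi_op :: "(nat \<Rightarrow> 'a \<Rightarrow> 'a) \<Rightarrow> nat vec \<Rightarrow> 'a \<Rightarrow> 'a" where
  "multi_op D b = fold (\<lambda>j. D j ^^ (b $ j)) [0..<dim_vec b]"

definition weyl_act :: "complex vec \<Rightarrow> weyl \<Rightarrow> log_series \<Rightarrow> log_series" where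
  "weyl_act v P \<phi> = (\<lambda>u p. \<Sum>(a, b) \<in> {m. P m \<noteq> 0}.
     P (a, b) * multi_op (series_deriv v) b \<phi> (u - map_vec int a) p)"

definition ambient_coefficients ::
    "int mat \<Rightarrow> complex vec \<Rightarrow> complex vec \<Rightarrow> nat set set \<Rightarrow> coeffs set" where
  "ambient_coefficients A \<beta> v N = (let n = dim_col A in
     {\<phi> (0\<^sub>v n) | \<phi>.
        (\<forall>u. \<phi> u \<in> carrier (mpoly_ring n)) \<and>
        (\<forall>u. \<phi> u \<noteq> (\<lambda>_. 0) \<longrightarrow> u \<in> mat_kernel A \<and> nsupp_at v u \<in> N) \<and>
        (\<forall>P \<in> hypergeometric_ideal A \<beta>. \<forall>u \<in> carrier_vec n. weyl_act v P \<phi> u = (\<lambda>_. 0))})"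

definition ambient_space ::
    "int mat \<Rightarrow> complex vec \<Rightarrow> complex vec \<Rightarrow> nat set set \<Rightarrow> (complex, coeffs) module" where
  "ambient_space A \<beta> v N = complex_space (dim_col A)
     (ideal_module (mpoly_ring (dim_col A)) (ambient_coefficients A \<beta> v N))"

text \<open>\<open>[c + Bs]\<^sub>p\<close> as a polynomial in \<open>s\<close>.\<close>

definition falling_s :: "int mat \<Rightarrow> complex vec \<Rightarrow> nat vec \<Rightarrow> coeffs" where
  "falling_s B c p = (let S = mpoly_ring (dim_col B) in
     \<Otimes>\<^bsub>S\<^esub> j \<in> {..<dim_vec p}. \<Otimes>\<^bsub>S\<^esub> k \<in> {..<p $ j}.
       mconst (dim_col B) (c $ j - of_nat k) \<oplus>\<^bsub>S\<^esub> ell B j)"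

text \<open>\<open>\<ell>\<^sup>E a\<^sub>u(s)\<close> as a power series in \<open>s\<close>. The poles of \<open>a\<^sub>u\<close> at \<open>s = 0\<close> are cancelled by \<open>\<ell>\<^sup>E\<close>
  when \<open>I\<^sub>u \<in> N\<close>, so the fraction is written as the solution of the cleared equation.\<close>

definition scaled_a :: "int mat \<Rightarrow> complex vec \<Rightarrow> nat set set \<Rightarrow> int vec \<Rightarrow> coeffs" where
  "scaled_a B v N u = (let R = mfps_ring (dim_col B) in
     THE g. g \<in> carrier R \<and>
       g \<otimes>\<^bsub>R\<^esub> falling_s B (v + map_vec of_int u) (pos_part u) =
       ell_prod B (nsupp v - \<Inter>N) \<otimes>\<^bsub>R\<^esub> falling_s B v (neg_part u))"

text \<open>The coefficient of \<open>s\<^sup>\<alpha>\<close> in \<open>x\<^sup>B\<^sup>s = exp (\<Sum>\<^sub>i s\<^sub>i (\<Sum>\<^sub>j B\<^sub>j\<^sub>i log x\<^sub>j))\<close>, a polynomial in \<open>log x\<close>.\<close>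

definition x_Bs :: "int mat \<Rightarrow> nat vec \<Rightarrow> coeffs" where
  "x_Bs B \<alpha> = (let n = dim_row B; r = dim_col B; R = mpoly_ring n in
     if \<alpha> \<in> carrier_vec r then
       mconst n (1 / (\<Prod>i<r. fact (\<alpha> $ i))) \<otimes>\<^bsub>R\<^esub>
       (\<Otimes>\<^bsub>R\<^esub> i \<in> {..<r}. linform n (\<lambda>j. of_int (B $$ (j, i))) [^]\<^bsub>R\<^esub> (\<alpha> $ i))
     else \<zero>\<^bsub>R\<^esub>)"

text \<open>\<open>Psi A B v N u \<gamma> p\<close> is the coefficient of \<open>x\<^sup>v\<^sup>+\<^sup>u s\<^sup>\<gamma> (log x)\<^sup>p\<close> in \<open>\<Psi>\<^sub>N(x, s)\<close>.\<close>

definition Psi :: "int mat \<Rightarrow> int mat \<Rightarrow> complex vec \<Rightarrow> nat set set \<Rightarrow>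
    int vec \<Rightarrow> nat vec \<Rightarrow> coeffs" where
  "Psi A B v N u \<gamma> p =
     (if u \<in> mat_kernel A \<and> nsupp_at v u \<in> N
      then (scaled_a B v N u \<otimes>\<^bsub>mfps_ring (dim_col B)\<^esub> (\<lambda>\<alpha>. x_Bs B \<alpha> p)) \<gamma> else 0)"

text \<open>\<open>(q(\<partial>\<^sub>s) f) |\<^sub>s\<^sub>=\<^sub>0\<close>\<close>

definition diff_at_0 :: "nat \<Rightarrow> coeffs \<Rightarrow> coeffs \<Rightarrow> complex" where
  "diff_at_0 r q f = (\<Sum>\<gamma> \<in> {\<gamma>. q \<gamma> \<noteq> 0}. q \<gamma> * multi_op mderiv \<gamma> f (0\<^sub>v r))"

definition orthogonal :: "nat \<Rightarrow> coeffs set \<Rightarrow> coeffs set" where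
  "orthogonal r I = {q \<in> carrier (mpoly_ring r). \<forall>f \<in> I. diff_at_0 r q f = 0}"

definition intrinsic_coefficients ::
    "int mat \<Rightarrow> int mat \<Rightarrow> complex vec \<Rightarrow> nat set set \<Rightarrow> coeffs set" where
  "intrinsic_coefficients A B v N = (let r = dim_col B in
     {(\<lambda>p. diff_at_0 r q (\<lambda>\<gamma>. Psi A B v N (0\<^sub>v (dim_col A)) \<gamma> p))
      | q. q \<in> orthogonal r (ideal_ell_H A B v N)})"

end

theory Submission
  imports Defs "HOL-Algebra.Subrings" "HOL-Computational_Algebra.Formal_Power_Series"
begin

unbundle no fps_syntax
hide_const (open) Multiset.mult

text \<open>
  The kernel of \<open>A\<close> is spanned by \<open>b = (1, 1, -2, -1, 1)\<close>, and \<open>v = (-1, -1, 0, 1, 0)\<close>. Along the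
  line \<open>v + k b\<close> the negative supports are \<open>{0, 1, 4}\<close> for \<open>k < 0\<close>, \<open>{0, 1}\<close> for \<open>k = 0\<close>, \<open>{2}\<close>
  for \<open>k = 1\<close> and \<open>{2, 3}\<close> for \<open>k > 1\<close>. For the family \<open>{{0, 1}, {2}}\<close> we have \<open>e = t\<^sub>0 t\<^sub>1\<close> and the
  generator \<open>t\<^sub>2 t\<^sub>3\<close> of \<open>P\<close>. Modulo \<open>U\<close> every \<open>t\<^sub>i\<close> is a multiple of one variable \<open>s\<close>, so
  \<open>e\<close> and \<open>t\<^sub>2 t\<^sub>3\<close> become multiples of \<open>s\<^sup>2\<close>: hence \<open>e\<close> lies in \<open>U + P\<close> and the intrinsic ideal is
  everything. But every product of a linear form in \<open>U\<close> with \<open>t\<^sub>2\<close> lacks the monomial \<open>t\<^sub>0 t\<^sub>1\<close>, so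
  \<open>e\<close> is not in \<open>U M + P\<close>, although each \<open>t\<^sub>i e\<close> is. The obstruction module is therefore the
  residue field. On the other side \<open>x\<^sup>v\<close> itself is a solution, while the equation of the binomial
  \<open>\<partial>\<^sub>0 \<partial>\<^sub>1 \<partial>\<^sub>4 - \<partial>\<^sub>2\<^sup>2 \<partial>\<^sub>3\<close> at \<open>x\<^sup>v\<close> forces the coefficient of \<open>x\<^sup>v\<close> to be a constant.
\<close>

section \<open>Rings of power series and polynomials\<close>

text \<open>Since L has rank one and b has no zero entry, every l^Y is a nonzero multiple of s^|Y|.
  The intrinsic ideal therefore sees only sizes, and |{0, 1}| = |{2, 3}| makes it trivial. The
  ambient module keeps the generators {0, 1} and {2} apart: a minimal H contributes s^|H - G| in the
  slot of its own G. Both differences, {4} and {3}, are singletons, so F/Z is F/sF, and the slot of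
  {0, 1} is annihilated exactly by the multiples of s. The entries of b sum to 0, which gives
  homogeneity, and v_2 = v_4 = 0 makes both monomials of every toric binomial kill x^v.

  Two clauses speak of the whole left ideal H_A(\<beta>). Genericity is obtained from the grading by
  Z^d instead of a Groebner basis: initial ideals depend only on signs of weights on L, and in rank
  one an open half-space of weights has the same signs. That all of H_A(\<beta>) annihilates x^v is
  reduced to generators by multiplicativity of the action on monomials, which comes down to the
  Vandermonde identity for falling factorials.\<close>

lemma finite_le_vec: "finite {q::nat vec. q \<le> p}"
proof -
  have "q \<in> vec (dim_vec p) ` (\<Pi>\<^sub>E i\<in>{..<dim_vec p}. {..p $ i})" if "q \<le> p" for q
  proof
    show "q = vec (dim_vec p) (\<lambda>i\<in>{..<dim_vec p}. q $ i)"
      using that by (auto simp: less_eq_vec_def)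
    show "(\<lambda>i\<in>{..<dim_vec p}. q $ i) \<in> (\<Pi>\<^sub>E i\<in>{..<dim_vec p}. {..p $ i})"
      using that by (auto simp: less_eq_vec_def)
  qed
  then have "{q. q \<le> p} \<subseteq> vec (dim_vec p) ` (\<Pi>\<^sub>E i\<in>{..<dim_vec p}. {..p $ i})" by blast
  then show ?thesis by (rule finite_subset) (auto intro!: finite_imageI finite_PiE)
qed

lemma le_vec_dim: "q \<le> p \<Longrightarrow> dim_vec q = dim_vec p"
  by (simp add: less_eq_vec_def)

lemma le_vec_carrier: "(q::nat vec) \<le> p \<Longrightarrow> q \<in> carrier_vec n \<longleftrightarrow> p \<in> carrier_vec n"
  by (auto simp: less_eq_vec_def)

lemma minus_le_vec: "(q::nat vec) \<le> p \<Longrightarrow> p - q \<le> p"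
  by (auto simp: less_eq_vec_def)

lemma minus_minus_vec: "(q::nat vec) \<le> p \<Longrightarrow> p - (p - q) = q"
  by (auto simp: less_eq_vec_def)

lemma add_minus_vec: "(q::nat vec) \<le> p \<Longrightarrow> q + (p - q) = p"
  by (auto simp: less_eq_vec_def)

lemma minus_add_vec: "(q::nat vec) \<le> p \<Longrightarrow> (p - q) + q = p"
  by (auto simp: less_eq_vec_def)

lemma le_zero_vec: "(q::nat vec) \<le> 0\<^sub>v n \<longleftrightarrow> q = 0\<^sub>v n"
  by (auto simp: less_eq_vec_def)

lemma mmonom_apply: "mmonom p q = (if q = p then 1 else 0)"
  by (simp add: mmonom_def)

lemma mfps_ring_simps:
  "carrier (mfps_ring n) = {f. \<forall>p. f p \<noteq> 0 \<longrightarrow> p \<in> carrier_vec n}"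
  "f \<otimes>\<^bsub>mfps_ring n\<^esub> g = (\<lambda>p. \<Sum>q \<in> {q. q \<le> p}. f q * g (p - q))"
  "\<one>\<^bsub>mfps_ring n\<^esub> = mmonom (0\<^sub>v n)"
  "\<zero>\<^bsub>mfps_ring n\<^esub> = (\<lambda>p. 0)"
  "f \<oplus>\<^bsub>mfps_ring n\<^esub> g = (\<lambda>p. f p + g p)"
  by (auto simp: mfps_ring_def mmonom_def)

lemma mpoly_ring_simps:
  "carrier (mpoly_ring n) = {f. (\<forall>p. f p \<noteq> 0 \<longrightarrow> p \<in> carrier_vec n) \<and> finite {p. f p \<noteq> 0}}"
  "mult (mpoly_ring n) = mult (mfps_ring n)"
  "\<one>\<^bsub>mpoly_ring n\<^esub> = mmonom (0\<^sub>v n)"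
  "\<zero>\<^bsub>mpoly_ring n\<^esub> = (\<lambda>p. 0)"
  "f \<oplus>\<^bsub>mpoly_ring n\<^esub> g = (\<lambda>p. f p + g p)"
  by (auto simp: mpoly_ring_def mfps_ring_def mmonom_def)

lemma mpoly_carrier_subset: "carrier (mpoly_ring n) \<subseteq> carrier (mfps_ring n)"
  by (auto simp: mpoly_ring_def)

lemma mmonom_mult:
  "(mmonom q \<otimes>\<^bsub>mfps_ring n\<^esub> f) p = (if q \<le> p then f (p - q) else 0)"
proof -
  have "(mmonom q \<otimes>\<^bsub>mfps_ring n\<^esub> f) p = (\<Sum>r\<in>{r. r \<le> p}. if q = r then f (p - r) else 0)"
    unfolding mfps_ring_simps by (intro sum.cong) (auto simp: mmonom_def)
  then show ?thesis by (simp add: sum.delta finite_le_vec)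
qed

lemma mfps_mult_comm: "f \<otimes>\<^bsub>mfps_ring n\<^esub> g = g \<otimes>\<^bsub>mfps_ring n\<^esub> f"
proof
  fix p :: "nat vec"
  show "(f \<otimes>\<^bsub>mfps_ring n\<^esub> g) p = (g \<otimes>\<^bsub>mfps_ring n\<^esub> f) p"
    unfolding mfps_ring_simps
    by (rule sum.reindex_bij_witness[of _ "\<lambda>q. p - q" "\<lambda>q. p - q"])
       (auto simp: minus_le_vec minus_minus_vec)
qed

text \<open>A chain r <= q <= p carries the same data as r together with the difference q - r <= p -
  r. This reindexing turns one triple sum into the other.\<close>

lemma mfps_mult_assoc:
  "(f \<otimes>\<^bsub>mfps_ring n\<^esub> g) \<otimes>\<^bsub>mfps_ring n\<^esub> h = f \<otimes>\<^bsub>mfps_ring n\<^esub> (g \<otimes>\<^bsub>mfps_ring n\<^esub> h)"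
proof
  fix p :: "nat vec"
  have "(\<Sum>q\<in>{q. q \<le> p}. \<Sum>r\<in>{r. r \<le> q}. f r * g (q - r) * h (p - q))
      = (\<Sum>r\<in>{r. r \<le> p}. \<Sum>s\<in>{s. s \<le> p - r}. f r * g s * h (p - r - s))"
    unfolding sum.Sigma[OF finite_le_vec ballI[OF finite_le_vec]]
  proof (rule sum.reindex_bij_witness[of _ "\<lambda>(r, s). (r + s, r)" "\<lambda>(q, r). (r, q - r)"], goal_cases)
    case (1 a)
    then show ?case by (auto simp: add_minus_vec)
  next
    case (2 a)
    then show ?case by (auto simp: less_eq_vec_def) (meson order.trans)
  next
    case (3 a)
    then show ?case by (auto simp: less_eq_vec_def)
  next
    case (4 a)
    then show ?case by (auto simp: less_eq_vec_def le_diff_conv2 add.commute)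
  next
    case (5 a)
    obtain q r where a: "a = (q, r)" by (cases a)
    with 5 have "p - r - (q - r) = p - q" by (auto simp: less_eq_vec_def)
    with a show ?case by simp
  qed
  then show "((f \<otimes>\<^bsub>mfps_ring n\<^esub> g) \<otimes>\<^bsub>mfps_ring n\<^esub> h) p = (f \<otimes>\<^bsub>mfps_ring n\<^esub> (g \<otimes>\<^bsub>mfps_ring n\<^esub> h)) p"
    unfolding mfps_ring_simps by (simp add: sum_distrib_left sum_distrib_right mult.assoc)
qed

lemma mfps_mult_closed:
  assumes "f \<in> carrier (mfps_ring n)"
  shows "f \<otimes>\<^bsub>mfps_ring n\<^esub> g \<in> carrier (mfps_ring n)"
proof -
  have "p \<in> carrier_vec n" if "(f \<otimes>\<^bsub>mfps_ring n\<^esub> g) p \<noteq> 0" for p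
  proof (rule ccontr)
    assume "p \<notin> carrier_vec n"
    then have "(f \<otimes>\<^bsub>mfps_ring n\<^esub> g) p = 0"
      unfolding mfps_ring_simps using assms
      by (intro sum.neutral) (auto simp: mfps_ring_simps dest: le_vec_carrier)
    with that show False by simp
  qed
  then show ?thesis unfolding mfps_ring_simps by simp
qed

lemma mfps_one_mult:
  assumes "f \<in> carrier (mfps_ring n)"
  shows "\<one>\<^bsub>mfps_ring n\<^esub> \<otimes>\<^bsub>mfps_ring n\<^esub> f = f"
proof
  fix p :: "nat vec"
  have "p \<in> carrier_vec n \<Longrightarrow> 0\<^sub>v n \<le> p \<and> p - 0\<^sub>v n = p" by (auto simp: less_eq_vec_def)
  moreover have "p \<notin> carrier_vec n \<Longrightarrow> \<not> 0\<^sub>v n \<le> p \<and> f p = 0"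
    using assms by (auto simp: less_eq_vec_def mfps_ring_simps)
  ultimately show "(\<one>\<^bsub>mfps_ring n\<^esub> \<otimes>\<^bsub>mfps_ring n\<^esub> f) p = f p"
    unfolding mfps_ring_simps(3) mmonom_mult by (cases "p \<in> carrier_vec n") auto
qed

lemma mfps_cring: "cring (mfps_ring n)"
proof (rule cringI)
  show "abelian_group (mfps_ring n)"
  proof (rule abelian_groupI)
    fix f assume f: "f \<in> carrier (mfps_ring n)"
    show "\<exists>g\<in>carrier (mfps_ring n). g \<oplus>\<^bsub>mfps_ring n\<^esub> f = \<zero>\<^bsub>mfps_ring n\<^esub>"
      by (rule bexI[of _ "\<lambda>p. - f p"]) (use f in \<open>auto simp: mfps_ring_simps\<close>)
    fix g assume g: "g \<in> carrier (mfps_ring n)"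
    show "f \<oplus>\<^bsub>mfps_ring n\<^esub> g \<in> carrier (mfps_ring n)"
      unfolding mfps_ring_simps mem_Collect_eq
    proof (intro allI impI)
      fix p assume "f p + g p \<noteq> 0"
      then have "f p \<noteq> 0 \<or> g p \<noteq> 0" by auto
      then show "p \<in> carrier_vec n" using f g by (auto simp: mfps_ring_simps)
    qed
  qed (auto simp: mfps_ring_simps)
  show "comm_monoid (mfps_ring n)"
    by (rule comm_monoidI)
      (auto simp: mfps_mult_closed mfps_one_mult mfps_mult_assoc,
       auto simp: mfps_ring_simps(1,3) mmonom_def mfps_mult_comm)
qed (auto simp: mfps_ring_simps sum.distrib distrib_right)

interpretation mfps: cring "mfps_ring n" for n by (rule mfps_cring)

lemma mfps_a_inv:
  assumes "f \<in> carrier (mfps_ring n)"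
  shows "\<ominus>\<^bsub>mfps_ring n\<^esub> f = (\<lambda>p. - f p)"
  by (rule mfps.minus_equality) (use assms in \<open>auto simp: mfps_ring_simps\<close>)

lemma mfps_minus:
  assumes "g \<in> carrier (mfps_ring n)"
  shows "f \<ominus>\<^bsub>mfps_ring n\<^esub> g = (\<lambda>p. f p - g p)"
  using assms by (simp add: a_minus_def mfps_a_inv mfps_ring_simps(5))

lemma mpoly_mult_finite:
  assumes "finite {p. f p \<noteq> 0}" "finite {p. g p \<noteq> 0}"
  shows "finite {p. (f \<otimes>\<^bsub>mfps_ring n\<^esub> g) p \<noteq> 0}"
proof (rule finite_subset)
  show "finite ((\<lambda>(a, b). a + b) ` ({p. f p \<noteq> 0} \<times> {p. g p \<noteq> 0}))" using assms by blast
  show "{p. (f \<otimes>\<^bsub>mfps_ring n\<^esub> g) p \<noteq> 0} \<subseteq> (\<lambda>(a, b). a + b) ` ({p. f p \<noteq> 0} \<times> {p. g p \<noteq> 0})"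
  proof
    fix p assume "p \<in> {p. (f \<otimes>\<^bsub>mfps_ring n\<^esub> g) p \<noteq> 0}"
    then obtain q where "q \<le> p" "f q * g (p - q) \<noteq> 0"
      unfolding mfps_ring_simps by (auto elim: sum.not_neutral_contains_not_neutral)
    then show "p \<in> (\<lambda>(a, b). a + b) ` ({p. f p \<noteq> 0} \<times> {p. g p \<noteq> 0})"
      by (intro image_eqI[of _ _ "(q, p - q)"]) (auto simp: add_minus_vec)
  qed
qed

text \<open>As a subring of the power series the polynomials inherit every axiom. Of the closure
  properties only finiteness of the support of a product takes an argument.\<close>

lemma mpoly_cring: "cring (mpoly_ring n)"
proof -
  have "subring (carrier (mpoly_ring n)) (mfps_ring n)"
  proof (rule mfps.subringI)
    show "carrier (mpoly_ring n) \<subseteq> carrier (mfps_ring n)" by (rule mpoly_carrier_subset)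
    show "\<one>\<^bsub>mfps_ring n\<^esub> \<in> carrier (mpoly_ring n)"
      by (auto simp: mfps_ring_simps(3) mpoly_ring_simps(1) mmonom_def)
    fix f assume f: "f \<in> carrier (mpoly_ring n)"
    then show "\<ominus>\<^bsub>mfps_ring n\<^esub> f \<in> carrier (mpoly_ring n)"
      using mpoly_carrier_subset[of n] by (subst mfps_a_inv) (auto simp: mpoly_ring_simps(1))
    fix g assume g: "g \<in> carrier (mpoly_ring n)"
    show "f \<otimes>\<^bsub>mfps_ring n\<^esub> g \<in> carrier (mpoly_ring n)"
      using f g mfps_mult_closed[of f n g] mpoly_mult_finite[of f g n]
      by (auto simp: mpoly_ring_simps(1) mfps_ring_simps(1))
    show "f \<oplus>\<^bsub>mfps_ring n\<^esub> g \<in> carrier (mpoly_ring n)"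
      using f g mfps.a_closed[of f n g] unfolding mpoly_ring_simps(1) mfps_ring_simps(1,5)
      by (auto intro: finite_subset[of _ "{p. f p \<noteq> 0} \<union> {p. g p \<noteq> 0}"])
  qed
  then have "cring (mfps_ring n \<lparr>carrier := carrier (mpoly_ring n)\<rparr>)"
    using mfps.subcringI' mfps.subcring_iff[OF mpoly_carrier_subset] by blast
  then show ?thesis by (simp add: mpoly_ring_def)
qed

interpretation mpoly: cring "mpoly_ring n" for n by (rule mpoly_cring)

lemma mpoly_a_inv:
  assumes "f \<in> carrier (mpoly_ring n)"
  shows "\<ominus>\<^bsub>mpoly_ring n\<^esub> f = (\<lambda>p. - f p)"
  by (rule mpoly.minus_equality) (use assms in \<open>auto simp: mpoly_ring_simps\<close>)

lemma mpoly_minus: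
  assumes "g \<in> carrier (mpoly_ring n)"
  shows "f \<ominus>\<^bsub>mpoly_ring n\<^esub> g = (\<lambda>p. f p - g p)"
  using assms by (simp add: a_minus_def mpoly_a_inv mpoly_ring_simps(5))

lemma mmonom_in_mpoly [simp]: "mmonom p \<in> carrier (mpoly_ring n) \<longleftrightarrow> p \<in> carrier_vec n"
  by (auto simp: mpoly_ring_simps mmonom_def)

lemma mmonom_in_mfps [simp]: "mmonom p \<in> carrier (mfps_ring n) \<longleftrightarrow> p \<in> carrier_vec n"
  by (auto simp: mfps_ring_simps mmonom_def)

lemma mconst_in_mpoly [simp]: "mconst n c \<in> carrier (mpoly_ring n)"
  by (auto simp: mpoly_ring_simps mconst_def)

lemma mconst_in_mfps [simp]: "mconst n c \<in> carrier (mfps_ring n)"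
  by (auto simp: mfps_ring_simps mconst_def)

lemma linform_in_mpoly [simp]: "linform n c \<in> carrier (mpoly_ring n)"
proof -
  have "\<exists>j<n. p = unit_vec n j" if "linform n c p \<noteq> 0" for p
    using that unfolding linform_def
    by (auto simp: mmonom_def elim!: sum.not_neutral_contains_not_neutral split: if_splits)
  then have "{p. linform n c p \<noteq> 0} \<subseteq> unit_vec n ` {..<n}" by blast
  then show ?thesis
    unfolding mpoly_ring_simps(1)
    by (auto intro: finite_subset)
qed

lemma linform_in_mfps [simp]: "linform n c \<in> carrier (mfps_ring n)"
  using mpoly_carrier_subset linform_in_mpoly by blast

lemma mmonom_mult_mmonom:
  assumes "p \<in> carrier_vec n" "q \<in> carrier_vec n"
  shows "mmonom p \<otimes>\<^bsub>mfps_ring m\<^esub> mmonom q = mmonom (p + q)"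
proof
  fix r
  have "(p \<le> r \<and> r - p = q) \<longleftrightarrow> r = p + q"
    using assms by (auto simp: less_eq_vec_def)
  then show "(mmonom p \<otimes>\<^bsub>mfps_ring m\<^esub> mmonom q) r = mmonom (p + q) r"
    unfolding mmonom_mult by (auto simp: mmonom_def)
qed

lemma mconst_mult:
  assumes "f \<in> carrier (mfps_ring n)"
  shows "mconst n c \<otimes>\<^bsub>mfps_ring n\<^esub> f = (\<lambda>p. c * f p)"
proof -
  have "mconst n c \<otimes>\<^bsub>mfps_ring n\<^esub> f = (\<lambda>p. c * (\<one>\<^bsub>mfps_ring n\<^esub> \<otimes>\<^bsub>mfps_ring n\<^esub> f) p)"
    unfolding mfps_ring_simps(2,3)
    by (auto simp: sum_distrib_left mconst_def mmonom_def intro!: ext sum.cong)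
  then show ?thesis using mfps_one_mult[OF assms] by simp
qed

lemma mult_at_0: "(f \<otimes>\<^bsub>mfps_ring n\<^esub> g) (0\<^sub>v n) = f (0\<^sub>v n) * g (0\<^sub>v n)"
proof -
  have "0\<^sub>v n - 0\<^sub>v n = (0\<^sub>v n :: nat vec)" by auto
  then show ?thesis by (simp add: mfps_ring_simps le_zero_vec)
qed

lemma linform_at_0: "linform n c (0\<^sub>v n) = 0"
proof -
  have "mmonom (unit_vec n j) (0\<^sub>v n) = 0" if "j < n" for j
    using that unit_vec_nonzero[of j n] by (auto simp: mmonom_def dest!: sym[of "0\<^sub>v n"])
  then show ?thesis by (simp add: linform_def)
qed

text \<open>Negation is multiplication by -1, so it is covered by absorption.\<close>

lemma (in cring) ideal_commI:
  assumes "I \<subseteq> carrier R" "\<zero> \<in> I" "\<And>a b. a \<in> I \<Longrightarrow> b \<in> I \<Longrightarrow> a \<oplus> b \<in> I"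
    "\<And>x a. x \<in> carrier R \<Longrightarrow> a \<in> I \<Longrightarrow> x \<otimes> a \<in> I"
  shows "ideal I R"
proof (rule idealI)
  show "ring R" by (rule ring_axioms)
  show "subgroup I (add_monoid R)"
  proof (rule add.subgroupI)
    fix a assume a: "a \<in> I"
    then have "\<ominus> a = (\<ominus> \<one>) \<otimes> a" using assms(1) by (auto simp: l_minus)
    then show "\<ominus> a \<in> I" using assms(4) a by simp
  qed (use assms in auto)
  fix a x assume "a \<in> I" "x \<in> carrier R"
  then show "x \<otimes> a \<in> I" "a \<otimes> x \<in> I" using assms(1,4) m_comm[of a x] by auto
qed

lemma (in cring) genideal_memberI:
  assumes "\<And>I. ideal I R \<Longrightarrow> S \<subseteq> I \<Longrightarrow> f \<in> I"
  shows "f \<in> Idl S"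
  using assms by (auto simp: genideal_def)

text \<open>Here the index set is a product of supports that does not depend on p, so the sum can be
  exchanged with a sum over p. The test on dimensions is there because vectors of different lengths
  can also be added, while q <= p only admits equal lengths.\<close>

lemma mpoly_mult_eq_sum:
  assumes "finite {q. x q \<noteq> 0}" "finite {r. f r \<noteq> 0}"
  shows "(x \<otimes>\<^bsub>mfps_ring n\<^esub> f) p =
    (\<Sum>(q, r)\<in>{q. x q \<noteq> 0} \<times> {r. f r \<noteq> 0}.
       if dim_vec q = dim_vec r \<and> q + r = p then x q * f r else 0)"
proof -
  have aux: "a + b - a = b" if "dim_vec a = dim_vec b" for a b :: "nat vec"
    using that by auto
  have "(x \<otimes>\<^bsub>mfps_ring n\<^esub> f) p = (\<Sum>q\<in>{q. q \<le> p \<and> x q \<noteq> 0 \<and> f (p - q) \<noteq> 0}. x q * f (p - q))"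
    unfolding mfps_ring_simps by (rule sum.mono_neutral_right) (auto simp: finite_le_vec)
  also have "\<dots> = (\<Sum>(q, r)\<in>{(q, r). x q \<noteq> 0 \<and> f r \<noteq> 0 \<and> dim_vec q = dim_vec r \<and> q + r = p}. x q * f r)"
    by (rule sum.reindex_bij_witness[of _ "\<lambda>(q, r). q" "\<lambda>q. (q, p - q)"])
       (auto simp: add_minus_vec aux less_eq_vec_def)
  also have "\<dots> = (\<Sum>(q, r)\<in>{q. x q \<noteq> 0} \<times> {r. f r \<noteq> 0}.
       if dim_vec q = dim_vec r \<and> q + r = p then x q * f r else 0)"
    by (rule sum.mono_neutral_cong_left) (use assms in \<open>auto split: if_splits\<close>)
  finally show ?thesis .
qed

section \<open>The Weyl algebra and its grading\<close>

lemma weyl_ring_simps: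
  "carrier (weyl_ring n) = {P. finite {m. P m \<noteq> 0} \<and> {m. P m \<noteq> 0} \<subseteq> carrier_vec n \<times> carrier_vec n}"
  "mult (weyl_ring n) = weyl_mult"
  "\<zero>\<^bsub>weyl_ring n\<^esub> = (\<lambda>m. 0)"
  "P \<oplus>\<^bsub>weyl_ring n\<^esub> Q = (\<lambda>m. P m + Q m)"
  by (auto simp: weyl_ring_def)

lemma weyl_add_closed:
  assumes "P \<in> carrier (weyl_ring n)" "Q \<in> carrier (weyl_ring n)"
  shows "(\<lambda>m. P m + Q m) \<in> carrier (weyl_ring n)"
proof -
  have "{m. P m + Q m \<noteq> 0} \<subseteq> {m. P m \<noteq> 0} \<union> {m. Q m \<noteq> 0}" by auto
  with assms show ?thesis
    unfolding weyl_ring_simps(1) mem_Collect_eq by (meson Un_least finite_Un finite_subset subset_trans)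
qed

lemma weyl_abelian_group: "abelian_group (weyl_ring n)"
proof (rule abelian_groupI)
  fix P assume P: "P \<in> carrier (weyl_ring n)"
  show "\<exists>Q\<in>carrier (weyl_ring n). Q \<oplus>\<^bsub>weyl_ring n\<^esub> P = \<zero>\<^bsub>weyl_ring n\<^esub>"
    by (rule bexI[of _ "\<lambda>m. - P m"]) (use P in \<open>auto simp: weyl_ring_simps\<close>)
  fix Q assume Q: "Q \<in> carrier (weyl_ring n)"
  show "P \<oplus>\<^bsub>weyl_ring n\<^esub> Q \<in> carrier (weyl_ring n)"
    using weyl_add_closed[OF P Q] by (simp add: weyl_ring_simps(4))
qed (auto simp: weyl_ring_simps)

interpretation weyl: abelian_group "weyl_ring n" for n by (rule weyl_abelian_group)

lemma weyl_a_inv: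
  assumes "P \<in> carrier (weyl_ring n)"
  shows "\<ominus>\<^bsub>weyl_ring n\<^esub> P = (\<lambda>m. - P m)"
  by (rule weyl.minus_equality) (use assms in \<open>auto simp: weyl_ring_simps\<close>)

lemma left_ideal_weylI:
  assumes "I \<subseteq> carrier (weyl_ring n)" "(\<lambda>m. 0) \<in> I"
    "\<And>P Q. P \<in> I \<Longrightarrow> Q \<in> I \<Longrightarrow> (\<lambda>m. P m + Q m) \<in> I"
    "\<And>P. P \<in> I \<Longrightarrow> (\<lambda>m. - P m) \<in> I"
    "\<And>x P. x \<in> carrier (weyl_ring n) \<Longrightarrow> P \<in> I \<Longrightarrow> weyl_mult x P \<in> I"
  shows "left_ideal I (weyl_ring n)"
  unfolding left_ideal_def
proof
  show "additive_subgroup I (weyl_ring n)"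
    by (rule additive_subgroupI, rule weyl.add.subgroupI)
      (use assms in \<open>auto simp: weyl_ring_simps(4) weyl_a_inv subset_iff simp flip: a_inv_def\<close>)
  show "\<forall>x\<in>carrier (weyl_ring n). \<forall>a\<in>I. x \<otimes>\<^bsub>weyl_ring n\<^esub> a \<in> I"
    using assms(5) by (simp add: weyl_ring_simps(2))
qed

lemma left_ideal_weylD:
  assumes "left_ideal I (weyl_ring n)"
  shows "I \<subseteq> carrier (weyl_ring n)" "(\<lambda>m. 0) \<in> I"
    "\<And>P Q. P \<in> I \<Longrightarrow> Q \<in> I \<Longrightarrow> (\<lambda>m. P m + Q m) \<in> I"
    "\<And>P. P \<in> I \<Longrightarrow> (\<lambda>m. - P m) \<in> I"
    "\<And>x P. x \<in> carrier (weyl_ring n) \<Longrightarrow> P \<in> I \<Longrightarrow> weyl_mult x P \<in> I"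
proof -
  interpret additive_subgroup I "weyl_ring n" using assms by (simp add: left_ideal_def)
  show sub: "I \<subseteq> carrier (weyl_ring n)" by (rule a_subset)
  show "(\<lambda>m. 0) \<in> I" using zero_closed by (simp add: weyl_ring_simps)
  show "(\<lambda>m. P m + Q m) \<in> I" if "P \<in> I" "Q \<in> I" for P Q
    using a_closed[OF that] by (simp add: weyl_ring_simps)
  show "(\<lambda>m. - P m) \<in> I" if "P \<in> I" for P
  proof -
    have "\<ominus>\<^bsub>weyl_ring n\<^esub> P \<in> I"
      using subgroup.m_inv_closed[OF a_subgroup that] by (simp only: a_inv_def)
    moreover have "P \<in> carrier (weyl_ring n)" using that sub by blast
    ultimately show ?thesis by (simp only: weyl_a_inv)
  qed
  show "weyl_mult x P \<in> I" if "x \<in> carrier (weyl_ring n)" "P \<in> I" for x P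
    using assms that by (auto simp: left_ideal_def weyl_ring_simps(2))
qed

lemma left_ideal_sum:
  assumes "left_ideal I (weyl_ring n)" "\<And>i. i \<in> F \<Longrightarrow> f i \<in> I"
  shows "(\<lambda>m. \<Sum>i\<in>F. f i m) \<in> I"
  using assms(2)
proof (induction F rule: infinite_finite_induct)
  case (insert i F)
  then show ?case using left_ideal_weylD(3)[OF assms(1)] by simp
qed (use left_ideal_weylD(2)[OF assms(1)] in auto)

text \<open>The structure constants of the Weyl algebra in the basis of normally ordered monomials:
  the coefficient of \<open>m\<close> in the product of \<open>m1\<close> and
  \<open>m2\<close>.\<close>

definition weyl_coeff :: "nat vec \<times> nat vec \<Rightarrow> nat vec \<times> nat vec \<Rightarrow> nat vec \<times> nat vec \<Rightarrow> complex" where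
  "weyl_coeff m1 m2 m = (case (m1, m2) of ((a, b), (c, e)) \<Rightarrow>
     \<Sum>k \<in> {k. k \<le> b \<and> k \<le> c \<and> (a + (c - k), (b - k) + e) = m}.
       (\<Prod>i<dim_vec k. of_nat (fact (k $ i) * (b $ i choose k $ i) * (c $ i choose k $ i))))"

text \<open>Arbitrary finite supersets of the supports are allowed, so that products with different
  factors can be summed over common index sets.\<close>

lemma weyl_mult_sum:
  assumes "finite F" "finite G" "{m. P m \<noteq> 0} \<subseteq> F" "{m. Q m \<noteq> 0} \<subseteq> G"
  shows "weyl_mult P Q m = (\<Sum>m1\<in>F. \<Sum>m2\<in>G. P m1 * Q m2 * weyl_coeff m1 m2 m)"
proof -
  have "weyl_mult P Q m = (\<Sum>m1\<in>{m. P m \<noteq> 0}. \<Sum>m2\<in>{m. Q m \<noteq> 0}. P m1 * Q m2 * weyl_coeff m1 m2 m)"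
    unfolding weyl_mult_def weyl_coeff_def by (simp add: split_def sum_distrib_left)
  also have "\<dots> = (\<Sum>m1\<in>{m. P m \<noteq> 0}. \<Sum>m2\<in>G. P m1 * Q m2 * weyl_coeff m1 m2 m)"
    by (intro sum.cong sum.mono_neutral_left) (use assms in auto)
  also have "\<dots> = (\<Sum>m1\<in>F. \<Sum>m2\<in>G. P m1 * Q m2 * weyl_coeff m1 m2 m)"
    by (intro sum.mono_neutral_left) (use assms in auto)
  finally show ?thesis .
qed

lemma weyl_coeff_nonzero:
  assumes "weyl_coeff (a, b) (c, e) m \<noteq> 0"
  obtains k where "k \<le> b" "k \<le> c" "m = (a + (c - k), (b - k) + e)"
  using assms unfolding weyl_coeff_def by (auto elim!: sum.not_neutral_contains_not_neutral)

lemma weyl_mult_closed: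
  assumes "P \<in> carrier (weyl_ring n)" "Q \<in> carrier (weyl_ring n)"
  shows "weyl_mult P Q \<in> carrier (weyl_ring n)"
proof -
  \<comment> \<open>Every monomial of the product comes from a pair of monomials and a contraction k
    <= b, which bounds the support by a finite set.\<close>
  define F where "F = (\<lambda>((a, b), (c, e), k). (a + (c - k), (b - k) + e)) `
    (SIGMA (a, b) : {m. P m \<noteq> 0}. SIGMA (c, e) : {m. Q m \<noteq> 0}. {k. k \<le> b})"
  have "finite F"
    using assms unfolding F_def weyl_ring_simps
    by (intro finite_imageI finite_SigmaI) (auto simp: finite_le_vec)
  moreover have "m \<in> F \<inter> carrier_vec n \<times> carrier_vec n" if "weyl_mult P Q m \<noteq> 0" for m
  proof -
    have "(\<Sum>m1\<in>{m. P m \<noteq> 0}. \<Sum>m2\<in>{m. Q m \<noteq> 0}. P m1 * Q m2 * weyl_coeff m1 m2 m) \<noteq> 0"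
      using that weyl_mult_sum[of "{m. P m \<noteq> 0}" "{m. Q m \<noteq> 0}" P Q m] assms
      by (auto simp: weyl_ring_simps)
    then obtain a b c e where *: "P (a, b) \<noteq> 0" "Q (c, e) \<noteq> 0" "weyl_coeff (a, b) (c, e) m \<noteq> 0"
      by (auto elim!: sum.not_neutral_contains_not_neutral)
    then obtain k where k: "k \<le> b" "k \<le> c" "m = (a + (c - k), (b - k) + e)"
      using weyl_coeff_nonzero by blast
    have "{a, b, c, e} \<subseteq> carrier_vec n" using * assms by (auto simp: weyl_ring_simps)
    moreover have "m \<in> F" unfolding F_def using * k
      by (intro image_eqI[of _ _ "((a, b), (c, e), k)"]) auto
    ultimately show ?thesis using k by (auto simp: less_eq_vec_def)
  qed
  ultimately show ?thesis unfolding weyl_ring_simps by (auto intro: finite_subset[of _ F])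
qed

lemma weyl_carrier_left_ideal: "left_ideal (carrier (weyl_ring n)) (weyl_ring n)"
  by (rule left_ideal_weylI)
    (auto simp: weyl_add_closed weyl_mult_closed, auto simp: weyl_ring_simps)

lemma lgenideal_memberI:
  assumes "\<And>I. left_ideal I R \<Longrightarrow> S \<subseteq> I \<Longrightarrow> f \<in> I"
  shows "f \<in> lgenideal R S"
  using assms by (auto simp: lgenideal_def)

lemma lgenideal_memberD:
  assumes "f \<in> lgenideal R S" "left_ideal I R" "S \<subseteq> I"
  shows "f \<in> I"
  using assms by (auto simp: lgenideal_def)

lemma lgenideal_left_ideal:
  assumes "S \<subseteq> carrier (weyl_ring n)"
  shows "left_ideal (lgenideal (weyl_ring n) S) (weyl_ring n)"
proof (rule left_ideal_weylI)
  show "lgenideal (weyl_ring n) S \<subseteq> carrier (weyl_ring n)"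
    using lgenideal_memberD[OF _ weyl_carrier_left_ideal assms] by blast
qed (auto intro!: lgenideal_memberI dest: lgenideal_memberD left_ideal_weylD)

section \<open>The grading by Z^d, with \<open>\<partial>\<^sub>j\<close> in the degree of the j-th
  column of \<open>A\<close>\<close>

definition toric_degree :: "int mat \<Rightarrow> nat vec \<Rightarrow> int vec" where
  "toric_degree A p = A *\<^sub>v map_vec int p"

text \<open>With x_j in the degree opposite to that of its derivative, the Leibniz rule respects
  degrees and the Euler operators have degree 0.\<close>

definition weyl_degree :: "int mat \<Rightarrow> nat vec \<times> nat vec \<Rightarrow> int vec" where
  "weyl_degree A m = toric_degree A (snd m) - toric_degree A (fst m)"

definition component :: "('m \<Rightarrow> 'd) \<Rightarrow> 'd \<Rightarrow> ('m \<Rightarrow> complex) \<Rightarrow> 'm \<Rightarrow> complex" where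
  "component \<delta> c f = (\<lambda>m. if \<delta> m = c then f m else 0)"

lemma toric_degree_dim [simp]: "dim_vec (toric_degree A p) = dim_row A"
  by (simp add: toric_degree_def)

lemma toric_degree_carrier [simp]: "toric_degree A p \<in> carrier_vec (dim_row A)"
  by (rule carrier_vecI) simp

lemma toric_degree_add:
  assumes "p \<in> carrier_vec (dim_col A)" "q \<in> carrier_vec (dim_col A)"
  shows "toric_degree A (p + q) = toric_degree A p + toric_degree A q"
proof -
  have "map_vec int (p + q) = map_vec int p + map_vec int q" using assms by auto
  then show ?thesis unfolding toric_degree_def
    using assms by (simp add: mult_add_distrib_mat_vec[of _ "dim_row A" "dim_col A"])
qed

text \<open>A contraction removes the same k from the derivatives b and from the variables c, so the
  difference of their degrees is unchanged.\<close>

lemma weyl_degree_mult: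
  assumes "weyl_coeff (a, b) (c, e) m \<noteq> 0" "{a, b, c, e} \<subseteq> carrier_vec (dim_col A)"
  shows "weyl_degree A m = weyl_degree A (a, b) + weyl_degree A (c, e)"
proof -
  obtain k where k: "k \<le> b" "k \<le> c" "m = (a + (c - k), (b - k) + e)"
    using assms weyl_coeff_nonzero by blast
  have kc: "k \<in> carrier_vec (dim_col A)" using k(1) assms(2) le_vec_carrier by blast
  then have ck: "c - k \<in> carrier_vec (dim_col A)" "b - k \<in> carrier_vec (dim_col A)"
    by (auto intro!: carrier_vecI)
  moreover have "toric_degree A b = toric_degree A (b - k) + toric_degree A k"
    using toric_degree_add[OF ck(2) kc] by (simp add: minus_add_vec[OF k(1)])
  moreover have "toric_degree A c = toric_degree A (c - k) + toric_degree A k"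
    using toric_degree_add[OF ck(1) kc] by (simp add: minus_add_vec[OF k(2)])
  ultimately show ?thesis
    using assms(2) k(3) by (auto simp: weyl_degree_def toric_degree_add)
qed

text \<open>A monomial \<open>m1\<close> of x shifts degrees by its own degree, so it reaches degree
  c exactly from the component of P in degree c - deg \<open>m1\<close>. It follows that the
  operators with all components in a given left ideal are closed under left multiplication.\<close>

lemma component_weyl_mult:
  assumes "x \<in> carrier (weyl_ring (dim_col A))" "P \<in> carrier (weyl_ring (dim_col A))"
    "c \<in> carrier_vec (dim_row A)"
  shows "component (weyl_degree A) c (weyl_mult x P) =
    (\<lambda>m. \<Sum>m1\<in>{m. x m \<noteq> 0}. weyl_mult (\<lambda>m'. if m' = m1 then x m1 else 0)
       (component (weyl_degree A) (c - weyl_degree A m1) P) m)"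
proof
  fix m
  let ?X = "{m. x m \<noteq> 0}" and ?P = "{m. P m \<noteq> 0}"
  have fin: "finite ?X" "finite ?P" using assms by (auto simp: weyl_ring_simps)
  have *: "weyl_mult (\<lambda>m'. if m' = m1 then x m1 else 0) (component (weyl_degree A) d P) m
     = (\<Sum>m2\<in>?P. x m1 * component (weyl_degree A) d P m2 * weyl_coeff m1 m2 m)" for m1 d
    by (subst weyl_mult_sum[of "{m1}" ?P]) (use fin in \<open>auto simp: component_def\<close>)
  have "(if weyl_degree A m = c then x m1 * P m2 * weyl_coeff m1 m2 m else 0) =
      x m1 * component (weyl_degree A) (c - weyl_degree A m1) P m2 * weyl_coeff m1 m2 m"
    if m: "m1 \<in> ?X" "m2 \<in> ?P" for m1 m2
  proof (cases "weyl_coeff m1 m2 m = 0")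
    case False
    obtain a b c' e where ab: "m1 = (a, b)" "m2 = (c', e)" by (cases m1, cases m2) auto
    then have "{a, b, c', e} \<subseteq> carrier_vec (dim_col A)"
      using assms m by (auto simp: weyl_ring_simps)
    then have "weyl_degree A m = weyl_degree A m1 + weyl_degree A m2"
      using weyl_degree_mult False ab by blast
    moreover have "\<And>m'. dim_vec (weyl_degree A m') = dim_row A" by (simp add: weyl_degree_def)
    ultimately have "weyl_degree A m = c \<longleftrightarrow> weyl_degree A m2 = c - weyl_degree A m1"
      using assms(3) by (auto simp: vec_eq_iff)
    then show ?thesis by (simp add: component_def)
  qed simp
  then show "component (weyl_degree A) c (weyl_mult x P) m =
    (\<Sum>m1\<in>?X. weyl_mult (\<lambda>m'. if m' = m1 then x m1 else 0)
       (component (weyl_degree A) (c - weyl_degree A m1) P) m)"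
    unfolding * weyl_mult_sum[OF fin subset_refl subset_refl] component_def[of _ c]
    by (auto simp: if_distrib[of "sum _"] intro!: sum.cong sum.neutral cong: if_cong)
qed

lemma wdot_minus:
  assumes "dim_vec u = dim_vec u'"
  shows "wdot w (u - u') = wdot w u - wdot w u'"
  using assms by (simp add: wdot_def algebra_simps sum_subtractf)

lemma wdot_add:
  assumes "dim_vec u = dim_vec u'"
  shows "wdot w (u + u') = wdot w u + wdot w u'"
  using assms by (simp add: wdot_def algebra_simps sum.distrib)

lemma map_vec_int_add: "dim_vec p = dim_vec q \<Longrightarrow> map_vec int (p + q) = map_vec int p + map_vec int q"
  by auto

lemma pos_minus_neg_part: "map_vec int (pos_part u) - map_vec int (neg_part u) = u"
  by (auto simp: pos_part_def neg_part_def)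

lemma pos_part_carrier [simp]: "pos_part u \<in> carrier_vec n \<longleftrightarrow> u \<in> carrier_vec n"
  by (auto simp: pos_part_def)

lemma neg_part_carrier [simp]: "neg_part u \<in> carrier_vec n \<longleftrightarrow> u \<in> carrier_vec n"
  by (auto simp: neg_part_def)

lemma toric_degree_eq_iff:
  assumes "p \<in> carrier_vec (dim_col A)" "q \<in> carrier_vec (dim_col A)"
  shows "toric_degree A p = toric_degree A q \<longleftrightarrow> map_vec int p - map_vec int q \<in> mat_kernel A"
proof -
  have "A *\<^sub>v (map_vec int p - map_vec int q) = toric_degree A p - toric_degree A q"
    unfolding toric_degree_def
    using assms by (simp add: mult_minus_distrib_mat_vec[of _ "dim_row A" "dim_col A"])
  moreover have "map_vec int p - map_vec int q \<in> carrier_vec (dim_col A)" using assms by auto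
  ultimately show ?thesis by (auto simp: mat_kernel_def vec_eq_iff)
qed

lemma toric_degree_parts:
  assumes "u \<in> mat_kernel A"
  shows "toric_degree A (pos_part u) = toric_degree A (neg_part u)"
  using assms toric_degree_eq_iff[of "pos_part u" A "neg_part u"]
  by (auto simp: pos_minus_neg_part mat_kernel_def)

lemma mpoly_ideal_sum:
  assumes "ideal I (mpoly_ring n)" "\<And>i. i \<in> F \<Longrightarrow> f i \<in> I"
  shows "(\<lambda>p. \<Sum>i\<in>F. f i p) \<in> I"
  using assms(2)
proof (induction F rule: infinite_finite_induct)
  case (insert i F)
  then have "f i \<oplus>\<^bsub>mpoly_ring n\<^esub> (\<lambda>p. \<Sum>i\<in>F. f i p) \<in> I"
    by (intro additive_subgroup.a_closed[OF ideal.axioms(1)[OF assms(1)]]) auto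
  with insert show ?case by (simp add: mpoly_ring_simps)
qed (use additive_subgroup.zero_closed[OF ideal.axioms(1)[OF assms(1)]] in \<open>auto simp: mpoly_ring_simps\<close>)

lemma scaled_monom_mult:
  "((\<lambda>p. if p = q then a else 0) \<otimes>\<^bsub>mfps_ring n\<^esub> f) p = (if q \<le> p then a * f (p - q) else 0)"
proof -
  have "((\<lambda>p. if p = q then a else 0) \<otimes>\<^bsub>mfps_ring n\<^esub> f) p = a * (mmonom q \<otimes>\<^bsub>mfps_ring n\<^esub> f) p"
    unfolding mfps_ring_simps sum_distrib_left by (intro sum.cong) (auto simp: mmonom_def)
  then show ?thesis unfolding mmonom_mult by simp
qed

lemma toric_generators_closed:
  "{mmonom (pos_part u) \<ominus>\<^bsub>mpoly_ring (dim_col A)\<^esub> mmonom (neg_part u) | u. u \<in> mat_kernel A}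
     \<subseteq> carrier (mpoly_ring (dim_col A))"
  by (auto simp: mat_kernel_def intro!: mpoly.minus_closed)

lemma toric_ideal_ideal: "ideal (toric_ideal A) (mpoly_ring (dim_col A))"
  unfolding toric_ideal_def Let_def by (rule mpoly.genideal_ideal[OF toric_generators_closed])

lemma toric_ideal_carrier: "f \<in> toric_ideal A \<Longrightarrow> f \<in> carrier (mpoly_ring (dim_col A))"
  using ideal.Icarr[OF toric_ideal_ideal] .

lemma toric_binomial:
  assumes "u \<in> mat_kernel A"
  shows "(\<lambda>p. mmonom (pos_part u) p - mmonom (neg_part u) p) \<in> toric_ideal A"
proof -
  have "mmonom (pos_part u) \<ominus>\<^bsub>mpoly_ring (dim_col A)\<^esub> mmonom (neg_part u) \<in> toric_ideal A"
    unfolding toric_ideal_def Let_def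
    using mpoly.genideal_self[OF toric_generators_closed] assms by blast
  then show ?thesis using assms by (simp add: mpoly_minus mat_kernel_def)
qed

text \<open>The induction principle of the toric ideal. Each later property of its elements is
  phrased as membership in a suitable ideal and checked on binomials.\<close>

lemma toric_ideal_induct:
  assumes "f \<in> toric_ideal A" "ideal I (mpoly_ring (dim_col A))"
    "\<And>u. u \<in> mat_kernel A \<Longrightarrow> (\<lambda>p. mmonom (pos_part u) p - mmonom (neg_part u) p) \<in> I"
  shows "f \<in> I"
proof -
  have "toric_ideal A \<subseteq> I"
    unfolding toric_ideal_def Let_def
    by (rule mpoly.genideal_minimal[OF assms(2)])
      (use assms(3) in \<open>auto simp: mpoly_minus mat_kernel_def\<close>)
  with assms(1) show ?thesis by blast
qed

lemma component_mpoly_mult: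
  assumes x: "x \<in> carrier (mpoly_ring (dim_col A))" and f: "f \<in> carrier (mpoly_ring (dim_col A))"
    and c: "c \<in> carrier_vec (dim_row A)"
  shows "component (toric_degree A) c (x \<otimes>\<^bsub>mfps_ring (dim_col A)\<^esub> f) =
    (\<lambda>p. \<Sum>q\<in>{q. x q \<noteq> 0}. ((\<lambda>p. if p = q then x q else 0) \<otimes>\<^bsub>mfps_ring (dim_col A)\<^esub>
        component (toric_degree A) (c - toric_degree A q) f) p)"
proof
  fix p
  have "(x \<otimes>\<^bsub>mfps_ring (dim_col A)\<^esub> f) p = (\<Sum>q\<in>{q. q \<le> p \<and> x q \<noteq> 0}. x q * f (p - q))"
    unfolding mfps_ring_simps by (rule sum.mono_neutral_right) (auto simp: finite_le_vec)
  also have "\<dots> = (\<Sum>q\<in>{q. x q \<noteq> 0}. if q \<le> p then x q * f (p - q) else 0)"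
    by (rule sum.mono_neutral_cong_left) (use x in \<open>auto simp: mpoly_ring_simps\<close>)
  finally have 1: "(x \<otimes>\<^bsub>mfps_ring (dim_col A)\<^esub> f) p
    = (\<Sum>q\<in>{q. x q \<noteq> 0}. if q \<le> p then x q * f (p - q) else 0)" .
  have "(if toric_degree A p = c then (if q \<le> p then x q * f (p - q) else 0) else 0) =
      (if q \<le> p then x q * component (toric_degree A) (c - toric_degree A q) f (p - q) else 0)"
    if "x q \<noteq> 0" for q
  proof (cases "q \<le> p \<and> f (p - q) \<noteq> 0")
    case True
    then have "q \<in> carrier_vec (dim_col A)" "p - q \<in> carrier_vec (dim_col A)"
      using that x f by (auto simp: mpoly_ring_simps)
    then have "toric_degree A p = toric_degree A q + toric_degree A (p - q)"
      using toric_degree_add[of q A "p - q"] True add_minus_vec by force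
    then have "toric_degree A p = c \<longleftrightarrow> toric_degree A (p - q) = c - toric_degree A q"
      using c by (auto simp: vec_eq_iff)
    then show ?thesis using True by (simp add: component_def)
  qed (auto simp: component_def)
  then show "component (toric_degree A) c (x \<otimes>\<^bsub>mfps_ring (dim_col A)\<^esub> f) p =
    (\<Sum>q\<in>{q. x q \<noteq> 0}. ((\<lambda>p. if p = q then x q else 0) \<otimes>\<^bsub>mfps_ring (dim_col A)\<^esub>
        component (toric_degree A) (c - toric_degree A q) f) p)"
    unfolding component_def[of _ c] 1 scaled_monom_mult
    by (cases "toric_degree A p = c") (auto intro!: sum.cong sum.neutral)
qed

text \<open>The polynomials of I_A with all components in I_A form an ideal. It contains the
  binomials, since both monomials of a binomial have the same degree: a component is the whole
  binomial or zero.\<close>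

lemma component_toric_ideal:
  assumes "f \<in> toric_ideal A" "c \<in> carrier_vec (dim_row A)"
  shows "component (toric_degree A) c f \<in> toric_ideal A"
proof -
  let ?R = "mpoly_ring (dim_col A)"
  interpret I: ideal "toric_ideal A" ?R by (rule toric_ideal_ideal)
  define T where "T = {f \<in> carrier ?R. \<forall>c\<in>carrier_vec (dim_row A).
    component (toric_degree A) c f \<in> toric_ideal A}"
  have zero: "(\<lambda>p. 0) \<in> toric_ideal A" using I.zero_closed by (simp add: mpoly_ring_simps)
  have "ideal T ?R"
  proof (rule mpoly.ideal_commI)
    show "T \<subseteq> carrier ?R" by (auto simp: T_def)
    show "\<zero>\<^bsub>?R\<^esub> \<in> T" using zero by (simp add: T_def component_def mpoly_ring_simps)
    fix f g assume f: "f \<in> T" and g: "g \<in> T"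
    have "component (toric_degree A) c (f \<oplus>\<^bsub>?R\<^esub> g)
        = component (toric_degree A) c f \<oplus>\<^bsub>?R\<^esub> component (toric_degree A) c g" for c
      by (auto simp: component_def mpoly_ring_simps)
    with f g show "f \<oplus>\<^bsub>?R\<^esub> g \<in> T" unfolding T_def by auto
  next
    fix x f assume x: "x \<in> carrier ?R" and f: "f \<in> T"
    have "component (toric_degree A) c (x \<otimes>\<^bsub>?R\<^esub> f) \<in> toric_ideal A"
      if c: "c \<in> carrier_vec (dim_row A)" for c
      unfolding mpoly_ring_simps
      using f c component_mpoly_mult[OF x _ c, of f]
    proof (simp add: T_def, intro mpoly_ideal_sum[OF toric_ideal_ideal])
      fix q assume "q \<in> {q. x q \<noteq> 0}"
      then have "(\<lambda>p. if p = q then x q else 0) \<in> carrier ?R"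
        using x by (auto simp: mpoly_ring_simps)
      moreover have "component (toric_degree A) (c - toric_degree A q) f \<in> toric_ideal A"
        using f c by (auto simp: T_def)
      ultimately show "(\<lambda>p. if p = q then x q else 0) \<otimes>\<^bsub>mfps_ring (dim_col A)\<^esub>
          component (toric_degree A) (c - toric_degree A q) f \<in> toric_ideal A"
        using I.I_l_closed by (simp add: mpoly_ring_simps)
    qed
    with x f show "x \<otimes>\<^bsub>?R\<^esub> f \<in> T" unfolding T_def by auto
  qed
  moreover have "(\<lambda>p. mmonom (pos_part u) p - mmonom (neg_part u) p) \<in> T" (is "?g \<in> _")
    if u: "u \<in> mat_kernel A" for u
  proof -
    have g: "?g \<in> toric_ideal A" by (rule toric_binomial[OF u])
    have "component (toric_degree A) c ?g
      = (if toric_degree A (pos_part u) = c then ?g else (\<lambda>p. 0))" for c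
      using toric_degree_parts[OF u] by (auto simp: component_def mmonom_def)
    then have "component (toric_degree A) c ?g \<in> toric_ideal A" for c
      using g zero by simp
    with g show ?thesis unfolding T_def using toric_ideal_carrier by blast
  qed
  ultimately have "f \<in> T" using toric_ideal_induct[OF assms(1)] by blast
  with assms(2) show ?thesis by (simp add: T_def)
qed

lemma hypergeometric_generators_closed:
  "weyl_of_d (dim_col A) ` toric_ideal A \<union> euler_op A \<beta> ` {..<dim_row A}
     \<subseteq> carrier (weyl_ring (dim_col A))"
proof (intro Un_least image_subsetI)
  fix f assume "f \<in> toric_ideal A"
  then have f: "f \<in> carrier (mpoly_ring (dim_col A))" by (rule toric_ideal_carrier)
  have "{m. weyl_of_d (dim_col A) f m \<noteq> 0} = Pair (0\<^sub>v (dim_col A)) ` {q. f q \<noteq> 0}"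
    by (auto simp: weyl_of_d_def split: if_splits)
  with f show "weyl_of_d (dim_col A) f \<in> carrier (weyl_ring (dim_col A))"
    by (auto simp: weyl_ring_simps mpoly_ring_simps)
next
  fix i
  let ?n = "dim_col A"
  let ?F = "insert (0\<^sub>v ?n, 0\<^sub>v ?n) ((\<lambda>j. (unit_vec ?n j, unit_vec ?n j)) ` {..<?n})"
  have "{m. euler_op A \<beta> i m \<noteq> 0} \<subseteq> ?F"
  proof
    fix m assume m: "m \<in> {m. euler_op A \<beta> i m \<noteq> 0}"
    show "m \<in> ?F"
    proof (rule ccontr)
      assume "m \<notin> ?F"
      then have "euler_op A \<beta> i m = 0" by (auto simp: euler_op_def Let_def intro!: sum.neutral)
      with m show False by simp
    qed
  qed
  moreover have "finite ?F" "?F \<subseteq> carrier_vec ?n \<times> carrier_vec ?n" by auto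
  ultimately show "euler_op A \<beta> i \<in> carrier (weyl_ring (dim_col A))"
    unfolding weyl_ring_simps by (auto intro: finite_subset)
qed

lemma hypergeometric_left_ideal: "left_ideal (hypergeometric_ideal A \<beta>) (weyl_ring (dim_col A))"
  unfolding hypergeometric_ideal_def by (rule lgenideal_left_ideal[OF hypergeometric_generators_closed])

lemma toric_in_hypergeometric:
  "f \<in> toric_ideal A \<Longrightarrow> weyl_of_d (dim_col A) f \<in> hypergeometric_ideal A \<beta>"
  unfolding hypergeometric_ideal_def by (rule lgenideal_memberI) auto

lemma euler_in_hypergeometric:
  "i < dim_row A \<Longrightarrow> euler_op A \<beta> i \<in> hypergeometric_ideal A \<beta>"
  unfolding hypergeometric_ideal_def by (rule lgenideal_memberI) auto

text \<open>All generators except the elements of I_A are homogeneous: the monomials of an Euler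
  operator are 1 and the \<open>x\<^sub>j \<partial>\<^sub>j\<close>, of degree 0. For I_A the
  homogeneity is inherited from the commutative ring. The operators with all components in
  H_A(\<beta>) thus form a left ideal that contains every generator.\<close>

lemma component_hypergeometric_ideal:
  assumes "P \<in> hypergeometric_ideal A \<beta>" "c \<in> carrier_vec (dim_row A)"
  shows "component (weyl_degree A) c P \<in> hypergeometric_ideal A \<beta>"
proof -
  let ?R = "weyl_ring (dim_col A)" and ?H = "hypergeometric_ideal A \<beta>"
  note H = left_ideal_weylD[OF hypergeometric_left_ideal[of A \<beta>]]
  define T where "T = {P \<in> carrier ?R. \<forall>c\<in>carrier_vec (dim_row A).
    component (weyl_degree A) c P \<in> ?H}"
  have "left_ideal T ?R"
  proof (rule left_ideal_weylI)
    show "T \<subseteq> carrier ?R" by (auto simp: T_def)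
    show "(\<lambda>m. 0) \<in> T" using H(2) by (simp add: T_def component_def weyl_ring_simps)
  next
    fix P Q assume P: "P \<in> T" and Q: "Q \<in> T"
    have "component (weyl_degree A) c (\<lambda>m. P m + Q m)
        = (\<lambda>m. component (weyl_degree A) c P m + component (weyl_degree A) c Q m)" for c
      by (auto simp: component_def)
    with P Q H(3) show "(\<lambda>m. P m + Q m) \<in> T" unfolding T_def by (auto intro: weyl_add_closed)
  next
    fix P assume P: "P \<in> T"
    have "component (weyl_degree A) c (\<lambda>m. - P m)
        = (\<lambda>m. - component (weyl_degree A) c P m)" for c
      by (auto simp: component_def)
    with P H(4) show "(\<lambda>m. - P m) \<in> T" unfolding T_def by (auto simp: weyl_ring_simps)
  next
    fix x P assume x: "x \<in> carrier ?R" and P: "P \<in> T"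
    have "component (weyl_degree A) c (weyl_mult x P) \<in> ?H"
      if c: "c \<in> carrier_vec (dim_row A)" for c
    proof -
      have "weyl_mult (\<lambda>m'. if m' = m1 then x m1 else 0)
          (component (weyl_degree A) (c - weyl_degree A m1) P) \<in> ?H" if "x m1 \<noteq> 0" for m1
      proof (rule H(5))
        show "(\<lambda>m'. if m' = m1 then x m1 else 0) \<in> carrier ?R"
          using x that by (auto simp: weyl_ring_simps)
        show "component (weyl_degree A) (c - weyl_degree A m1) P \<in> ?H"
          using P c by (auto simp: T_def weyl_degree_def)
      qed
      then show ?thesis
        using P c unfolding T_def
        by (subst component_weyl_mult[OF x _ c])
          (auto intro!: left_ideal_sum[OF hypergeometric_left_ideal])
    qed
    with x P show "weyl_mult x P \<in> T" unfolding T_def by (auto intro: weyl_mult_closed)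
  qed
  moreover have "weyl_of_d (dim_col A) f \<in> T" if f: "f \<in> toric_ideal A" for f
  proof -
    have "toric_degree A (0\<^sub>v (dim_col A)) = 0\<^sub>v (dim_row A)"
      by (auto simp: toric_degree_def scalar_prod_def)
    then have "weyl_degree A (0\<^sub>v (dim_col A), q) = toric_degree A q" for q
      by (auto simp: weyl_degree_def)
    then have "component (weyl_degree A) c (weyl_of_d (dim_col A) f)
      = weyl_of_d (dim_col A) (component (toric_degree A) c f)" for c
      by (auto simp: component_def weyl_of_d_def fun_eq_iff)
    then show ?thesis
      using f toric_in_hypergeometric component_toric_ideal H(1) unfolding T_def by fastforce
  qed
  moreover have "euler_op A \<beta> i \<in> T" if i: "i < dim_row A" for i
  proof -
    have "weyl_degree A m = 0\<^sub>v (dim_row A)" if "euler_op A \<beta> i m \<noteq> 0" for m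
    proof -
      have "fst m = snd m"
        using that by (auto simp: euler_op_def Let_def split: if_splits
          elim!: sum.not_neutral_contains_not_neutral)
      then show ?thesis by (auto simp: weyl_degree_def)
    qed
    then have deg: "euler_op A \<beta> i m = 0 \<or> weyl_degree A m = 0\<^sub>v (dim_row A)" for m by blast
    have "component (weyl_degree A) c (euler_op A \<beta> i)
      = (if c = 0\<^sub>v (dim_row A) then euler_op A \<beta> i else (\<lambda>m. 0))" for c
    proof
      fix m
      show "component (weyl_degree A) c (euler_op A \<beta> i) m
        = (if c = 0\<^sub>v (dim_row A) then euler_op A \<beta> i else (\<lambda>m. 0)) m"
        using deg[of m] by (auto simp: component_def)
    qed
    then show ?thesis
      using euler_in_hypergeometric[OF i, of \<beta>] H(1,2) unfolding T_def by auto
  qed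
  ultimately have "?H \<subseteq> T"
    unfolding hypergeometric_ideal_def by (auto intro: lgenideal_memberD)
  with assms show ?thesis by (auto simp: T_def)
qed

section \<open>Initial ideals\<close>

text \<open>The monomial \<open>m0\<close> attains the maximum of \<open>wt\<close> over all of f,
  so in its degree the initial form of f is the initial form of the component. Inside one degree the
  two weights order the monomials alike, hence select the same leading terms.\<close>

lemma init_form_component:
  assumes same: "\<And>m m'. f m \<noteq> 0 \<Longrightarrow> f m' \<noteq> 0 \<Longrightarrow> \<delta> m = \<delta> m' \<Longrightarrow> wt m \<le> wt m' \<longleftrightarrow> wt' m \<le> wt' m'"
    and m0: "init_form wt f m0 \<noteq> 0"
  shows "component \<delta> (\<delta> m0) (init_form wt f) = init_form wt' (component \<delta> (\<delta> m0) f)"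
proof
  fix m
  have f0: "f m0 \<noteq> 0" and max0: "\<And>m'. f m' \<noteq> 0 \<Longrightarrow> wt m' \<le> wt m0"
    using m0 by (auto simp: init_form_def split: if_splits)
  show "component \<delta> (\<delta> m0) (init_form wt f) m = init_form wt' (component \<delta> (\<delta> m0) f) m"
  proof (cases "\<delta> m = \<delta> m0 \<and> f m \<noteq> 0")
    case True
    then have fm: "component \<delta> (\<delta> m0) f m = f m" by (simp add: component_def)
    have "(\<forall>m'. f m' \<noteq> 0 \<longrightarrow> wt m' \<le> wt m) \<longleftrightarrow> wt m0 \<le> wt m"
      using f0 max0 order_trans by blast
    also have "\<dots> \<longleftrightarrow> (\<forall>m'. f m' \<noteq> 0 \<longrightarrow> \<delta> m' = \<delta> m0 \<longrightarrow> wt m' \<le> wt m)"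
      using f0 max0 order_trans by blast
    also have "\<dots> \<longleftrightarrow> (\<forall>m'. component \<delta> (\<delta> m0) f m' \<noteq> 0 \<longrightarrow> wt' m' \<le> wt' m)"
      using True same by (auto simp: component_def)
    finally have "init_form wt f m = init_form wt' (component \<delta> (\<delta> m0) f) m"
      unfolding init_form_def fm by simp
    with True show ?thesis by (simp add: component_def[of _ _ "init_form wt f"])
  qed (auto simp: init_form_def component_def)
qed

lemma init_form_closed:
  assumes "P \<in> carrier (weyl_ring n)"
  shows "init_form wt P \<in> carrier (weyl_ring n)"
proof -
  have "{m. init_form wt P m \<noteq> 0} \<subseteq> {m. P m \<noteq> 0}" by (auto simp: init_form_def)
  then show ?thesis using assms unfolding weyl_ring_simps by (auto intro: finite_subset)
qed

text \<open>\<open>H\<^sub>A(\<beta>)\<close> is graded by \<open>\<int>\<^sup>d\<close>, and two monomials of the same degree differ by an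
  element of \<open>ker A\<close>. So only the signs of a weight on \<open>ker A\<close> enter the initial ideal.\<close>

lemma weyl_init_ideal_mono:
  assumes same: "\<And>u. u \<in> mat_kernel A \<Longrightarrow> wdot w u \<le> 0 \<longleftrightarrow> wdot w' u \<le> 0"
  shows "weyl_init_ideal (dim_col A) w (hypergeometric_ideal A \<beta>)
    \<subseteq> weyl_init_ideal (dim_col A) w' (hypergeometric_ideal A \<beta>)"
proof -
  let ?n = "dim_col A" and ?H = "hypergeometric_ideal A \<beta>"
  define wt where "wt = (\<lambda>w (p, q). wdot w (map_vec int q) - wdot w (map_vec int p))"
  note H = left_ideal_weylD[OF hypergeometric_left_ideal[of A \<beta>]]
  let ?I = "\<lambda>w. lgenideal (weyl_ring ?n) (init_form (wt w) ` ?H)"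
  have li: "left_ideal (?I w') (weyl_ring ?n)"
    by (rule lgenideal_left_ideal) (use H(1) init_form_closed in blast)
  have "init_form (wt w) P \<in> ?I w'" if P: "P \<in> ?H" for P
  proof -
    let ?f = "init_form (wt w) P"
    have Pc: "P \<in> carrier (weyl_ring ?n)" using P H(1) by blast
    have same': "wt w m \<le> wt w m' \<longleftrightarrow> wt w' m \<le> wt w' m'"
      if "P m \<noteq> 0" "P m' \<noteq> 0" "weyl_degree A m = weyl_degree A m'" for m m'
    proof -
      obtain a b where m: "m = (a, b)" by (cases m)
      obtain c e where m': "m' = (c, e)" by (cases m')
      have car: "{a, b, c, e} \<subseteq> carrier_vec ?n" using that m m' Pc by (auto simp: weyl_ring_simps)
      \<comment> \<open>The equality of degrees b - a = e - c is rewritten with sums of exponents,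
        to which the criterion for the kernel applies.\<close>
      then have "toric_degree A (b + c) = toric_degree A (e + a)"
        using that(3) unfolding m m' weyl_degree_def
        by (auto simp: toric_degree_add vec_eq_iff algebra_simps)
      then have "map_vec int (b + c) - map_vec int (e + a) \<in> mat_kernel A"
        using car by (subst (asm) toric_degree_eq_iff) auto
      moreover have "wdot w (map_vec int (b + c) - map_vec int (e + a)) = wt w m - wt w m'" for w
        using car unfolding m m' wt_def
        by (auto simp: wdot_minus wdot_add map_vec_int_add)
      ultimately show ?thesis using same by fastforce
    qed
    have fin: "finite {m. ?f m \<noteq> 0}"
      using init_form_closed[OF Pc, of "wt w"] by (simp add: weyl_ring_simps)
    have "component (weyl_degree A) c ?f \<in> ?I w'" if c: "c \<in> weyl_degree A ` {m. ?f m \<noteq> 0}" for c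
    proof -
      from c obtain m0 where m0: "?f m0 \<noteq> 0" "c = weyl_degree A m0" by auto
      have "component (weyl_degree A) c ?f = init_form (wt w') (component (weyl_degree A) c P)"
        unfolding m0(2) by (rule init_form_component[OF same' m0(1)])
      moreover have "component (weyl_degree A) c P \<in> ?H"
        using component_hypergeometric_ideal[OF P] m0(2) by (simp add: weyl_degree_def)
      ultimately show ?thesis by (auto intro!: lgenideal_memberI)
    qed
    \<comment> \<open>An initial form for \<open>w\<close> is the finite sum of its components, each
      of which is an initial form for \<open>w'\<close> of an element of H_A(\<beta>).\<close>
    then have "(\<lambda>m. \<Sum>c\<in>weyl_degree A ` {m. ?f m \<noteq> 0}. component (weyl_degree A) c ?f m) \<in> ?I w'"
      by (rule left_ideal_sum[OF li])
    moreover have "(\<Sum>c\<in>weyl_degree A ` {m. ?f m \<noteq> 0}. component (weyl_degree A) c ?f m) = ?f m" for m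
      using fin by (auto simp: component_def sum.delta)
    ultimately show ?thesis by simp
  qed
  then have "?I w \<subseteq> ?I w'" using lgenideal_memberD[OF _ li] by blast
  then show ?thesis unfolding weyl_init_ideal_def wt_def .
qed

section \<open>The initial ideal of a toric ideal of rank one\<close>

lemma monom_multiple:
  assumes f: "f \<in> carrier (mfps_ring n)" and s: "s \<in> carrier_vec n" and le: "\<And>p. f p \<noteq> 0 \<Longrightarrow> s \<le> p"
  shows "mmonom s \<otimes>\<^bsub>mfps_ring m\<^esub> (\<lambda>q. if q \<in> carrier_vec n then f (q + s) else 0) = f"
proof
  fix p
  show "(mmonom s \<otimes>\<^bsub>mfps_ring m\<^esub> (\<lambda>q. if q \<in> carrier_vec n then f (q + s) else 0)) p = f p"
  proof (cases "s \<le> p")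
    case True
    then have "p - s \<in> carrier_vec n" using s by (auto intro!: carrier_vecI)
    with True show ?thesis unfolding mmonom_mult by (simp add: minus_add_vec)
  next
    case False
    then show ?thesis unfolding mmonom_mult using le by auto
  qed
qed

lemma monom_multiple_in_ideal:
  assumes I: "ideal I (mpoly_ring n)" "mmonom s \<in> I" and f: "f \<in> carrier (mpoly_ring n)"
    and s: "s \<in> carrier_vec n" and le: "\<And>p. f p \<noteq> 0 \<Longrightarrow> s \<le> p"
  shows "f \<in> I"
proof -
  let ?g = "\<lambda>q. if q \<in> carrier_vec n then f (q + s) else 0"
  have "inj_on (\<lambda>q. q + s) {q. ?g q \<noteq> 0}"
    using s by (intro inj_onI) (auto simp: vec_eq_iff split: if_splits)
  moreover have "(\<lambda>q. q + s) ` {q. ?g q \<noteq> 0} \<subseteq> {p. f p \<noteq> 0}" by (auto split: if_splits)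
  moreover have "finite {p. f p \<noteq> 0}" using f by (simp add: mpoly_ring_simps)
  ultimately have "finite {q. ?g q \<noteq> 0}" by (rule inj_on_finite)
  then have "?g \<in> carrier (mpoly_ring n)" by (auto simp: mpoly_ring_simps)
  then have "mmonom s \<otimes>\<^bsub>mpoly_ring n\<^esub> ?g \<in> I" using ideal.I_r_closed[OF I] by blast
  moreover have "f \<in> carrier (mfps_ring n)" using f mpoly_carrier_subset by blast
  ultimately show ?thesis using monom_multiple[OF _ s le] by (simp add: mpoly_ring_simps)
qed

text \<open>\<open>D\<close> is an upward closed condition on exponents. It is used for divisibility
  by b_+, for the ideal of s in one variable, and for the monomials that kill x^v.\<close>

lemma mpoly_support_ideal:
  assumes up: "\<And>p q. D p \<Longrightarrow> p \<in> carrier_vec n \<Longrightarrow> q \<in> carrier_vec n \<Longrightarrow> D (q + p)"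
  shows "ideal {f \<in> carrier (mpoly_ring n). \<forall>p. f p \<noteq> 0 \<longrightarrow> D p} (mpoly_ring n)" (is "ideal ?I _")
proof (rule mpoly.ideal_commI)
  fix f g assume f: "f \<in> ?I" and g: "g \<in> ?I"
  have "D p" if "f p + g p \<noteq> 0" for p
  proof -
    have "f p \<noteq> 0 \<or> g p \<noteq> 0" using that by auto
    with f g show ?thesis by auto
  qed
  moreover have "f \<oplus>\<^bsub>mpoly_ring n\<^esub> g \<in> carrier (mpoly_ring n)" using f g by blast
  ultimately show "f \<oplus>\<^bsub>mpoly_ring n\<^esub> g \<in> ?I" by (simp add: mpoly_ring_simps)
next
  fix x f assume x: "x \<in> carrier (mpoly_ring n)" and f: "f \<in> ?I"
  have "D p" if p: "(x \<otimes>\<^bsub>mpoly_ring n\<^esub> f) p \<noteq> 0" for p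
  proof -
    from p obtain q where q: "q \<le> p" "x q * f (p - q) \<noteq> 0"
      unfolding mpoly_ring_simps mfps_ring_simps by (auto elim: sum.not_neutral_contains_not_neutral)
    then have "D (p - q)" "q \<in> carrier_vec n" "p - q \<in> carrier_vec n"
      using f x by (auto simp: mpoly_ring_simps)
    then have "D (q + (p - q))" using up by blast
    then show ?thesis by (simp add: add_minus_vec[OF q(1)])
  qed
  moreover have "x \<otimes>\<^bsub>mpoly_ring n\<^esub> f \<in> carrier (mpoly_ring n)" using f x by blast
  ultimately show "x \<otimes>\<^bsub>mpoly_ring n\<^esub> f \<in> ?I" by simp
qed (auto simp: mpoly_ring_simps)

text \<open>This is evaluation at the point (1, ..., 1), which lies on the toric variety: it is
  multiplicative and vanishes on every binomial.\<close>

definition coeff_sum :: "coeffs \<Rightarrow> complex" where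
  "coeff_sum f = (\<Sum>p\<in>{p. f p \<noteq> 0}. f p)"

lemma coeff_sum_superset:
  assumes "finite F" "{p. f p \<noteq> 0} \<subseteq> F"
  shows "coeff_sum f = (\<Sum>p\<in>F. f p)"
  unfolding coeff_sum_def by (rule sum.mono_neutral_left) (use assms in auto)

lemma coeff_sum_mult:
  assumes x: "x \<in> carrier (mpoly_ring n)" and f: "f \<in> carrier (mpoly_ring n)"
  shows "coeff_sum (x \<otimes>\<^bsub>mfps_ring n\<^esub> f) = coeff_sum x * coeff_sum f"
proof -
  let ?X = "{q. x q \<noteq> 0}" and ?Y = "{r. f r \<noteq> 0}"
  have fin: "finite ?X" "finite ?Y" using x f by (auto simp: mpoly_ring_simps)
  define F where "F = (\<lambda>(q, r). q + r) ` (?X \<times> ?Y)"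
  have finF: "finite F" using fin by (auto simp: F_def)
  have dims: "dim_vec q = dim_vec r" if "x q \<noteq> 0" "f r \<noteq> 0" for q r
    using x f that by (auto simp: mpoly_ring_simps)
  have eq: "(x \<otimes>\<^bsub>mfps_ring n\<^esub> f) p = (\<Sum>(q, r)\<in>?X \<times> ?Y. if q + r = p then x q * f r else 0)" for p
    unfolding mpoly_mult_eq_sum[OF fin] by (rule sum.cong) (auto simp: dims)
  have "p \<in> F" if nz: "(x \<otimes>\<^bsub>mfps_ring n\<^esub> f) p \<noteq> 0" for p
  proof -
    obtain a where "a \<in> ?X \<times> ?Y" "(case a of (q, r) \<Rightarrow> if q + r = p then x q * f r else 0) \<noteq> 0"
      using nz unfolding eq by (rule sum.not_neutral_contains_not_neutral)
    then show ?thesis unfolding F_def by (intro image_eqI[of _ _ a]) (auto split: if_splits prod.splits)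
  qed
  then have sub: "{p. (x \<otimes>\<^bsub>mfps_ring n\<^esub> f) p \<noteq> 0} \<subseteq> F" by blast
  have "coeff_sum (x \<otimes>\<^bsub>mfps_ring n\<^esub> f) = (\<Sum>(q, r)\<in>?X \<times> ?Y. \<Sum>p\<in>F. if q + r = p then x q * f r else 0)"
    unfolding coeff_sum_superset[OF finF sub] eq by (subst sum.swap) (simp add: split_def)
  also have "\<dots> = (\<Sum>(q, r)\<in>?X \<times> ?Y. x q * f r)"
  proof (intro sum.cong refl, clarify)
    fix q r assume "x q \<noteq> 0" "f r \<noteq> 0"
    then have "q + r \<in> F" unfolding F_def by (intro image_eqI[of _ _ "(q, r)"]) auto
    then show "(\<Sum>p\<in>F. if q + r = p then x q * f r else 0) = x q * f r" using finF by simp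
  qed
  finally show ?thesis by (simp add: coeff_sum_def sum_product sum.cartesian_product)
qed

lemma toric_coeff_sum:
  assumes "f \<in> toric_ideal A"
  shows "coeff_sum f = 0"
proof -
  let ?R = "mpoly_ring (dim_col A)"
  let ?T = "{f \<in> carrier ?R. coeff_sum f = 0}"
  have "ideal ?T ?R"
  proof (rule mpoly.ideal_commI)
    fix f g assume f: "f \<in> ?T" and g: "g \<in> ?T"
    let ?F = "{p. f p \<noteq> 0} \<union> {p. g p \<noteq> 0}"
    have fin: "finite ?F" using f g by (auto simp: mpoly_ring_simps)
    have sub: "{p. f p + g p \<noteq> 0} \<subseteq> ?F" by auto
    have "coeff_sum (\<lambda>p. f p + g p) = coeff_sum f + coeff_sum g"
      unfolding coeff_sum_superset[OF fin Un_upper1] coeff_sum_superset[OF fin Un_upper2]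
        coeff_sum_superset[OF fin sub] by (simp add: sum.distrib)
    moreover have "f \<oplus>\<^bsub>?R\<^esub> g \<in> carrier ?R" using f g by blast
    ultimately show "f \<oplus>\<^bsub>?R\<^esub> g \<in> ?T" using f g by (simp add: mpoly_ring_simps(5))
  next
    fix x f assume x: "x \<in> carrier ?R" and f: "f \<in> ?T"
    then have "x \<otimes>\<^bsub>?R\<^esub> f \<in> carrier ?R" by blast
    with f show "x \<otimes>\<^bsub>?R\<^esub> f \<in> ?T" using coeff_sum_mult[OF x, of f] by (simp add: mpoly_ring_simps(2))
  qed (auto simp: coeff_sum_def mpoly_ring_simps)
  moreover have "(\<lambda>p. mmonom (pos_part u) p - mmonom (neg_part u) p) \<in> ?T" (is "?g \<in> _")
    if u: "u \<in> mat_kernel A" for u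
  proof -
    have "coeff_sum ?g = (\<Sum>p\<in>{pos_part u, neg_part u}. ?g p)"
      by (rule coeff_sum_superset) (auto simp: mmonom_def split: if_splits)
    also have "\<dots> = 0" by (cases "pos_part u = neg_part u") (auto simp: mmonom_def)
    finally show ?thesis using toric_binomial[OF u] toric_ideal_carrier by blast
  qed
  ultimately have "f \<in> ?T" using toric_ideal_induct[OF assms] by blast
  then show ?thesis by simp
qed

lemma wdot_smult: "wdot w (k \<cdot>\<^sub>v u) = of_int k * wdot w u"
  by (simp add: wdot_def sum_distrib_left algebra_simps)

text \<open>The component of f in the degree of p lies in I_A, so its coefficients sum to 0 and it
  has a second monomial p'. Then p - p' = k b, and maximality of p together with w . b > 0 forces k
  >= 1. Hence p = p' + k b is at least b_+.\<close>

lemma toric_init_form_support: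
  assumes ker: "mat_kernel A = range (\<lambda>k. k \<cdot>\<^sub>v b)" and pos: "wdot w b > 0"
    and f: "f \<in> toric_ideal A" and p: "init_form (\<lambda>p. wdot w (map_vec int p)) f p \<noteq> 0"
  shows "pos_part b \<le> p"
proof -
  have fc: "f \<in> carrier (mpoly_ring (dim_col A))" by (rule toric_ideal_carrier[OF f])
  have fp: "f p \<noteq> 0" and max: "\<And>p'. f p' \<noteq> 0 \<Longrightarrow> wdot w (map_vec int p') \<le> wdot w (map_vec int p)"
    using p by (auto simp: init_form_def split: if_splits)
  obtain p' where p': "f p' \<noteq> 0" "p' \<noteq> p" "toric_degree A p' = toric_degree A p"
  proof (rule ccontr)
    assume *: "\<not> thesis"
    let ?f = "component (toric_degree A) (toric_degree A p) f"
    have "?f \<in> toric_ideal A" using component_toric_ideal[OF f] by simp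
    then have "coeff_sum ?f = 0" by (rule toric_coeff_sum)
    moreover have "coeff_sum ?f = (\<Sum>p'\<in>{p}. ?f p')"
      by (rule coeff_sum_superset) (use that * in \<open>auto simp: component_def split: if_splits\<close>)
    ultimately show False using fp by (simp add: component_def)
  qed
  have car: "p \<in> carrier_vec (dim_col A)" "p' \<in> carrier_vec (dim_col A)"
    using fc fp p' by (auto simp: mpoly_ring_simps)
  then have "map_vec int p - map_vec int p' \<in> mat_kernel A"
    using p'(3) toric_degree_eq_iff by metis
  then obtain k where k: "map_vec int p - map_vec int p' = k \<cdot>\<^sub>v b" using ker by auto
  have "0 \<le> of_int k * wdot w b"
    using max[OF p'(1)] wdot_minus[of "map_vec int p" "map_vec int p'" w] car
    by (auto simp: k wdot_smult)
  then have "k \<ge> 0" using pos by (simp add: zero_le_mult_iff)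
  moreover have "k \<noteq> 0"
  proof
    assume "k = 0"
    then have "p $ i = p' $ i" if "i < dim_col A" for i
      using arg_cong[OF k, of "\<lambda>v. v $ i"] arg_cong[OF k, of dim_vec] car that by auto
    with p'(2) car show False by (auto simp: vec_eq_iff)
  qed
  ultimately have k1: "k \<ge> 1" by simp
  have dim: "dim_vec b = dim_col A" using arg_cong[OF k, of dim_vec] car by auto
  show ?thesis
    unfolding less_eq_vec_def
  proof (intro conjI allI impI)
    show "dim_vec (pos_part b) = dim_vec p" using dim car by (auto simp: pos_part_def)
    fix i assume "i < dim_vec p"
    then have i: "i < dim_col A" using car by auto
    have "int (p $ i) = int (p' $ i) + k * b $ i"
      using arg_cong[OF k, of "\<lambda>v. v $ i"] car i dim by auto
    \<comment> \<open>Coordinates with b_i < 0 impose nothing, as b_+ is 0 there.\<close>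
    moreover have "k * b $ i \<ge> b $ i" if "b $ i \<ge> 0"
      using mult_right_mono[OF k1 that] by simp
    ultimately show "pos_part b $ i \<le> p $ i"
      using i dim by (cases "b $ i \<ge> 0") (auto simp: pos_part_def)
  qed
qed

lemma poly_init_ideal_support:
  assumes ker: "mat_kernel A = range (\<lambda>k. k \<cdot>\<^sub>v b)" and pos: "wdot w b > 0"
  shows "poly_init_ideal (dim_col A) w (toric_ideal A)
    \<subseteq> {f \<in> carrier (mpoly_ring (dim_col A)). \<forall>p. f p \<noteq> 0 \<longrightarrow> pos_part b \<le> p}" (is "_ \<subseteq> ?I")
  unfolding poly_init_ideal_def
proof (rule mpoly.genideal_minimal)
  show "ideal ?I (mpoly_ring (dim_col A))"
    by (rule mpoly_support_ideal) (auto simp: less_eq_vec_def trans_le_add2)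
  show "init_form (\<lambda>p. wdot w (map_vec int p)) ` toric_ideal A \<subseteq> ?I"
  proof (intro image_subsetI CollectI conjI allI impI)
    fix f assume f: "f \<in> toric_ideal A"
    then have "f \<in> carrier (mpoly_ring (dim_col A))" by (rule toric_ideal_carrier)
    then show "init_form (\<lambda>p. wdot w (map_vec int p)) f \<in> carrier (mpoly_ring (dim_col A))"
      by (auto simp: mpoly_ring_simps init_form_def elim!: finite_subset[rotated] split: if_splits)
    fix p assume "init_form (\<lambda>p. wdot w (map_vec int p)) f p \<noteq> 0"
    then show "pos_part b \<le> p" by (rule toric_init_form_support[OF ker pos f])
  qed
qed

text \<open>Since w . b > 0, the leading term of the binomial of b is the monomial of b_+. All other
  initial monomials are multiples of it.\<close>

lemma poly_init_ideal_principal: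
  assumes ker: "mat_kernel A = range (\<lambda>k. k \<cdot>\<^sub>v b)" and pos: "wdot w b > 0"
  shows "poly_init_ideal (dim_col A) w (toric_ideal A) = Idl\<^bsub>mpoly_ring (dim_col A)\<^esub> {mmonom (pos_part b)}"
proof -
  let ?R = "mpoly_ring (dim_col A)"
  have b: "b \<in> mat_kernel A" unfolding ker by (rule range_eqI[of _ _ 1]) auto
  then have car: "b \<in> carrier_vec (dim_col A)" by (simp add: mat_kernel_def)
  let ?g = "\<lambda>p. mmonom (pos_part b) p - mmonom (neg_part b) p"
  have "wdot w b = wdot w (map_vec int (pos_part b)) - wdot w (map_vec int (neg_part b))"
    using wdot_minus[of "map_vec int (pos_part b)" "map_vec int (neg_part b)" w]
    by (simp add: pos_minus_neg_part) (simp add: pos_part_def neg_part_def)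
  then have lt: "wdot w (map_vec int (neg_part b)) < wdot w (map_vec int (pos_part b))"
    using pos by simp
  then have "pos_part b \<noteq> neg_part b" by auto
  with lt have init: "mmonom (pos_part b) = init_form (\<lambda>p. wdot w (map_vec int p)) ?g"
    by (auto simp: init_form_def mmonom_def fun_eq_iff)
  then have mem: "mmonom (pos_part b) \<in> poly_init_ideal (dim_col A) w (toric_ideal A)"
    unfolding poly_init_ideal_def
  proof (intro mpoly.genideal_memberI)
    fix I assume "init_form (\<lambda>p. wdot w (map_vec int p)) ` toric_ideal A \<subseteq> I"
    moreover have "mmonom (pos_part b) \<in> init_form (\<lambda>p. wdot w (map_vec int p)) ` toric_ideal A"
      by (rule image_eqI[where x = ?g], rule init, rule toric_binomial[OF b])
    ultimately show "mmonom (pos_part b) \<in> I" by blast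
  qed
  have "poly_init_ideal (dim_col A) w (toric_ideal A) \<subseteq> Idl\<^bsub>?R\<^esub> {mmonom (pos_part b)}"
  proof
    fix f assume "f \<in> poly_init_ideal (dim_col A) w (toric_ideal A)"
    then have "f \<in> carrier ?R" "\<And>p. f p \<noteq> 0 \<Longrightarrow> pos_part b \<le> p"
      using poly_init_ideal_support[OF ker pos] by auto
    moreover have "ideal (Idl\<^bsub>?R\<^esub> {mmonom (pos_part b)}) ?R"
      by (rule mpoly.genideal_ideal) (use car in simp)
    moreover have "mmonom (pos_part b) \<in> Idl\<^bsub>?R\<^esub> {mmonom (pos_part b)}"
      by (rule mpoly.genideal_self') (use car in simp)
    ultimately show "f \<in> Idl\<^bsub>?R\<^esub> {mmonom (pos_part b)}"
      using monom_multiple_in_ideal[of _ _ "pos_part b" f] car by simp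
  qed
  moreover have "ideal (poly_init_ideal (dim_col A) w (toric_ideal A)) ?R"
    unfolding poly_init_ideal_def
  proof (rule mpoly.genideal_ideal, rule image_subsetI)
    fix f assume "f \<in> toric_ideal A"
    then have "f \<in> carrier ?R" by (rule toric_ideal_carrier)
    then show "init_form (\<lambda>p. wdot w (map_vec int p)) f \<in> carrier ?R"
      by (auto simp: mpoly_ring_simps init_form_def elim!: finite_subset[rotated] split: if_splits)
  qed
  then have "Idl\<^bsub>?R\<^esub> {mmonom (pos_part b)} \<subseteq> poly_init_ideal (dim_col A) w (toric_ideal A)"
    using mem by (intro mpoly.genideal_minimal) auto
  ultimately show ?thesis by blast
qed

section \<open>Genericity in rank one\<close>

lemma openin_wdot_pos:
  "openin (Euclidean_space n) {w \<in> topspace (Euclidean_space n). 0 < wdot w b}"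
proof -
  have "continuous_map (Euclidean_space n) euclideanreal (\<lambda>w. w j)" for j
    unfolding Euclidean_space_def
    by (rule continuous_map_from_subtopology) (rule continuous_map_product_projection, simp)
  then have "continuous_map (Euclidean_space n) euclideanreal (\<lambda>w. wdot w b)"
    unfolding wdot_def by (intro continuous_map_sum continuous_map_real_mult) auto
  from openin_continuous_map_preimage[OF this, of "{0<..}"] show ?thesis by simp
qed

text \<open>Every element of L is a multiple of b, so all weights with w . b > 0 have the same signs
  on L and give the same initial ideal. This open half-space lies inside one class of the fan, hence
  in the interior of its closure.\<close>

lemma generic_direction_rank_one:
  assumes ker: "mat_kernel A = range (\<lambda>k. k \<cdot>\<^sub>v b)" and pos: "wdot w b > 0"
    and w: "w \<in> topspace (Euclidean_space (dim_col A))"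
  shows "generic_direction A \<beta> w"
proof -
  let ?n = "dim_col A" and ?H = "hypergeometric_ideal A \<beta>"
  have b: "b \<in> mat_kernel A" unfolding ker by (rule range_eqI[of _ _ 1]) auto
  then have car: "b \<in> carrier_vec ?n" by (simp add: mat_kernel_def)
  define E where "E = {w' \<in> topspace (Euclidean_space ?n). weyl_init_ideal ?n w' ?H = weyl_init_ideal ?n w ?H}"
  have sign: "wdot w' u \<le> 0 \<longleftrightarrow> wdot w u \<le> 0" if "0 < wdot w' b" "u \<in> mat_kernel A" for w' u
    using that pos by (auto simp: ker wdot_smult mult_le_0_iff)
  have "weyl_init_ideal ?n w' ?H = weyl_init_ideal ?n w ?H" if "0 < wdot w' b" for w'
    using weyl_init_ideal_mono[of A w' w \<beta>] weyl_init_ideal_mono[of A w w' \<beta>] sign[OF that] by blast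
  then have "{w' \<in> topspace (Euclidean_space ?n). 0 < wdot w' b} \<subseteq> E" by (auto simp: E_def)
  also have "\<dots> \<subseteq> Euclidean_space ?n closure_of E"
    by (rule closure_of_subset) (auto simp: E_def)
  finally have "{w' \<in> topspace (Euclidean_space ?n). 0 < wdot w' b}
      \<subseteq> Euclidean_space ?n interior_of (Euclidean_space ?n closure_of E)"
    using openin_wdot_pos by (rule interior_of_maximal)
  then have "w \<in> Euclidean_space ?n interior_of (Euclidean_space ?n closure_of E)"
    using w pos by blast
  moreover have "Euclidean_space ?n closure_of E \<in> small_groebner_fan ?n ?H"
    using w unfolding small_groebner_fan_def E_def by blast
  moreover have "monomial_ideal ?n (poly_init_ideal ?n w (toric_ideal A))"
    unfolding monomial_ideal_def poly_init_ideal_principal[OF ker pos]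
    by (rule exI[of _ "{pos_part b}"]) (use car in auto)
  ultimately show ?thesis using w unfolding generic_direction_def Let_def by blast
qed

lemma (in vec_space) rank_full_rows:
  assumes "A \<in> carrier_mat n nc" "set (unit_vecs n) \<subseteq> set (cols A)"
  shows "rank A = n"
proof -
  have "set (cols A) \<subseteq> carrier_vec n" using cols_dim assms(1) by blast
  then have "span (set (cols A)) \<subseteq> carrier_vec n" using span_is_subset2 by auto
  moreover have "carrier_vec n \<subseteq> span (set (cols A))"
    using span_is_monotone[OF assms(2)] span_unit_vecs_is_carrier by auto
  ultimately have "span_vs (set (cols A)) = V" by (auto simp: module_vec_def)
  then show ?thesis unfolding rank_def by (simp add: dim_is_n)
qed

section \<open>The example\<close>

definition ex_b :: "int vec" where "ex_b = vec_of_list [1, 1, -2, -1, 1]"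

text \<open>An identity block, which makes the rank visible, and a last column chosen so that b
  spans the kernel (this uses b_4 = 1). As the entries of b sum to 0, the last column has coordinate
  sum 1 like the unit vectors, and the functional (1, 1, 1, 1) witnesses homogeneity.\<close>

definition ex_A :: "int mat" where
  "ex_A = mat 4 5 (\<lambda>(i, j). if j = i then 1 else if j = 4 then - ex_b $ i else 0)"

definition ex_v :: "complex vec" where "ex_v = map_vec of_int (vec_of_list [-1, -1, 0, 1, 0])"

text \<open>This is A v. Because v_4 = 0, it consists of the first four entries of v.\<close>

definition ex_beta :: "complex vec" where "ex_beta = map_vec of_int (vec_of_list [-1, -1, 0, 1])"

text \<open>The last unit vector reads off k from k b, since b_4 = 1.\<close>

definition ex_w :: "nat \<Rightarrow> real" where "ex_w j = (if j = 4 then 1 else 0)"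

text \<open>The member {2, 3} of the distinguished collection is left out. Outside the family it
  provides the generator t_2 t_3 of P.\<close>

definition ex_N :: "nat set set" where "ex_N = {{0, 1}, {2}}"

lemma less_4: "(i::nat) < 4 \<longleftrightarrow> i = 0 \<or> i = 1 \<or> i = 2 \<or> i = 3" by auto

lemma less_5: "(i::nat) < 5 \<longleftrightarrow> i = 0 \<or> i = 1 \<or> i = 2 \<or> i = 3 \<or> i = 4" by auto

lemma sum_less_5: "(\<Sum>i<5. f i) = f 0 + f 1 + f 2 + f 3 + (f (4::nat) :: 'a::comm_monoid_add)"
  by (simp add: eval_nat_numeral)

lemma ex_b_simps [simp]:
  "dim_vec ex_b = 5" "ex_b $ 0 = 1" "ex_b $ 1 = 1" "ex_b $ Suc 0 = 1" "ex_b $ 2 = -2" "ex_b $ 3 = -1" "ex_b $ 4 = 1"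
  by (simp_all add: ex_b_def eval_nat_numeral)

lemma ex_b_carrier [simp]: "ex_b \<in> carrier_vec 5" by (rule carrier_vecI) simp

lemma ex_A_simps [simp]: "dim_row ex_A = 4" "dim_col ex_A = 5" "ex_A \<in> carrier_mat 4 5"
  by (auto simp: ex_A_def)

lemma ex_A_index: "i < 4 \<Longrightarrow> j < 5 \<Longrightarrow> ex_A $$ (i, j) = (if j = i then 1 else if j = 4 then - ex_b $ i else 0)"
  by (simp add: ex_A_def)

lemma ex_v_simps [simp]:
  "dim_vec ex_v = 5" "ex_v $ 0 = -1" "ex_v $ 1 = -1" "ex_v $ Suc 0 = -1" "ex_v $ 2 = 0" "ex_v $ 3 = 1" "ex_v $ 4 = 0"
  by (simp_all add: ex_v_def eval_nat_numeral)

lemma ex_beta_simps [simp]: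
  "dim_vec ex_beta = 4" "ex_beta $ 0 = -1" "ex_beta $ 1 = -1" "ex_beta $ Suc 0 = -1" "ex_beta $ 2 = 0" "ex_beta $ 3 = 1"
  by (simp_all add: ex_beta_def eval_nat_numeral)

lemma ex_row_sum:
  fixes u :: "'a::comm_ring_1 vec"
  assumes "i < 4" "dim_vec u = 5"
  shows "(map_mat of_int ex_A *\<^sub>v u) $ i = u $ i - of_int (ex_b $ i) * u $ 4"
  using assms(1)
  by (simp add: scalar_prod_def assms(2) atLeast0LessThan sum_less_5 ex_A_index)
    (auto simp: less_4 ex_A_index)

lemma ex_row_sum_int:
  assumes "i < 4" "dim_vec u = 5"
  shows "(ex_A *\<^sub>v u) $ i = u $ i - ex_b $ i * u $ 4"
proof -
  have id: "map_mat of_int ex_A = ex_A" by auto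
  show ?thesis using ex_row_sum[OF assms] unfolding id by simp
qed

lemma ex_kernel: "mat_kernel ex_A = range (\<lambda>k. k \<cdot>\<^sub>v ex_b)"
proof -
  have "u \<in> mat_kernel ex_A \<longleftrightarrow> (\<exists>k. u = k \<cdot>\<^sub>v ex_b)" for u
  proof
    assume u: "u \<in> mat_kernel ex_A"
    then have dim: "dim_vec u = 5" by (auto simp: mat_kernel_def)
    have "u $ i = ex_b $ i * u $ 4" if "i < 4" for i
    proof -
      have "(ex_A *\<^sub>v u) $ i = 0" using u that by (simp add: mat_kernel_def)
      with ex_row_sum_int[OF that dim] show ?thesis by simp
    qed
    then have eq: "u $ i = (u $ 4 \<cdot>\<^sub>v ex_b) $ i" if "i < 5" for i
      using that by (cases "i = 4") auto
    have "u = u $ 4 \<cdot>\<^sub>v ex_b"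
    proof (rule eq_vecI)
      fix i assume "i < dim_vec (u $ 4 \<cdot>\<^sub>v ex_b)"
      then have "i < 5" by simp
      then show "u $ i = (u $ 4 \<cdot>\<^sub>v ex_b) $ i" by (rule eq)
    qed (simp add: dim)
    then show "\<exists>k. u = k \<cdot>\<^sub>v ex_b" by blast
  next
    assume "\<exists>k. u = k \<cdot>\<^sub>v ex_b"
    then obtain k where k: "u = k \<cdot>\<^sub>v ex_b" by blast
    have "(ex_A *\<^sub>v u) $ i = 0" if "i < 4" for i
      using ex_row_sum_int[OF that, of u] that by (simp add: k)
    then show "u \<in> mat_kernel ex_A" unfolding mat_kernel_def by (auto simp: k)
  qed
  then show ?thesis by auto
qed

lemma ex_homogeneous: "homogeneous_matrix 4 5 ex_A"
  unfolding homogeneous_matrix_def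
proof (intro conjI)
  show "vec_space.rank 4 (map_mat rat_of_int ex_A) = 4"
  proof (rule vec_space.rank_full_rows)
    show "map_mat rat_of_int ex_A \<in> carrier_mat 4 5" by simp
    have "unit_vec 4 i = col (map_mat rat_of_int ex_A) i" if "i < 4" for i
      using that by (auto simp: ex_A_def)
    then show "set (unit_vecs 4) \<subseteq> set (cols (map_mat rat_of_int ex_A))"
      by (auto simp: unit_vecs_def cols_def)
  qed
  show "\<exists>h\<in>carrier_vec 4. \<exists>\<gamma>. h \<noteq> 0\<^sub>v 4 \<and> \<gamma> \<noteq> 0 \<and>
      (\<forall>j<5. h \<bullet> map_vec real_of_int (col ex_A j) = \<gamma>)"
  proof (intro bexI exI conjI)
    show "vec 4 (\<lambda>_. 1) \<noteq> (0\<^sub>v 4 :: real vec)" by (auto simp: vec_eq_iff intro!: exI[of _ 0])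
    have "(\<Sum>i<4. f i) = f 0 + f 1 + f 2 + f (3::nat)" for f :: "nat \<Rightarrow> real"
      by (simp add: eval_nat_numeral)
    then show "\<forall>j<5. vec 4 (\<lambda>_. 1) \<bullet> map_vec real_of_int (col ex_A j) = 1"
      by (auto simp: less_5 scalar_prod_def atLeast0LessThan ex_A_index)
  qed auto
qed simp

lemma gale_dual_column:
  assumes "dim_vec b = dim_col A" "mat_kernel A = range (\<lambda>k. k \<cdot>\<^sub>v b)" "b \<noteq> 0\<^sub>v (dim_col A)"
  shows "gale_dual A (mat (dim_col A) 1 (\<lambda>(j, _). b $ j))"
proof -
  have mult: "mat (dim_col A) 1 (\<lambda>(j, _). b $ j) *\<^sub>v c = c $ 0 \<cdot>\<^sub>v b" if "c \<in> carrier_vec 1" for c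
    using that assms(1) by (auto simp: scalar_prod_def)
  obtain i where i: "i < dim_col A" "b $ i \<noteq> 0" using assms(1,3) by (auto simp: vec_eq_iff)
  have "bij_betw (\<lambda>c. c $ 0 \<cdot>\<^sub>v b) (carrier_vec 1) (range (\<lambda>k. k \<cdot>\<^sub>v b))"
  proof (rule bij_betwI')
    fix c c' :: "int vec" assume c: "c \<in> carrier_vec 1" "c' \<in> carrier_vec 1"
    have "c $ 0 = c' $ 0" if "c $ 0 \<cdot>\<^sub>v b = c' $ 0 \<cdot>\<^sub>v b"
      using arg_cong[OF that, of "\<lambda>v. v $ i"] i assms(1) by auto
    then show "(c $ 0 \<cdot>\<^sub>v b = c' $ 0 \<cdot>\<^sub>v b) = (c = c')" using c by (auto simp: vec_eq_iff)
  next
    fix u assume "u \<in> range (\<lambda>k. k \<cdot>\<^sub>v b)"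
    then obtain k where "u = k \<cdot>\<^sub>v b" by auto
    then show "\<exists>c\<in>carrier_vec 1. u = c $ 0 \<cdot>\<^sub>v b" by (intro bexI[of _ "vec 1 (\<lambda>_. k)"]) auto
  qed auto
  then have "bij_betw (\<lambda>c. mat (dim_col A) 1 (\<lambda>(j, _). b $ j) *\<^sub>v c) (carrier_vec 1) (range (\<lambda>k. k \<cdot>\<^sub>v b))"
    by (subst bij_betw_cong[OF mult]) auto
  then show ?thesis by (simp add: gale_dual_def assms(2))
qed

text \<open>The column of B lies in the kernel, so it is k b for an integer k. As b itself is an
  integer multiple of that column and has an entry 1, k divides 1.\<close>

lemma gale_dual_rank_one:
  assumes "gale_dual A B" "dim_col B = 1" "mat_kernel A = range (\<lambda>k. k \<cdot>\<^sub>v b)"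
    and j: "j < dim_col A" "b $ j = 1" and b: "b \<in> carrier_vec (dim_col A)"
  obtains \<sigma> :: int where "\<sigma> = 1 \<or> \<sigma> = -1" "\<And>i. i < dim_col A \<Longrightarrow> B $$ (i, 0) = \<sigma> * b $ i"
proof -
  have dim: "dim_row B = dim_col A" and bij: "bij_betw (\<lambda>c. B *\<^sub>v c) (carrier_vec 1) (range (\<lambda>k. k \<cdot>\<^sub>v b))"
    using assms by (auto simp: gale_dual_def)
  have mult: "(B *\<^sub>v c) $ i = B $$ (i, 0) * c $ 0" if "c \<in> carrier_vec 1" "i < dim_col A" for c i
    using that dim assms(2) by (auto simp: scalar_prod_def)
  have "B *\<^sub>v vec 1 (\<lambda>_. 1) \<in> range (\<lambda>k. k \<cdot>\<^sub>v b)" using bij by (auto simp: bij_betw_def)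
  then obtain k where k: "B *\<^sub>v vec 1 (\<lambda>_. 1) = k \<cdot>\<^sub>v b" by auto
  have Bk: "B $$ (i, 0) = k * b $ i" if "i < dim_col A" for i
    using mult[of "vec 1 (\<lambda>_. 1)" i] that b unfolding k by simp
  have "1 \<cdot>\<^sub>v b \<in> (\<lambda>c. B *\<^sub>v c) ` carrier_vec 1" using bij unfolding bij_betw_def by blast
  then obtain c where c: "c \<in> carrier_vec 1" "1 \<cdot>\<^sub>v b = B *\<^sub>v c" by auto
  have "1 = k * c $ 0" using mult[OF c(1) j(1)] Bk[OF j(1)] j b by (simp flip: c(2))
  then have "k = 1 \<or> k = -1" by (metis dvd_triv_left zdvd1_eq abs_eq_iff abs_1)
  with Bk that show thesis by blast
qed

lemma ex_lattice_rank: "lattice_rank ex_A 1"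
proof -
  have "ex_b \<noteq> 0\<^sub>v 5" by (auto simp: vec_eq_iff less_5)
  then show ?thesis
    unfolding lattice_rank_def using gale_dual_column[of ex_b ex_A] ex_kernel by fastforce
qed

lemma ex_wdot: "wdot ex_w (k \<cdot>\<^sub>v ex_b) = of_int k"
  by (simp add: wdot_def sum_less_5 ex_w_def)

lemma ex_generic: "generic_direction ex_A ex_beta ex_w"
proof (rule generic_direction_rank_one[OF ex_kernel])
  show "0 < wdot ex_w ex_b" using ex_wdot[of 1] by simp
  show "ex_w \<in> topspace (Euclidean_space (dim_col ex_A))" by (simp add: topspace_Euclidean_space ex_w_def)
qed

lemma falling_eq_0:
  assumes "j < dim_vec p" "k < p $ j" "z $ j = of_nat k"
  shows "falling z p = 0"
proof -
  have "(\<Prod>k<p $ j. z $ j - of_nat k) = 0" using assms by (intro prod_zero[OF _ bexI[of _ k]]) auto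
  then have "\<exists>i\<in>{..<dim_vec p}. (\<Prod>k<p $ i. z $ i - of_nat k) = 0" using assms(1) by blast
  then show ?thesis unfolding falling_def by (intro prod_zero) simp_all
qed

lemma ex_fake_exponent: "fake_exponent ex_A ex_beta ex_w ex_v"
  unfolding fake_exponent_def
proof (intro conjI ballI impI)
  show "ex_v \<in> carrier_vec (dim_col ex_A)" by (rule carrier_vecI) simp
  show "map_mat of_int ex_A *\<^sub>v ex_v = ex_beta"
    by (intro eq_vecI) (auto simp: ex_row_sum simp del: index_mult_mat_vec, auto simp: less_4)
  fix p assume p: "p \<in> carrier_vec (dim_col ex_A)"
    "mmonom p \<in> poly_init_ideal (dim_col ex_A) ex_w (toric_ideal ex_A)"
  have "0 < wdot ex_w ex_b" using ex_wdot[of 1] by simp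
  then have "pos_part ex_b \<le> p"
    using poly_init_ideal_support[OF ex_kernel] p(2) by (fastforce simp: mmonom_def)
  \<comment> \<open>Every initial monomial is divisible by the derivative of index 4, and v_4 = 0
    makes the first factor of its falling factorial vanish.\<close>
  then have "1 \<le> p $ 4" using p(1) by (auto simp: less_eq_vec_def pos_part_def less_5)
  then show "falling ex_v p = 0" using p(1) by (intro falling_eq_0[of 4 _ 0]) auto
qed

section \<open>Negative supports along the line v + k b\<close>

lemma nsupp_at_of_int:
  assumes "dim_vec u = dim_vec z"
  shows "nsupp_at (map_vec of_int z) u = {j. j < dim_vec z \<and> z $ j + u $ j < 0}"
proof -
  have main: "(\<exists>m<0. (map_vec of_int z + map_vec of_int u) $ j = complex_of_int m) \<longleftrightarrow> z $ j + u $ j < 0"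
    if "j < dim_vec z" for j
  proof -
    have eq: "(map_vec of_int z + map_vec of_int u) $ j = complex_of_int (z $ j + u $ j)"
      using that assms by simp
    show ?thesis unfolding eq of_int_eq_iff by auto
  qed
  have dim: "dim_vec (map_vec of_int z + map_vec of_int u :: complex vec) = dim_vec z"
    using assms by simp
  show ?thesis unfolding nsupp_at_def nsupp_def dim
    by (rule Collect_cong, rule conj_cong[OF refl], rule main)
qed

text \<open>The entries of v + k b are k - 1, k - 1, -2k, 1 - k and k, and each is negative on a
  half-line of integers k.\<close>

lemma ex_nsupp_at:
  "nsupp_at ex_v (k \<cdot>\<^sub>v ex_b) =
    (if k < 0 then {0, 1, 4} else if k = 0 then {0, 1} else if k = 1 then {2} else {2, 3})"
proof -
  let ?z = "vec_of_list [-1, -1, 0, 1, 0] :: int vec"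
  have z: "?z $ 0 = -1" "?z $ 1 = -1" "?z $ 2 = 0" "?z $ 3 = 1" "?z $ 4 = 0"
    by (simp_all add: eval_nat_numeral)
  have eq: "nsupp_at ex_v (k \<cdot>\<^sub>v ex_b) = {j. j < 5 \<and> ?z $ j + (k \<cdot>\<^sub>v ex_b) $ j < 0}"
    unfolding ex_v_def by (subst nsupp_at_of_int) auto
  have mem: "j \<in> nsupp_at ex_v (k \<cdot>\<^sub>v ex_b) \<longleftrightarrow> j < 5 \<and> ?z $ j + k * ex_b $ j < 0" for j
    unfolding eq mem_Collect_eq by (rule conj_cong[OF refl]) (simp only: index_smult_vec ex_b_simps)
  have cases: "j \<in> nsupp_at ex_v (k \<cdot>\<^sub>v ex_b) \<longleftrightarrow> j = 0 \<and> k < 1 \<or> j = 1 \<and> k < 1 \<or> j = 2 \<and> 0 < k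
      \<or> j = 3 \<and> 1 < k \<or> j = 4 \<and> k < 0" for j
  proof (cases "j < 5")
    case True
    then consider "j = 0" | "j = 1" | "j = 2" | "j = 3" | "j = 4" by linarith
    then show ?thesis unfolding mem by cases (simp_all only: z ex_b_simps, linarith+)
  next
    case False
    then show ?thesis unfolding mem by auto
  qed
  show ?thesis by (rule Set.set_eqI, unfold cases) auto
qed

lemma ex_nsupp: "nsupp ex_v = {0, 1}"
proof -
  have "ex_v + map_vec of_int (0 \<cdot>\<^sub>v ex_b) = ex_v" by (intro eq_vecI) auto
  then show ?thesis using ex_nsupp_at[of 0] by (simp add: nsupp_at_def)
qed

lemma ex_nsupps: "nsupps ex_A ex_v = {{0, 1, 4}, {0, 1}, {2}, {2, 3}}"
proof -
  let ?f = "\<lambda>k. nsupp_at ex_v (k \<cdot>\<^sub>v ex_b)"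
  have "nsupps ex_A ex_v = range ?f"
    by (simp only: nsupps_def ex_kernel image_image)
  moreover have "{0, 1, 4} = ?f (-1)" "{0, 1} = ?f 0" "{2} = ?f 1" "{2, 3} = ?f 2"
    unfolding ex_nsupp_at by simp_all
  then have "{{0, 1, 4}, {0, 1}, {2}, {2, 3}} \<subseteq> range ?f" by blast
  moreover have "range ?f \<subseteq> {{0, 1, 4}, {0, 1}, {2}, {2, 3}}"
    unfolding ex_nsupp_at by (rule image_subsetI) simp
  ultimately show ?thesis by (simp only: subset_antisym)
qed

text \<open>The weight of k b is k, so the only support to be excluded is {0, 1, 4}, which occurs
  exactly for k < 0.\<close>

lemma ex_distinguished: "distinguished ex_A ex_w ex_v = {{0, 1}, {2}, {2, 3}}"
proof -
  have ne: "{0, 1, 4} \<noteq> {0, 1::nat}" "{0, 1, 4} \<noteq> {2::nat}" "{0, 1, 4} \<noteq> {2, 3::nat}"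
    by (rule notI, drule arg_cong[of _ _ card], simp)+
  have neg: "nsupp_at ex_v (k \<cdot>\<^sub>v ex_b) = {0, 1, 4} \<longleftrightarrow> k < 0" for k
    unfolding ex_nsupp_at using ne by metis
  have "(\<forall>k. nsupp_at ex_v (k \<cdot>\<^sub>v ex_b) = I \<longrightarrow> 0 \<le> k) \<longleftrightarrow> I \<noteq> {0, 1, 4}"
    for I
  proof
    assume all: "\<forall>k. nsupp_at ex_v (k \<cdot>\<^sub>v ex_b) = I \<longrightarrow> 0 \<le> k"
    have "nsupp_at ex_v (-1 \<cdot>\<^sub>v ex_b) = {0, 1, 4}" unfolding neg by simp
    moreover have "\<not> 0 \<le> (-1::int)" by simp
    ultimately show "I \<noteq> {0, 1, 4}" using spec[OF all, of "-1"] by metis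
  next
    assume I: "I \<noteq> {0, 1, 4}"
    show "\<forall>k. nsupp_at ex_v (k \<cdot>\<^sub>v ex_b) = I \<longrightarrow> 0 \<le> k"
    proof (intro allI impI)
      fix k assume "nsupp_at ex_v (k \<cdot>\<^sub>v ex_b) = I"
      with neg[of k] I have "\<not> k < 0" by metis
      then show "0 \<le> k" by simp
    qed
  qed
  then have "distinguished ex_A ex_w ex_v = {I \<in> nsupps ex_A ex_v. I \<noteq> {0, 1, 4}}"
    by (simp add: distinguished_def ex_kernel ex_wdot)
  also have "\<dots> = {{0, 1}, {2}, {2, 3}}" using ne unfolding ex_nsupps by blast
  finally show ?thesis .
qed

lemma ex_family: "neg_support_family ex_A ex_w ex_v ex_N" "ordered_family ex_A ex_v ex_N"
  "ex_N \<noteq> distinguished ex_A ex_w ex_v"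
proof -
  show "neg_support_family ex_A ex_w ex_v ex_N"
    by (auto simp: neg_support_family_def ex_nsupp ex_distinguished ex_N_def)
  show "ordered_family ex_A ex_v ex_N"
    unfolding ordered_family_def ex_nsupps ex_N_def by auto
  have "{2, 3} \<noteq> {0, 1::nat}" by (rule notI, drule arg_cong[of _ _ "\<lambda>X. 2 \<in> X"], simp)
  moreover have "{2, 3} \<noteq> {2::nat}" by (rule notI, drule arg_cong[of _ _ "\<lambda>X. 3 \<in> X"], simp)
  ultimately have "{2, 3} \<notin> ex_N" by (simp only: ex_N_def insert_iff empty_iff simp_thms not_False_eq_True)
  then show "ex_N \<noteq> distinguished ex_A ex_w ex_v" unfolding ex_distinguished by blast
qed

lemma ex_Inter_N: "\<Inter>ex_N = {}"
  by (auto simp: ex_N_def)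

lemma ex_mixed_supports:
  "mixed_supports ex_A ex_v ex_N = {{0, 1, 4}, {0, 1, 2, 3}, {0, 1, 2, 4}, {2, 3}}"
proof -
  have ne: "{0, 1, 4} \<noteq> {0, 1::nat}" "{0, 1, 4} \<noteq> {2::nat}" "{2, 3} \<noteq> {0, 1::nat}" "{2, 3} \<noteq> {2::nat}"
    by (rule notI, drule arg_cong[of _ _ "\<lambda>X. 3 \<in> X \<or> 4 \<in> X"], simp)+
  have "{a, b, c, d} - {b, c} = {a, d}" if "a \<noteq> b" "a \<noteq> c" "d \<noteq> b" "d \<noteq> c" for a b c d :: "nat set"
    using that by auto
  from this[OF ne] have "nsupps ex_A ex_v - ex_N = {{0, 1, 4}, {2, 3}}"
    unfolding ex_nsupps ex_N_def .
  moreover have "{(I \<union> J) - {} | I J. I \<in> {a, b} \<and> J \<in> {c, d}} = {a \<union> c, a \<union> d, b \<union> c, b \<union> d}"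
    for a b c d :: "nat set" by blast
  ultimately have "mixed_supports ex_A ex_v ex_N =
    {{0, 1} \<union> {0, 1, 4}, {0, 1} \<union> {2, 3}, {2} \<union> {0, 1, 4}, {2} \<union> {2, 3}}"
    unfolding mixed_supports_def ex_Inter_N by (simp only: ex_N_def)
  moreover have "{0, 1} \<union> {0, 1, 4} = {0, 1, 4::nat}" "{0, 1} \<union> {2, 3} = {0, 1, 2, 3::nat}"
    "{2} \<union> {0, 1, 4} = {0, 1, 2, 4::nat}" "{2} \<union> {2, 3} = {2, 3::nat}" by auto
  ultimately show ?thesis by (simp only:)
qed

text \<open>An antichain inside F that has a member below each element of F consists precisely of
  the minimal elements.\<close>

lemma incl_minimal_eqI:
  assumes "M \<subseteq> F" "\<And>X Y. X \<in> M \<Longrightarrow> Y \<in> M \<Longrightarrow> X \<subseteq> Y \<Longrightarrow> X = Y" "\<And>Y. Y \<in> F \<Longrightarrow> \<exists>X\<in>M. X \<subseteq> Y"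
  shows "incl_minimal F = M"
proof
  show "incl_minimal F \<subseteq> M"
  proof
    fix Y assume Y: "Y \<in> incl_minimal F"
    then obtain X where "X \<in> M" "X \<subseteq> Y" using assms(3)[of Y] by (auto simp: incl_minimal_def)
    moreover from this have "X = Y" using Y assms(1) by (auto simp: incl_minimal_def)
    ultimately show "Y \<in> M" by simp
  qed
  show "M \<subseteq> incl_minimal F"
  proof
    fix X assume X: "X \<in> M"
    have "Y = X" if "Y \<in> F" "Y \<subseteq> X" for Y
    proof -
      obtain Z where "Z \<in> M" "Z \<subseteq> Y" using assms(3) \<open>Y \<in> F\<close> by blast
      moreover from this have "Z = X" using assms(2) X \<open>Y \<subseteq> X\<close> subset_trans by metis
      ultimately show ?thesis using \<open>Y \<subseteq> X\<close> by (simp add: subset_antisym)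
    qed
    moreover have "X \<in> F" using X assms(1) by (rule subsetD[rotated])
    ultimately show "X \<in> incl_minimal F" by (simp add: incl_minimal_def)
  qed
qed

lemma ex_min_G: "min_G ex_N = {{0, 1}, {2}}"
proof -
  have "(\<lambda>I. I - \<Inter>ex_N) ` ex_N = {{0, 1}, {2}}" unfolding ex_Inter_N by (simp add: ex_N_def)
  moreover have "incl_minimal {{0, 1}, {2}} = {{0, 1}, {2::nat}}"
  proof (rule incl_minimal_eqI)
    fix X Y :: "nat set" assume "X \<in> {{0, 1}, {2}}" "Y \<in> {{0, 1}, {2}}" "X \<subseteq> Y"
    moreover have "\<not> {0, 1} \<subseteq> {2::nat}" "\<not> {2} \<subseteq> {0, 1::nat}" by simp_all
    ultimately show "X = Y" by blast
  qed blast+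
  ultimately show ?thesis by (simp only: min_G_def)
qed

lemma ex_min_H: "min_H ex_A ex_v ex_N = {{0, 1, 4}, {2, 3}}"
  unfolding min_H_def ex_mixed_supports
proof (rule incl_minimal_eqI)
  fix X Y :: "nat set" assume "X \<in> {{0, 1, 4}, {2, 3}}" "Y \<in> {{0, 1, 4}, {2, 3}}" "X \<subseteq> Y"
  moreover have "\<not> {0, 1, 4} \<subseteq> {2, 3::nat}" "\<not> {2, 3} \<subseteq> {0, 1, 4::nat}" by simp_all
  ultimately show "X = Y" by blast
next
  fix Y :: "nat set" assume "Y \<in> {{0, 1, 4}, {0, 1, 2, 3}, {0, 1, 2, 4}, {2, 3}}"
  moreover have "{2, 3} \<subseteq> {0, 1, 2, 3::nat}" "{0, 1, 4} \<subseteq> {0, 1, 2, 4::nat}" by simp_all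
  ultimately show "\<exists>X\<in>{{0, 1, 4}, {2, 3}}. X \<subseteq> Y" by blast
qed blast

text \<open>The choices are forced: {0, 1, 4} does not contain {2}, {2, 3} does not contain {0, 1},
  and E = {0, 1} does not contain {2}.\<close>

lemma ex_admissible:
  "admissible_choice ex_A ex_v ex_N \<iota> G \<longleftrightarrow> \<iota> {0, 1, 4} = {0, 1} \<and> \<iota> {2, 3} = {2} \<and> G = {0, 1}"
proof -
  have "(\<forall>H\<in>{c, d}. \<iota> H \<in> {a, b} \<and> \<iota> H \<subseteq> H) \<and> G \<in> {a, b} \<and> G \<subseteq> a \<longleftrightarrow>
      \<iota> c = a \<and> \<iota> d = b \<and> G = a"
    if "a \<subseteq> c" "b \<subseteq> d" "\<not> b \<subseteq> c" "\<not> a \<subseteq> d" "\<not> b \<subseteq> a" for a b c d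
    using that by auto
  then show ?thesis
    unfolding admissible_choice_def ex_min_H ex_min_G ex_nsupp ex_Inter_N Diff_empty by simp
qed

section \<open>Quotients with residue field \<open>\<complex>\<close>\<close>

lemma (in vectorspace) dim_one_iso:
  assumes "a \<in> carrier V" "a \<noteq> \<zero>\<^bsub>V\<^esub>" "\<And>x. x \<in> carrier V \<Longrightarrow> \<exists>c\<in>carrier K. x = c \<odot>\<^bsub>V\<^esub> a"
  shows "fin_dim" "dim = 1"
proof -
  have sp: "span {a} = carrier V"
  proof
    show "span {a} \<subseteq> carrier V" using span_is_subset2 assms(1) by blast
    have "c \<odot>\<^bsub>V\<^esub> a \<in> span {a}" if "c \<in> carrier K" for c
      using that assms(1) span_is_submodule[of "{a}"] in_own_span[of "{a}"]
      by (auto intro: submodule.smult_closed)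
    then show "carrier V \<subseteq> span {a}" using assms(3) by blast
  qed
  then show "fin_dim" unfolding fin_dim_def using assms(1) by blast
  have "lin_indpt {a}" using lin_dep_iff_in_span[of "{}" a] assms(1,2) 
    by (auto simp: span_def lincomb_def lin_dep_def)
  then have "basis {a}" using sp assms(1) by (auto simp: basis_def)
  then show "dim = 1" using dim_basis[of "{a}"] by simp
qed

text \<open>The modules concerned are bare records, so the vector space axioms have to be
  established together with the dimension. A bijection from \<complex> that respects the operations
  gives both. It serves the obstruction module as well as the ambient coefficient space.\<close>

lemma has_complex_dim_one:
  assumes bij: "bij_betw \<psi> UNIV (carrier V)"
    and add: "\<And>x y. \<psi> x \<oplus>\<^bsub>V\<^esub> \<psi> y = \<psi> (x + y)" and zero: "\<zero>\<^bsub>V\<^esub> = \<psi> 0"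
    and smult: "\<And>c x. c \<odot>\<^bsub>V\<^esub> \<psi> x = \<psi> (c * x)"
  shows "has_complex_dim V 1"
proof -
  have car: "carrier V = range \<psi>" using bij by (simp add: bij_betw_def)
  have "Module.module class_ring V"
  proof (rule module_criteria)
    show "cring (class_ring :: complex ring)" using class_field field.axioms(1) domain.axioms(1) by blast
    show "\<forall>x\<in>carrier V. \<exists>y\<in>carrier V. x \<oplus>\<^bsub>V\<^esub> y = \<zero>\<^bsub>V\<^esub>"
    proof
      fix x assume "x \<in> carrier V"
      then obtain c where c: "x = \<psi> c" using car by auto
      show "\<exists>y\<in>carrier V. x \<oplus>\<^bsub>V\<^esub> y = \<zero>\<^bsub>V\<^esub>"
        by (rule bexI[of _ "\<psi> (- c)"]) (auto simp: c add zero car)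
    qed
  qed (auto simp: car add zero smult class_ring_simps algebra_simps)
  then interpret vectorspace class_ring V
    using class_field by (simp add: vectorspace_def)
  have ne: "\<psi> 1 \<noteq> \<zero>\<^bsub>V\<^esub>" using bij unfolding zero bij_betw_def by (metis UNIV_I inj_onD zero_neq_one)
  have "\<exists>c\<in>carrier class_ring. x = c \<odot>\<^bsub>V\<^esub> \<psi> 1" if "x \<in> carrier V" for x
    using that car smult[of _ 1] by (auto simp: class_ring_simps)
  then show ?thesis
    using dim_one_iso[of "\<psi> 1"] ne car vectorspace_axioms unfolding has_complex_dim_def by blast
qed

text \<open>These are the cosets of the maximal ideal at the origin. The class of 0 is that ideal
  itself.\<close>

definition residue_class :: "nat \<Rightarrow> coeffs ring \<Rightarrow> complex \<Rightarrow> coeffs set" where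
  "residue_class n R c = {f \<in> carrier R. f (0\<^sub>v n) = c}"

text \<open>Taking the constant term is a ring homomorphism onto \<complex>, and constants are
  representatives. Both rings are treated at once because the obstruction module is a quotient of
  power series while \<complex>[s]/<s> is one of polynomials.\<close>

lemma residue_class_properties:
  assumes R: "R = mfps_ring n \<or> R = mpoly_ring n"
  defines "Q \<equiv> quot_module (ideal_module R (carrier R)) (residue_class n R 0)"
  shows "bij_betw (residue_class n R) UNIV (carrier Q)"
    and "residue_class n R c \<oplus>\<^bsub>Q\<^esub> residue_class n R d = residue_class n R (c + d)"
    and "f \<in> carrier R \<Longrightarrow> f \<odot>\<^bsub>Q\<^esub> residue_class n R c = residue_class n R (f (0\<^sub>v n) * c)"
    and "\<zero>\<^bsub>Q\<^esub> = residue_class n R 0"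
proof -
  have const: "mconst n c \<in> carrier R" for c using R by auto
  have const0: "mconst n c (0\<^sub>v n) = c" for c by (simp add: mconst_def)
  have add: "f \<oplus>\<^bsub>R\<^esub> g = (\<lambda>p. f p + g p)" for f g
    using R by (auto simp: mfps_ring_simps mpoly_ring_simps)
  have mult0: "(f \<otimes>\<^bsub>R\<^esub> g) (0\<^sub>v n) = f (0\<^sub>v n) * g (0\<^sub>v n)" for f g
    using R by (auto simp: mult_at_0 mpoly_ring_simps(2))
  have closed: "f \<oplus>\<^bsub>R\<^esub> g \<in> carrier R" "f \<otimes>\<^bsub>R\<^esub> g \<in> carrier R" if "f \<in> carrier R" "g \<in> carrier R" for f g
    using R that by auto
  have closed': "(\<lambda>p. f p + g p) \<in> carrier R" if "f \<in> carrier R" "g \<in> carrier R" for f g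
    using closed(1)[OF that] by (simp add: add)
  have diff: "(\<lambda>p. f p - g p) \<in> carrier R" if "f \<in> carrier R" "g \<in> carrier R" for f g
    using R that mfps.minus_closed[of f n g] mpoly.minus_closed[of f n g] by (auto simp: mfps_minus mpoly_minus)
  have coset: "residue_class n R 0 +>\<^bsub>ideal_module R (carrier R)\<^esub> f = residue_class n R (f (0\<^sub>v n))"
    if f: "f \<in> carrier R" for f
  proof -
    have "g \<in> residue_class n R (f (0\<^sub>v n)) \<longleftrightarrow> (\<exists>h\<in>residue_class n R 0. g = (\<lambda>p. h p + f p))" for g
    proof
      assume "g \<in> residue_class n R (f (0\<^sub>v n))"
      then show "\<exists>h\<in>residue_class n R 0. g = (\<lambda>p. h p + f p)"
        using f diff by (intro bexI[of _ "\<lambda>p. g p - f p"]) (auto simp: residue_class_def)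
    next
      assume "\<exists>h\<in>residue_class n R 0. g = (\<lambda>p. h p + f p)"
      then show "g \<in> residue_class n R (f (0\<^sub>v n))"
        using f closed' by (auto simp: residue_class_def)
    qed
    then show ?thesis by (auto simp: a_r_coset_def' ideal_module_def add)
  qed
  have surj: "carrier Q = range (residue_class n R)"
  proof -
    have "carrier Q = (\<lambda>f. residue_class n R (f (0\<^sub>v n))) ` carrier R"
    proof -
      have "carrier (ideal_module R (carrier R)) = carrier R" by (simp add: ideal_module_def)
      then show ?thesis by (auto simp: Q_def quot_module_def A_RCOSETS_def' coset)
    qed
    also have "\<dots> = range (residue_class n R)"
    proof -
      have "residue_class n R c \<in> (\<lambda>f. residue_class n R (f (0\<^sub>v n))) ` carrier R" for c
        by (rule image_eqI[of _ _ "mconst n c"]) (use const const0 in auto)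
      then show ?thesis by auto
    qed
    finally show ?thesis .
  qed
  moreover have "inj (residue_class n R)"
  proof (rule injI)
    fix c d assume eq: "residue_class n R c = residue_class n R d"
    have "mconst n c \<in> residue_class n R c" using const const0 by (simp add: residue_class_def)
    then have "mconst n c \<in> residue_class n R d" unfolding eq .
    then show "c = d" by (simp add: residue_class_def const0)
  qed
  ultimately show "bij_betw (residue_class n R) UNIV (carrier Q)" by (auto simp: bij_betw_def)
  show "residue_class n R c \<oplus>\<^bsub>Q\<^esub> residue_class n R d = residue_class n R (c + d)" for c d
  proof -
    have "g \<in> residue_class n R (c + d) \<longleftrightarrow>
        (\<exists>f\<in>residue_class n R c. \<exists>h\<in>residue_class n R d. g = (\<lambda>p. f p + h p))" for g
    proof
      assume "g \<in> residue_class n R (c + d)"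
      then show "\<exists>f\<in>residue_class n R c. \<exists>h\<in>residue_class n R d. g = (\<lambda>p. f p + h p)"
        using const const0 diff
        by (intro bexI[of _ "mconst n c"] bexI[of _ "\<lambda>p. g p - mconst n c p"]) (auto simp: residue_class_def)
    next
      assume "\<exists>f\<in>residue_class n R c. \<exists>h\<in>residue_class n R d. g = (\<lambda>p. f p + h p)"
      then show "g \<in> residue_class n R (c + d)"
        using closed' by (auto simp: residue_class_def)
    qed
    then show ?thesis
      by (auto simp: Q_def quot_module_def set_add_def' ideal_module_def add)
  qed
  show "f \<odot>\<^bsub>Q\<^esub> residue_class n R c = residue_class n R (f (0\<^sub>v n) * c)" if f: "f \<in> carrier R" for f c
  proof -
    have "f \<odot>\<^bsub>Q\<^esub> residue_class n R c
      = (\<Union>g\<in>residue_class n R c. residue_class n R 0 +>\<^bsub>ideal_module R (carrier R)\<^esub> (f \<otimes>\<^bsub>R\<^esub> g))"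
      by (simp add: Q_def quot_module_def ideal_module_def)
    also have "\<dots> = (\<Union>g\<in>residue_class n R c. residue_class n R (f (0\<^sub>v n) * c))"
      by (intro SUP_cong refl, subst coset) (auto simp: residue_class_def mult0 closed f)
    also have "\<dots> = residue_class n R (f (0\<^sub>v n) * c)"
    proof -
      have "mconst n c \<in> residue_class n R c" using const const0 by (simp add: residue_class_def)
      then show ?thesis by blast
    qed
    finally show ?thesis .
  qed
  show "\<zero>\<^bsub>Q\<^esub> = residue_class n R 0" by (simp add: Q_def quot_module_def)
qed

lemma residue_module_dim:
  assumes "R = mfps_ring n \<or> R = mpoly_ring n"
  shows "has_complex_dim (complex_space n (quot_module (ideal_module R (carrier R)) (residue_class n R 0))) 1"
proof (rule has_complex_dim_one[where \<psi> = "residue_class n R"])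
  note * = residue_class_properties[OF assms]
  have "mconst n c \<in> carrier R" for c using assms by auto
  then show "c \<odot>\<^bsub>complex_space n (quot_module (ideal_module R (carrier R)) (residue_class n R 0))\<^esub>
      residue_class n R x = residue_class n R (c * x)" for c x
    by (simp add: complex_space_def *(3)) (simp add: mconst_def)
qed (simp_all add: complex_space_def residue_class_properties[OF assms])

text \<open>The isomorphism matches classes with the same constant term. It is linear over any
  \<open>\<sigma>\<close> that preserves constant terms, as scalars act through theirs.\<close>

lemma residue_module_isomorphic:
  assumes R: "R = mfps_ring n \<or> R = mpoly_ring n" and R': "R' = mfps_ring m \<or> R' = mpoly_ring m"
    and T: "T \<subseteq> carrier R" "\<And>f. f \<in> T \<Longrightarrow> \<sigma> f \<in> carrier R'" "\<And>f. f \<in> T \<Longrightarrow> \<sigma> f (0\<^sub>v m) = f (0\<^sub>v n)"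
  shows "isomorphic_over T \<sigma> (quot_module (ideal_module R (carrier R)) (residue_class n R 0))
    (quot_module (ideal_module R' (carrier R')) (residue_class m R' 0))"
proof -
  let ?Q = "quot_module (ideal_module R (carrier R)) (residue_class n R 0)"
  note Q = residue_class_properties[OF R] and Q' = residue_class_properties[OF R']
  let ?\<phi> = "residue_class m R' \<circ> inv_into UNIV (residue_class n R)"
  have inj: "inj (residue_class n R)" and car: "carrier ?Q = range (residue_class n R)"
    using Q(1) by (auto simp: bij_betw_def)
  have \<phi>: "?\<phi> (residue_class n R c) = residue_class m R' c" for c
    using inj by (simp add: inv_f_f)
  show ?thesis
    unfolding isomorphic_over_def
  proof (intro exI[of _ ?\<phi>] conjI ballI)
    show "bij_betw ?\<phi> (carrier ?Q) (carrier (quot_module (ideal_module R' (carrier R')) (residue_class m R' 0)))"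
      using bij_betw_inv_into[OF Q(1)] Q'(1) by (rule bij_betw_trans)
  next
    fix x y assume "x \<in> carrier ?Q" "y \<in> carrier ?Q"
    then obtain c d where "x = residue_class n R c" "y = residue_class n R d" using car by auto
    then show "?\<phi> (x \<oplus>\<^bsub>?Q\<^esub> y) = ?\<phi> x \<oplus>\<^bsub>quot_module (ideal_module R' (carrier R')) (residue_class m R' 0)\<^esub> ?\<phi> y"
      by (simp only: \<phi> Q(2) Q'(2))
  next
    fix f x assume "f \<in> T" "x \<in> carrier ?Q"
    then obtain c where "x = residue_class n R c" using car by auto
    moreover have "f \<in> carrier R" "\<sigma> f \<in> carrier R'" "\<sigma> f (0\<^sub>v m) = f (0\<^sub>v n)" using T \<open>f \<in> T\<close> by auto
    ultimately show "?\<phi> (f \<odot>\<^bsub>?Q\<^esub> x)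
      = \<sigma> f \<odot>\<^bsub>quot_module (ideal_module R' (carrier R')) (residue_class m R' 0)\<^esub> ?\<phi> x"
      by (simp only: \<phi> Q(3) Q'(3))
  qed
qed

section \<open>Squarefree monomials and ideals of power series\<close>

definition support_vec :: "nat \<Rightarrow> nat set \<Rightarrow> nat vec" where
  "support_vec n J = vec n (\<lambda>j. if j \<in> J then 1 else 0)"

lemma support_vec_carrier [simp]: "support_vec n J \<in> carrier_vec n"
  by (simp add: support_vec_def)

lemma support_vec_le_iff:
  assumes "S \<subseteq> {..<n}"
  shows "support_vec n S \<le> support_vec n T \<longleftrightarrow> S \<subseteq> T"
  using assms by (auto simp: support_vec_def less_eq_vec_def)

lemma t_prod_eq:
  assumes "finite J" "J \<subseteq> {..<n}"
  shows "t_prod n J = mmonom (support_vec n J)"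
  using assms
proof (induction J rule: finite_induct)
  case empty
  have "support_vec n {} = 0\<^sub>v n" by (auto simp: support_vec_def)
  then show ?case by (simp add: t_prod_def mfps_ring_simps(3))
next
  case (insert j J)
  have "t_prod n (insert j J) = mmonom (unit_vec n j) \<otimes>\<^bsub>mfps_ring n\<^esub> t_prod n J"
    using insert unfolding t_prod_def by (intro mfps.finprod_insert) auto
  also have "\<dots> = mmonom (unit_vec n j + support_vec n J)"
    using insert by (simp add: mmonom_mult_mmonom[of _ n])
  also have "unit_vec n j + support_vec n J = support_vec n (insert j J)"
    using insert by (intro eq_vecI) (auto simp: support_vec_def unit_vec_def)
  finally show ?case .
qed

lemma mfps_ideal_add:
  assumes "ideal I (mfps_ring n)" "f \<in> I" "g \<in> I"
  shows "(\<lambda>p. f p + g p) \<in> I"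
  using additive_subgroup.a_closed[OF ideal.axioms(1)[OF assms(1)] assms(2,3)] by (simp add: mfps_ring_simps)

lemma mfps_ideal_scale:
  assumes "ideal I (mfps_ring n)" "f \<in> I"
  shows "(\<lambda>p. c * f p) \<in> I"
proof -
  have "mconst n c \<otimes>\<^bsub>mfps_ring n\<^esub> f \<in> I"
    by (rule ideal.I_l_closed[OF assms]) simp
  then show ?thesis using ideal.Icarr[OF assms] by (simp add: mconst_mult)
qed

lemma mfps_ideal_sum:
  assumes "ideal I (mfps_ring n)" "\<And>i. i \<in> F \<Longrightarrow> f i \<in> I"
  shows "(\<lambda>p. \<Sum>i\<in>F. f i p) \<in> I"
  using assms(2)
proof (induction F rule: infinite_finite_induct)
  case (insert i F)
  then show ?case using mfps_ideal_add[OF assms(1)] by simp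
qed (use additive_subgroup.zero_closed[OF ideal.axioms(1)[OF assms(1)]] in \<open>auto simp: mfps_ring_simps\<close>)

text \<open>The coefficient of a multiple of f at q involves coefficients of f only at exponents
  below q. Ideals are bounded from above in this way: if no generator has a monomial in the downward
  closed set \<open>D\<close>, no element has.\<close>

lemma mfps_vanish_ideal:
  assumes "\<And>q r. q \<in> D \<Longrightarrow> r \<le> q \<Longrightarrow> r \<in> D"
  shows "ideal {f \<in> carrier (mfps_ring n). \<forall>q\<in>D. f q = 0} (mfps_ring n)" (is "ideal ?I _")
proof (rule mfps.ideal_commI)
  fix f g assume fg: "f \<in> ?I" "g \<in> ?I"
  then have "f \<oplus>\<^bsub>mfps_ring n\<^esub> g \<in> carrier (mfps_ring n)" by blast
  with fg show "f \<oplus>\<^bsub>mfps_ring n\<^esub> g \<in> ?I" by (simp add: mfps_ring_simps(5))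
next
  fix x f assume x: "x \<in> carrier (mfps_ring n)" and f: "f \<in> ?I"
  have "(x \<otimes>\<^bsub>mfps_ring n\<^esub> f) q = 0" if q: "q \<in> D" for q
    unfolding mfps_ring_simps
  proof (rule sum.neutral, clarify)
    fix r assume "r \<le> q"
    then have "q - r \<in> D" using assms[OF q] minus_le_vec by blast
    then show "x r * f (q - r) = 0" using f by simp
  qed
  moreover have "x \<otimes>\<^bsub>mfps_ring n\<^esub> f \<in> carrier (mfps_ring n)" using x f by blast
  ultimately show "x \<otimes>\<^bsub>mfps_ring n\<^esub> f \<in> ?I" by simp
qed (auto simp: mfps_ring_simps)

lemma mfps_colon_ideal:
  assumes I: "ideal I (mfps_ring n)" and e: "e \<in> carrier (mfps_ring n)"
  shows "ideal (colon (mfps_ring n) I e) (mfps_ring n)"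
proof (rule mfps.ideal_commI)
  note add = additive_subgroup.a_closed[OF ideal.axioms(1)[OF I]]
  have "\<zero>\<^bsub>mfps_ring n\<^esub> \<in> I" using additive_subgroup.zero_closed[OF ideal.axioms(1)[OF I]] .
  then show "\<zero>\<^bsub>mfps_ring n\<^esub> \<in> colon (mfps_ring n) I e" using e by (simp add: colon_def)
  fix f g assume "f \<in> colon (mfps_ring n) I e" "g \<in> colon (mfps_ring n) I e"
  then show "f \<oplus>\<^bsub>mfps_ring n\<^esub> g \<in> colon (mfps_ring n) I e"
    using e add by (simp add: colon_def mfps.l_distr)
next
  fix x f assume "x \<in> carrier (mfps_ring n)" "f \<in> colon (mfps_ring n) I e"
  then show "x \<otimes>\<^bsub>mfps_ring n\<^esub> f \<in> colon (mfps_ring n) I e"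
    using e ideal.I_l_closed[OF I] by (simp add: colon_def mfps.m_assoc)
qed (auto simp: colon_def)

text \<open>A monomial other than 1 is assigned to its first variable.\<close>

lemma mfps_maximal_ideal:
  assumes I: "ideal I (mfps_ring n)" "\<And>j. j < n \<Longrightarrow> mmonom (unit_vec n j) \<in> I"
    and f: "f \<in> carrier (mfps_ring n)" "f (0\<^sub>v n) = 0"
  shows "f \<in> I"
proof -
  define g where "g j = (\<lambda>p. if p \<in> carrier_vec n \<and> (\<forall>i<j. p $ i = 0) then f (p + unit_vec n j) else 0)" for j
  have gc: "g j \<in> carrier (mfps_ring n)" for j by (auto simp: g_def mfps_ring_simps)
  have "f p = (\<Sum>j<n. (mmonom (unit_vec n j) \<otimes>\<^bsub>mfps_ring n\<^esub> g j) p)" for p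
  proof (cases "p \<in> carrier_vec n \<and> p \<noteq> 0\<^sub>v n")
    case True
    have "\<exists>j. p $ j \<noteq> 0 \<and> j < n" using True by (auto simp: vec_eq_iff)
    then obtain k where k: "p $ k \<noteq> 0" "k < n" and "\<forall>i<k. \<not> (p $ i \<noteq> 0 \<and> i < n)"
      using exists_least_iff[of "\<lambda>j. p $ j \<noteq> 0 \<and> j < n"] by auto
    then have least: "p $ i = 0" if "i < k" for i using that by auto
    have "(mmonom (unit_vec n j) \<otimes>\<^bsub>mfps_ring n\<^esub> g j) p = (if j = k then f p else 0)" if j: "j < n" for j
    proof (cases "j = k")
      case True
      have le: "unit_vec n k \<le> p" using k \<open>p \<in> carrier_vec n \<and> p \<noteq> 0\<^sub>v n\<close>
        by (auto simp: less_eq_vec_def unit_vec_def)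
      moreover have "\<forall>i<k. (p - unit_vec n k) $ i = 0" using least k(2) by (auto simp: unit_vec_def)
      moreover have "p - unit_vec n k \<in> carrier_vec n" by (rule carrier_vecI) simp
      ultimately show ?thesis using True by (simp add: mmonom_mult g_def minus_add_vec[OF le])
    next
      case False
      have "g j (p - unit_vec n j) = 0" if le: "unit_vec n j \<le> p"
      proof -
        have "p $ j \<noteq> 0" using le j by (auto simp: less_eq_vec_def unit_vec_def dest!: spec[of _ j])
        then have "k < j" using least False by (meson not_less_iff_gr_or_eq)
        moreover have "(p - unit_vec n j) $ k \<noteq> 0" using k False by (simp add: unit_vec_def)
        ultimately show ?thesis by (auto simp: g_def)
      qed
      then show ?thesis using False by (simp add: mmonom_mult)
    qed
    then show ?thesis using k(2) by simp
  next
    case False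
    have "\<not> unit_vec n j \<le> p" if "j < n" for j
    proof
      assume le: "unit_vec n j \<le> p"
      then have "p \<in> carrier_vec n" using le_vec_carrier[OF le, of n] by simp
      then have "p = 0\<^sub>v n" using False by simp
      then have "p $ j = 0" using that by simp
      moreover have "1 \<le> p $ j"
        using le that by (auto simp: less_eq_vec_def unit_vec_def dest!: spec[of _ j])
      ultimately show False by simp
    qed
    moreover have "f p = 0" using False f by (auto simp: mfps_ring_simps(1))
    ultimately show ?thesis by (simp add: mmonom_mult)
  qed
  then have "f = (\<lambda>p. \<Sum>j<n. (mmonom (unit_vec n j) \<otimes>\<^bsub>mfps_ring n\<^esub> g j) p)" by blast
  also have "\<dots> \<in> I"
    using I gc by (intro mfps_ideal_sum[OF I(1)] ideal.I_r_closed[OF I(1)]) auto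
  finally show ?thesis .
qed

lemma maximal_ideal_one_variable:
  "Idl\<^bsub>mpoly_ring 1\<^esub> {mmonom (unit_vec 1 0)} = residue_class 1 (mpoly_ring 1) 0"
proof
  let ?I = "{f \<in> carrier (mpoly_ring 1). \<forall>p. f p \<noteq> 0 \<longrightarrow> unit_vec 1 0 \<le> p}"
  have le: "unit_vec 1 0 \<le> p \<longleftrightarrow> p \<noteq> 0\<^sub>v 1" if "p \<in> carrier_vec 1" for p :: "nat vec"
    using that by (auto simp: less_eq_vec_def unit_vec_def vec_eq_iff)
  have eq: "residue_class 1 (mpoly_ring 1) 0 = ?I"
    using le by (auto simp: residue_class_def mpoly_ring_simps)
  show "Idl\<^bsub>mpoly_ring 1\<^esub> {mmonom (unit_vec 1 0)} \<subseteq> residue_class 1 (mpoly_ring 1) 0"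
    unfolding eq
  proof (rule mpoly.genideal_minimal)
    show "ideal ?I (mpoly_ring 1)"
      by (rule mpoly_support_ideal) (auto simp: less_eq_vec_def unit_vec_def)
    show "{mmonom (unit_vec 1 0)} \<subseteq> ?I" by (auto simp: mmonom_def mpoly_ring_simps)
  qed
  have "ideal (Idl\<^bsub>mpoly_ring 1\<^esub> {mmonom (unit_vec 1 0)}) (mpoly_ring 1)"
    by (rule mpoly.genideal_ideal) simp
  moreover have "mmonom (unit_vec 1 0) \<in> Idl\<^bsub>mpoly_ring 1\<^esub> {mmonom (unit_vec 1 0)}"
    by (rule mpoly.genideal_self') simp
  ultimately show "residue_class 1 (mpoly_ring 1) 0 \<subseteq> Idl\<^bsub>mpoly_ring 1\<^esub> {mmonom (unit_vec 1 0)}"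
    unfolding eq using monom_multiple_in_ideal[of _ 1 "unit_vec 1 0"] by auto
qed

section \<open>The substitution \<open>t\<^sub>j \<mapsto> (B s)\<^sub>j\<close> at the origin\<close>

lemma mpoly_finsum_eval:
  assumes "\<And>i. i \<in> F \<Longrightarrow> g i \<in> carrier (mpoly_ring n)"
  shows "(\<Oplus>\<^bsub>mpoly_ring n\<^esub> i\<in>F. g i) p = (\<Sum>i\<in>F. g i p)"
  using assms
proof (induction F rule: infinite_finite_induct)
  case (insert i F)
  then have "(\<Oplus>\<^bsub>mpoly_ring n\<^esub> i\<in>insert i F. g i) = g i \<oplus>\<^bsub>mpoly_ring n\<^esub> (\<Oplus>\<^bsub>mpoly_ring n\<^esub> i\<in>F. g i)"
    by (intro mpoly.finsum_insert) auto
  with insert show ?case by (simp add: mpoly_ring_simps(5))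
qed (auto simp: mpoly_ring_simps(4))

lemma mpoly_finprod_at_0:
  assumes "finite F" "\<And>i. i \<in> F \<Longrightarrow> g i \<in> carrier (mpoly_ring n)"
  shows "(\<Otimes>\<^bsub>mpoly_ring n\<^esub> i\<in>F. g i) (0\<^sub>v n) = (\<Prod>i\<in>F. g i (0\<^sub>v n))"
  using assms
proof (induction F rule: finite_induct)
  case empty
  then show ?case by (simp add: mpoly_ring_simps(3) mmonom_def)
next
  case (insert i F)
  then have "(\<Otimes>\<^bsub>mpoly_ring n\<^esub> i\<in>insert i F. g i) = g i \<otimes>\<^bsub>mpoly_ring n\<^esub> (\<Otimes>\<^bsub>mpoly_ring n\<^esub> i\<in>F. g i)"
    by (intro mpoly.finprod_insert) auto
  with insert show ?case by (simp add: mpoly_ring_simps(2) mult_at_0)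
qed

lemma mpoly_pow_at_0: "(f [^]\<^bsub>mpoly_ring n\<^esub> (k::nat)) (0\<^sub>v n) = f (0\<^sub>v n) ^ k"
  by (induction k) (auto simp: mpoly_ring_simps(2,3) mult_at_0 mmonom_def)

lemma ell_closed [simp]: "ell B j \<in> carrier (mpoly_ring (dim_col B))"
  by (simp add: ell_def)

text \<open>The linear forms l_j vanish at the origin, so the substitution preserves constant terms.
  This is all that an isomorphism of residue fields asks of it.\<close>

lemma gale_subst_at_0:
  assumes "f \<in> carrier (mpoly_ring (dim_row B))"
  shows "gale_subst B f \<in> carrier (mpoly_ring (dim_col B))"
    "gale_subst B f (0\<^sub>v (dim_col B)) = f (0\<^sub>v (dim_row B))"
proof -
  let ?S = "mpoly_ring (dim_col B)"
  let ?g = "\<lambda>p. mconst (dim_col B) (f p) \<otimes>\<^bsub>?S\<^esub> (\<Otimes>\<^bsub>?S\<^esub> j \<in> {..<dim_row B}. ell B j [^]\<^bsub>?S\<^esub> (p $ j))"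
  have gc: "?g p \<in> carrier ?S" for p by (intro mpoly.m_closed mpoly.finprod_closed) auto
  then show "gale_subst B f \<in> carrier ?S"
    unfolding gale_subst_def Let_def by (intro mpoly.finsum_closed) auto
  have "?g p (0\<^sub>v (dim_col B)) = (if p = 0\<^sub>v (dim_row B) then f p else 0)" if "f p \<noteq> 0" for p
  proof -
    have p: "p \<in> carrier_vec (dim_row B)" using that assms by (auto simp: mpoly_ring_simps)
    have "?g p (0\<^sub>v (dim_col B)) = f p * (\<Prod>j<dim_row B. 0 ^ (p $ j))"
      by (simp add: mpoly_ring_simps(2) mult_at_0 mpoly_finprod_at_0 mpoly_pow_at_0 ell_def linform_at_0 mconst_def)
    \<comment> \<open>As 0 ^ 0 = 1, exactly the constant monomial survives.\<close>
    also have "(\<Prod>j<dim_row B. (0::complex) ^ (p $ j)) = (if p = 0\<^sub>v (dim_row B) then 1 else 0)"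
      using p by (auto simp: vec_eq_iff power_0_left)
    finally show ?thesis by simp
  qed
  then have "gale_subst B f (0\<^sub>v (dim_col B)) = (\<Sum>p\<in>{p. f p \<noteq> 0}. if p = 0\<^sub>v (dim_row B) then f p else 0)"
    unfolding gale_subst_def Let_def by (simp add: mpoly_finsum_eval gc)
  also have "\<dots> = f (0\<^sub>v (dim_row B))"
    using assms by (simp add: sum.delta mpoly_ring_simps)
  finally show "gale_subst B f (0\<^sub>v (dim_col B)) = f (0\<^sub>v (dim_row B))" .
qed

section \<open>The obstruction module of the example\<close>

text \<open>Otherwise set literals such as \<open>{0, 1}\<close> are rewritten to \<open>{0, Suc 0}\<close>.\<close>

declare One_nat_def [simp del]

lemma ex_t_prods:
  "t_prod 5 {0, 1} = mmonom (support_vec 5 {0, 1})" "t_prod 5 {2} = mmonom (support_vec 5 {2})"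
  "t_prod 5 {0, 1, 4} = mmonom (support_vec 5 {0, 1, 4})" "t_prod 5 {2, 3} = mmonom (support_vec 5 {2, 3})"
  "t_prod 5 {0, 1, 2, 3} = mmonom (support_vec 5 {0, 1, 2, 3})"
  "t_prod 5 {0, 1, 2, 4} = mmonom (support_vec 5 {0, 1, 2, 4})"
  by (rule t_prod_eq; simp)+

text \<open>The i-th entry of A t for i < 4. Modulo U it identifies t_i with b_i t_4, so that t_4
  plays the role of s.\<close>

definition ex_u :: "nat \<Rightarrow> coeffs" where
  "ex_u i = (\<lambda>p. mmonom (unit_vec 5 i) p - of_int (ex_b $ i) * mmonom (unit_vec 5 4) p)"

lemma ex_u_eq: "i < 4 \<Longrightarrow> linform 5 (\<lambda>j. of_int (ex_A $$ (i, j))) = ex_u i"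
  unfolding linform_def ex_u_def by (rule ext, simp only: sum_less_5 less_4) (auto simp: ex_A_index)

lemma ex_U_ideal: "ideal (ideal_U ex_A) (mfps_ring 5)"
  unfolding ideal_U_def Let_def by (simp, rule mfps.genideal_ideal) auto

lemma ex_u_in_U: "i < 4 \<Longrightarrow> ex_u i \<in> ideal_U ex_A"
  unfolding ideal_U_def Let_def
  by (rule mfps.genideal_memberI) (auto simp flip: ex_u_eq)

lemma ex_U_at_0: "f \<in> ideal_U ex_A \<Longrightarrow> f (0\<^sub>v 5) = 0"
proof -
  have "ideal_U ex_A \<subseteq> {f \<in> carrier (mfps_ring 5). \<forall>q\<in>{0\<^sub>v 5}. f q = 0}"
    unfolding ideal_U_def Let_def
    by (simp only: ex_A_simps, rule mfps.genideal_minimal, rule mfps_vanish_ideal)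
      (auto simp: le_zero_vec linform_at_0)
  then show "f \<in> ideal_U ex_A \<Longrightarrow> f (0\<^sub>v 5) = 0" by blast
qed

lemma ex_M_eq: "ideal_M 5 ex_N = Idl\<^bsub>mfps_ring 5\<^esub> {t_prod 5 {0, 1}, t_prod 5 {2}}"
  unfolding ideal_M_def ex_Inter_N Diff_empty by (simp add: ex_N_def)

lemma ex_M_ideal: "ideal (ideal_M 5 ex_N) (mfps_ring 5)"
  unfolding ex_M_eq by (rule mfps.genideal_ideal) (simp add: ex_t_prods)

text \<open>Neither generator of M divides a proper divisor of t_0 t_1: the first is t_0 t_1 itself
  and the second, t_2, does not divide it.\<close>

lemma ex_M_vanish:
  assumes "f \<in> ideal_M 5 ex_N" "q \<le> support_vec 5 {0, 1}" "q \<noteq> support_vec 5 {0, 1}"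
  shows "f q = 0"
proof -
  let ?D = "{q. q \<le> support_vec 5 {0, 1} \<and> q \<noteq> support_vec 5 {0, 1}}"
  have "\<not> support_vec 5 {2} \<le> support_vec 5 {0, 1}" by (subst support_vec_le_iff) auto
  then have "ideal_M 5 ex_N \<subseteq> {f \<in> carrier (mfps_ring 5). \<forall>q\<in>?D. f q = 0}"
    unfolding ex_M_eq ex_t_prods
    by (intro mfps.genideal_minimal mfps_vanish_ideal) (auto simp: mmonom_apply intro: order_trans dest: order_antisym)
  with assms show ?thesis by blast
qed

lemma ex_P_eq: "ideal_P ex_A ex_v ex_N = Idl\<^bsub>mfps_ring 5\<^esub>
  {t_prod 5 {0, 1, 4}, t_prod 5 {0, 1, 2, 3}, t_prod 5 {0, 1, 2, 4}, t_prod 5 {2, 3}}"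
  unfolding ideal_P_def Let_def ex_mixed_supports by simp

lemma ex_P_ideal: "ideal (ideal_P ex_A ex_v ex_N) (mfps_ring 5)"
  unfolding ex_P_eq by (rule mfps.genideal_ideal) (simp add: ex_t_prods)

lemma ex_P_generators: "t_prod 5 {0, 1, 4} \<in> ideal_P ex_A ex_v ex_N" "t_prod 5 {2, 3} \<in> ideal_P ex_A ex_v ex_N"
  unfolding ex_P_eq by (rule mfps.genideal_memberI, blast)+

text \<open>Each generator of P contains one of the variables t_2, t_3, t_4, so none divides t_0
  t_1.\<close>

lemma ex_P_vanish:
  assumes "f \<in> ideal_P ex_A ex_v ex_N" "q \<le> support_vec 5 {0, 1}"
  shows "f q = 0"
proof -
  have "\<not> support_vec 5 S \<le> support_vec 5 {0, 1}" if "S \<subseteq> {..<5}" "\<not> S \<subseteq> {0, 1}" for S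
    using that by (simp add: support_vec_le_iff)
  then have *: "\<not> support_vec 5 {0, 1, 4} \<le> support_vec 5 {0, 1}" "\<not> support_vec 5 {0, 1, 2, 3} \<le> support_vec 5 {0, 1}"
    "\<not> support_vec 5 {0, 1, 2, 4} \<le> support_vec 5 {0, 1}" "\<not> support_vec 5 {2, 3} \<le> support_vec 5 {0, 1}"
    by (simp_all add: support_vec_le_iff)
  have "ideal_P ex_A ex_v ex_N \<subseteq> {f \<in> carrier (mfps_ring 5). \<forall>q\<in>{q. q \<le> support_vec 5 {0, 1}}. f q = 0}"
    unfolding ex_P_eq ex_t_prods
    by (intro mfps.genideal_minimal mfps_vanish_ideal) (use * in \<open>auto simp: mmonom_apply intro: order_trans\<close>)
  with assms show ?thesis by blast
qed

lemma ex_e_in_U_plus_P: "t_prod 5 {0, 1} \<in> ideal_U ex_A <+>\<^bsub>mfps_ring 5\<^esub> ideal_P ex_A ex_v ex_N"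
proof -
  let ?t = "\<lambda>i. unit_vec 5 i :: nat vec"
  have mult: "(\<lambda>p. mmonom (?t j + ?t i) p - of_int (ex_b $ i) * mmonom (?t j + ?t 4) p) \<in> ideal_U ex_A"
    if "i < 4" for i j
  proof -
    have "mmonom (?t j) \<otimes>\<^bsub>mfps_ring 5\<^esub> ex_u i \<in> ideal_U ex_A"
      by (rule ideal.I_l_closed[OF ex_U_ideal ex_u_in_U[OF that]]) simp
    moreover have "(mmonom (?t j) \<otimes>\<^bsub>mfps_ring 5\<^esub> ex_u i) p
        = (mmonom (?t j) \<otimes>\<^bsub>mfps_ring 5\<^esub> mmonom (?t i)) p
          - of_int (ex_b $ i) * (mmonom (?t j) \<otimes>\<^bsub>mfps_ring 5\<^esub> mmonom (?t 4)) p" for p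
      unfolding mmonom_mult by (simp add: ex_u_def)
    then have "mmonom (?t j) \<otimes>\<^bsub>mfps_ring 5\<^esub> ex_u i
        = (\<lambda>p. mmonom (?t j + ?t i) p - of_int (ex_b $ i) * mmonom (?t j + ?t 4) p)"
      by (simp add: mmonom_mult_mmonom[of _ 5] fun_eq_iff)
    ultimately show ?thesis by simp
  qed
  note add = mfps_ideal_add[OF ex_U_ideal] and scale = mfps_ideal_scale[OF ex_U_ideal]
  \<comment> \<open>Modulo U, t_0 t_1 becomes b_0 b_1 t_4^2 = t_4^2 and t_2 t_3 becomes b_2 b_3
    t_4^2 = 2 t_4^2, whence the factor 1/2. Writing u_i = t_i - b_i t_4, the identity is t_0 t_1 =
    t_1 u_0 + t_4 u_1 - (1/2) t_3 u_2 + t_4 u_3 + (1/2) t_2 t_3.\<close>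
  let ?u = "\<lambda>p. ((mmonom (?t 1 + ?t 0) p - of_int (ex_b $ 0) * mmonom (?t 1 + ?t 4) p) +
      (mmonom (?t 4 + ?t 1) p - of_int (ex_b $ 1) * mmonom (?t 4 + ?t 4) p)) +
      (- 1 / 2 * (mmonom (?t 3 + ?t 2) p - of_int (ex_b $ 2) * mmonom (?t 3 + ?t 4) p) +
      (mmonom (?t 4 + ?t 3) p - of_int (ex_b $ 3) * mmonom (?t 4 + ?t 4) p))"
  let ?q = "\<lambda>p. 1 / 2 * t_prod 5 {2, 3} p"
  have u: "?u \<in> ideal_U ex_A" by (intro add scale mult) simp_all
  have q: "?q \<in> ideal_P ex_A ex_v ex_N" by (intro mfps_ideal_scale[OF ex_P_ideal] ex_P_generators)
  have sup: "support_vec 5 {0, 1} = ?t 1 + ?t 0" "support_vec 5 {2, 3} = ?t 3 + ?t 2"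
    by (auto simp: support_vec_def unit_vec_def)
  have comm: "?t 4 + ?t 1 = ?t 1 + ?t 4" "?t 4 + ?t 3 = ?t 3 + ?t 4" by auto
  have "t_prod 5 {0, 1} = (\<lambda>p. ?u p + ?q p)"
    unfolding ex_t_prods sup comm by (simp add: fun_eq_iff algebra_simps)
  then have "t_prod 5 {0, 1} = ?u \<oplus>\<^bsub>mfps_ring 5\<^esub> ?q" by (simp only: mfps_ring_simps(5))
  then show ?thesis using u q unfolding set_add_def' by blast
qed

lemma ex_colon_total:
  "colon (mfps_ring 5) (ideal_U ex_A <+>\<^bsub>mfps_ring 5\<^esub> ideal_P ex_A ex_v ex_N) (t_prod 5 {0, 1}) = carrier (mfps_ring 5)"
  using ideal.I_l_closed[OF mfps.add_ideals[OF ex_U_ideal ex_P_ideal] ex_e_in_U_plus_P]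
  by (auto simp: colon_def)

text \<open>In a product u m the coefficient of t_0 t_1 splits into terms u(q) m(t_0 t_1 / q). For q
  = 1 the first factor is a constant term of U, and for other q the second is a coefficient of M at
  a proper divisor of t_0 t_1. Both vanish.\<close>

lemma ex_UM_P_vanish:
  assumes "f \<in> (ideal_U ex_A \<cdot>\<^bsub>mfps_ring 5\<^esub> ideal_M 5 ex_N) <+>\<^bsub>mfps_ring 5\<^esub> ideal_P ex_A ex_v ex_N"
  shows "f (support_vec 5 {0, 1}) = 0"
proof -
  let ?s = "support_vec 5 {0, 1}"
  have "g ?s = 0" if "g \<in> ideal_U ex_A \<cdot>\<^bsub>mfps_ring 5\<^esub> ideal_M 5 ex_N" for g
    using that
  proof (induction rule: ideal_prod.induct)
    case (prod u m)
    show ?case unfolding mfps_ring_simps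
    proof (rule sum.neutral, clarify)
      fix q assume q: "q \<le> ?s"
      show "u q * m (?s - q) = 0"
      proof (cases "q = 0\<^sub>v 5")
        case True
        then show ?thesis using ex_U_at_0[OF prod(1)] by simp
      next
        case False
        have "?s - q \<noteq> ?s"
        proof
          assume "?s - q = ?s"
          then have "q = ?s - ?s" using minus_minus_vec[OF q] by simp
          also have "\<dots> = 0\<^sub>v 5" by (auto simp: support_vec_def)
          finally show False using False by simp
        qed
        then show ?thesis using ex_M_vanish[OF prod(2)] minus_le_vec[OF q] by simp
      qed
    qed
  qed (simp add: mfps_ring_simps(5))
  moreover obtain g h where "g \<in> ideal_U ex_A \<cdot>\<^bsub>mfps_ring 5\<^esub> ideal_M 5 ex_N"
    "h \<in> ideal_P ex_A ex_v ex_N" "f = g \<oplus>\<^bsub>mfps_ring 5\<^esub> h"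
    using assms unfolding set_add_def' by blast
  ultimately show ?thesis using ex_P_vanish[of h ?s] by (simp add: mfps_ring_simps(5))
qed

text \<open>The coefficient of t_0 t_1 in f e is the constant term of f, and UM + P has no such
  coefficient. Conversely u_i e lies in UM because e lies in M, and t_4 e = t_0 t_1 t_4 is a
  generator of P. So t_4 and each t_i = u_i + b_i t_4 multiply e into UM + P, and the variables
  generate the maximal ideal.\<close>

lemma ex_colon_maximal:
  "colon (mfps_ring 5) ((ideal_U ex_A \<cdot>\<^bsub>mfps_ring 5\<^esub> ideal_M 5 ex_N) <+>\<^bsub>mfps_ring 5\<^esub> ideal_P ex_A ex_v ex_N)
     (t_prod 5 {0, 1}) = residue_class 5 (mfps_ring 5) 0" (is "colon ?R ?K ?e = _")
proof
  let ?s = "support_vec 5 {0, 1}"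
  have e: "?e = mmonom ?s" by (rule ex_t_prods)
  have UM: "ideal (ideal_U ex_A \<cdot>\<^bsub>?R\<^esub> ideal_M 5 ex_N) ?R"
    by (rule mfps.ideal_prod_is_ideal[OF ex_U_ideal ex_M_ideal])
  have K: "ideal ?K ?R" by (rule mfps.add_ideals[OF UM ex_P_ideal])
  show "colon ?R ?K ?e \<subseteq> residue_class 5 ?R 0"
  proof
    fix f assume f: "f \<in> colon ?R ?K ?e"
    then have "(f \<otimes>\<^bsub>?R\<^esub> mmonom ?s) ?s = 0" using ex_UM_P_vanish by (simp add: colon_def e)
    moreover have "(f \<otimes>\<^bsub>?R\<^esub> mmonom ?s) ?s = f (?s - ?s)"
      by (subst mfps_mult_comm) (simp add: mmonom_mult)
    moreover have "?s - ?s = 0\<^sub>v 5" by (auto simp: support_vec_def)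
    ultimately show "f \<in> residue_class 5 ?R 0" using f by (simp add: residue_class_def colon_def)
  qed
  have ec: "?e \<in> carrier ?R" by (simp add: e)
  have C: "ideal (colon ?R ?K ?e) ?R" by (rule mfps_colon_ideal[OF K ec])
  have "?e \<in> ideal_M 5 ex_N" unfolding ex_M_eq by (rule mfps.genideal_memberI) blast
  then have "ex_u i \<otimes>\<^bsub>?R\<^esub> ?e \<in> ideal_U ex_A \<cdot>\<^bsub>?R\<^esub> ideal_M 5 ex_N" if "i < 4" for i
    by (rule ideal_prod.prod[OF ex_u_in_U[OF that]])
  then have "ex_u i \<otimes>\<^bsub>?R\<^esub> ?e \<in> ?K" if "i < 4" for i
    using that additive_subgroup.zero_closed[OF ideal.axioms(1)[OF ex_P_ideal]] ec
      ideal.Icarr[OF UM, of "ex_u i \<otimes>\<^bsub>?R\<^esub> ?e"]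
    unfolding set_add_def' by (auto intro!: exI[of _ "ex_u i \<otimes>\<^bsub>?R\<^esub> ?e"] bexI)
  then have u: "ex_u i \<in> colon ?R ?K ?e" if "i < 4" for i
    using that ideal.Icarr[OF ex_U_ideal ex_u_in_U] by (simp add: colon_def)
  have "mmonom (unit_vec 5 4) \<otimes>\<^bsub>?R\<^esub> ?e = t_prod 5 {0, 1, 4}"
  proof -
    have "unit_vec 5 4 + ?s = support_vec 5 {0, 1, 4}" by (auto simp: support_vec_def unit_vec_def)
    then show ?thesis by (simp add: ex_t_prods mmonom_mult_mmonom[of _ 5])
  qed
  then have "mmonom (unit_vec 5 4) \<otimes>\<^bsub>?R\<^esub> ?e \<in> ?K"
    using ex_P_generators(1) additive_subgroup.zero_closed[OF ideal.axioms(1)[OF UM]]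
      ideal.Icarr[OF ex_P_ideal ex_P_generators(1)]
    unfolding set_add_def' by (auto intro!: bexI[of _ "\<zero>\<^bsub>?R\<^esub>"] bexI)
  then have t4: "mmonom (unit_vec 5 4) \<in> colon ?R ?K ?e" by (simp add: colon_def)
  have t: "mmonom (unit_vec 5 i) \<in> colon ?R ?K ?e" if "i < 5" for i
  proof (cases "i = 4")
    case False
    with that have i: "i < 4" by simp
    have "(\<lambda>p. ex_u i p + of_int (ex_b $ i) * mmonom (unit_vec 5 4) p) \<in> colon ?R ?K ?e"
      by (rule mfps_ideal_add[OF C u[OF i] mfps_ideal_scale[OF C t4]])
    then show ?thesis by (simp add: ex_u_def)
  qed (simp add: t4)
  show "residue_class 5 ?R 0 \<subseteq> colon ?R ?K ?e"
    using mfps_maximal_ideal[OF C t] by (auto simp: residue_class_def)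
qed

lemma ex_obstruction:
  "obstruction ex_A ex_v ex_N =
     quot_module (ideal_module (mfps_ring 5) (carrier (mfps_ring 5))) (residue_class 5 (mfps_ring 5) 0)"
  unfolding obstruction_def Let_def ex_nsupp ex_Inter_N Diff_empty ex_A_simps
    ex_colon_total ex_colon_maximal ..

lemma ex_obstruction_dim: "has_complex_dim (complex_space 5 (obstruction ex_A ex_v ex_N)) 1"
  unfolding ex_obstruction by (rule residue_module_dim) simp

lemma ex_obstruction_isomorphic:
  assumes "B \<in> carrier_mat 5 1"
  shows "isomorphic_over (carrier (mpoly_ring 5)) (gale_subst B) (obstruction ex_A ex_v ex_N)
    (quot_module (ideal_module (mpoly_ring 1) (carrier (mpoly_ring 1))) (Idl\<^bsub>mpoly_ring 1\<^esub> {mmonom (unit_vec 1 0)}))"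
  unfolding ex_obstruction maximal_ideal_one_variable
proof (rule residue_module_isomorphic)
  have B: "dim_row B = 5" "dim_col B = 1" using assms by auto
  fix f assume f: "f \<in> carrier (mpoly_ring 5)"
  show "gale_subst B f \<in> carrier (mpoly_ring 1)" "gale_subst B f (0\<^sub>v 1) = f (0\<^sub>v 5)"
    using gale_subst_at_0[of f B] f B by auto
qed (auto intro: mpoly_carrier_subset[THEN subsetD])

section \<open>The ambient and intrinsic ideals of the example\<close>

definition s_pow :: "nat \<Rightarrow> coeffs" where
  "s_pow k = mmonom (vec 1 (\<lambda>_. k))"

lemma s_pow_0: "s_pow 0 = \<one>\<^bsub>mpoly_ring 1\<^esub>"
  by (auto simp: s_pow_def mpoly_ring_simps(3) intro!: arg_cong[of _ _ mmonom])

lemma s_pow_1: "s_pow 1 = mmonom (unit_vec 1 0)"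
  by (auto simp: s_pow_def intro!: arg_cong[of _ _ mmonom])

lemma s_pow_closed [simp]: "s_pow k \<in> carrier (mpoly_ring 1)"
  by (simp add: s_pow_def)

lemma scaled_mult:
  "(\<lambda>p. a * f p) \<otimes>\<^bsub>mfps_ring n\<^esub> (\<lambda>p. b * g p) = (\<lambda>p. a * b * (f \<otimes>\<^bsub>mfps_ring n\<^esub> g) p)"
  unfolding mfps_ring_simps by (simp add: sum_distrib_left algebra_simps)

lemma s_pow_mult: "s_pow j \<otimes>\<^bsub>mfps_ring 1\<^esub> s_pow k = s_pow (j + k)"
proof -
  have "vec 1 (\<lambda>_. j) + vec 1 (\<lambda>_. k) = vec 1 (\<lambda>_. j + k)" by auto
  then show ?thesis by (simp add: s_pow_def mmonom_mult_mmonom[of _ 1])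
qed

lemma ell_eq: "dim_col B = 1 \<Longrightarrow> ell B j = (\<lambda>p. of_int (B $$ (j, 0)) * s_pow 1 p)"
  unfolding ell_def s_pow_1 by (simp add: linform_def One_nat_def)

text \<open>With a single variable each l_j is an entry of B times s, so a product is determined by
  its size up to the constant in front.\<close>

lemma ell_prod_eq:
  assumes "dim_col B = 1" "finite Y"
  shows "ell_prod B Y = (\<lambda>p. (\<Prod>j\<in>Y. of_int (B $$ (j, 0))) * s_pow (card Y) p)"
  using assms(2)
proof (induction Y rule: finite_induct)
  case empty
  then show ?case using assms(1) by (simp add: ell_prod_def s_pow_0)
next
  case (insert j Y)
  have "ell_prod B (insert j Y) = ell B j \<otimes>\<^bsub>mpoly_ring 1\<^esub> ell_prod B Y"
    using insert assms(1) ell_closed[of B] unfolding ell_prod_def assms(1)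
    by (intro mpoly.finprod_insert) auto
  also have "\<dots> = (\<lambda>p. of_int (B $$ (j, 0)) * (\<Prod>j\<in>Y. of_int (B $$ (j, 0))) * s_pow (1 + card Y) p)"
    unfolding insert.IH ell_eq[OF assms(1)] mpoly_ring_simps(2) scaled_mult s_pow_mult ..
  finally show ?case using insert by (simp add: plus_1_eq_Suc)
qed

lemma ell_prod_closed [simp]: "ell_prod B Y \<in> carrier (mpoly_ring (dim_col B))"
  unfolding ell_prod_def by (intro mpoly.finprod_closed) auto

lemma s_pow_at_0: "s_pow k (0\<^sub>v 1) = (if k = 0 then 1 else 0)"
  by (auto simp: s_pow_def mmonom_def vec_eq_iff)

lemma ell_prod_at_0:
  assumes "dim_col B = 1" "finite Y" "Y \<noteq> {}"
  shows "ell_prod B Y (0\<^sub>v 1) = 0"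
  using assms by (simp add: ell_prod_eq s_pow_at_0 card_gt_0_iff)

lemma mpoly_ideal_scale:
  assumes "ideal I (mpoly_ring n)" "f \<in> I"
  shows "(\<lambda>p. c * f p) \<in> I"
proof -
  have "mconst n c \<otimes>\<^bsub>mpoly_ring n\<^esub> f \<in> I"
    by (rule ideal.I_l_closed[OF assms]) simp
  moreover have "f \<in> carrier (mfps_ring n)"
    using ideal.Icarr[OF assms] mpoly_carrier_subset by blast
  ultimately show ?thesis by (simp add: mpoly_ring_simps(2) mconst_mult)
qed

lemma s_pow_in_ideal:
  assumes "dim_col B = 1" "ideal I (mpoly_ring 1)" "ell_prod B Y \<in> I" "finite Y"
    "\<And>j. j \<in> Y \<Longrightarrow> B $$ (j, 0) \<noteq> 0"
  shows "s_pow (card Y) \<in> I"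
proof -
  let ?c = "\<Prod>j\<in>Y. complex_of_int (B $$ (j, 0))"
  have "?c \<noteq> 0" using assms(4,5) by simp
  then have "s_pow (card Y) = (\<lambda>p. inverse ?c * ell_prod B Y p)"
    by (simp add: ell_prod_eq[OF assms(1,4)] fun_eq_iff)
  then show ?thesis using mpoly_ideal_scale[OF assms(2,3)] by simp
qed

text \<open>The theorem speaks about every Gale dual. Such a B is the column b up to sign, and it
  enters the computations through the fact that its entries are nonzero.\<close>

locale ex_gale_dual =
  fixes B :: "int mat"
  assumes B: "B \<in> carrier_mat 5 1" and gale: "gale_dual ex_A B"
begin

lemma dims [simp]: "dim_row B = 5" "dim_col B = 1"
  using B by auto

lemma entries_nonzero: "j < 5 \<Longrightarrow> B $$ (j, 0) \<noteq> 0"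
proof -
  assume j: "j < 5"
  obtain \<sigma> :: int where \<sigma>: "\<sigma> = 1 \<or> \<sigma> = -1" and eq: "\<And>i. i < 5 \<Longrightarrow> B $$ (i, 0) = \<sigma> * ex_b $ i"
    using gale_dual_rank_one[OF gale _ ex_kernel, of 4] by auto
  have "ex_b $ j \<noteq> 0" using j by (auto simp: less_5)
  moreover have "\<sigma> \<noteq> 0" using \<sigma> by auto
  ultimately show ?thesis unfolding eq[OF j] by simp
qed

lemma ell_H_ideal: "ideal (ideal_ell_H ex_A B ex_v ex_N) (mpoly_ring 1)"
  unfolding ideal_ell_H_def dims by (rule mpoly.genideal_ideal) (use ell_prod_closed[of B] in auto)

lemma ell_H_contains: "s_pow 2 \<in> ideal_ell_H ex_A B ex_v ex_N"
proof -
  have "ell_prod B {2, 3} \<in> ideal_ell_H ex_A B ex_v ex_N"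
    unfolding ideal_ell_H_def ex_min_H by (rule mpoly.genideal_memberI) blast
  then have "s_pow (card {2, 3::nat}) \<in> ideal_ell_H ex_A B ex_v ex_N"
    by (rule s_pow_in_ideal[OF dims(2) ell_H_ideal])
      (use entries_nonzero[of 2] entries_nonzero[of 3] in auto)
  moreover have "card {2, 3::nat} = 2" by simp
  ultimately show ?thesis by (simp only:)
qed

lemma ell_prod_01: "ell_prod B {0, 1} = (\<lambda>p. (\<Prod>j\<in>{0, 1}. of_int (B $$ (j, 0))) * s_pow 2 p)"
proof -
  have "card {0, 1::nat} = 2" by simp
  then show ?thesis using ell_prod_eq[OF dims(2), of "{0, 1}"] by (simp only: finite.intros)
qed

text \<open>E = {0, 1} and the minimal set {2, 3} have the same size, so l^E is a scalar multiple of
  s^2, which the ideal of the l^H contains.\<close>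

lemma J_intr: "ideal_J_intr ex_A B ex_v ex_N = carrier (mpoly_ring 1)"
proof -
  have "ell_prod B {0, 1} \<in> ideal_ell_H ex_A B ex_v ex_N"
    unfolding ell_prod_01 by (rule mpoly_ideal_scale[OF ell_H_ideal ell_H_contains])
  then show ?thesis
    using ideal.I_l_closed[OF ell_H_ideal]
    unfolding ideal_J_intr_def colon_def dims ex_nsupp ex_Inter_N Diff_empty by blast
qed

end

section \<open>The intrinsic coefficient space\<close>

lemma mderiv_funpow:
  "(mderiv 0 ^^ k) f (vec 1 (\<lambda>_. m)) = fact (m + k) / fact m * f (vec 1 (\<lambda>_. m + k))"
proof (induction k arbitrary: m)
  case (Suc k)
  have cancel: "c * (F / (c * d) * v) = F / d * v" if "c \<noteq> 0" for c F d v :: complex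
    using that by simp
  have ne: "of_nat (Suc m) \<noteq> (0::complex)" by (simp only: of_nat_eq_0_iff)
  have "vec 1 (\<lambda>_. m) + unit_vec (dim_vec (vec 1 (\<lambda>_. m))) 0 = vec 1 (\<lambda>_. Suc m)" by auto
  then have "(mderiv 0 ^^ Suc k) f (vec 1 (\<lambda>_. m)) = of_nat (Suc m) * (mderiv 0 ^^ k) f (vec 1 (\<lambda>_. Suc m))"
    by (simp add: mderiv_def)
  also have "\<dots> = fact (m + Suc k) / fact m * f (vec 1 (\<lambda>_. m + Suc k))"
    by (simp only: Suc.IH fact_Suc cancel[OF ne] add_Suc_right add_Suc)
  finally show ?case .
qed simp

lemma diff_at_0_one_variable:
  assumes "q \<in> carrier (mpoly_ring 1)"
  shows "diff_at_0 1 q f = (\<Sum>\<gamma>\<in>{\<gamma>. q \<gamma> \<noteq> 0}. q \<gamma> * fact (\<gamma> $ 0) * f \<gamma>)"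
  unfolding diff_at_0_def
proof (rule sum.cong[OF refl])
  fix \<gamma> assume "\<gamma> \<in> {\<gamma>. q \<gamma> \<noteq> 0}"
  then have \<gamma>: "\<gamma> \<in> carrier_vec 1" using assms by (auto simp: mpoly_ring_simps)
  then have eq: "vec 1 (\<lambda>_. \<gamma> $ 0) = \<gamma>" by auto
  have zero: "0\<^sub>v 1 = vec 1 (\<lambda>_. 0::nat)" by auto
  have "multi_op mderiv \<gamma> f (0\<^sub>v 1) = (mderiv 0 ^^ (\<gamma> $ 0)) f (0\<^sub>v 1)"
    using \<gamma> by (simp add: multi_op_def One_nat_def)
  then have "multi_op mderiv \<gamma> f (0\<^sub>v 1) = (mderiv 0 ^^ (\<gamma> $ 0)) f (vec 1 (\<lambda>_. 0))"
    unfolding zero .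
  then show "q \<gamma> * multi_op mderiv \<gamma> f (0\<^sub>v 1) = q \<gamma> * fact (\<gamma> $ 0) * f \<gamma>"
    using mderiv_funpow[of "\<gamma> $ 0" f 0] by (simp add: eq)
qed

text \<open>At u = 0 both falling factorials are empty products, so the cleared equation reads g =
  l^E and has a unique solution.\<close>

lemma scaled_a_0:
  "scaled_a B v N (0\<^sub>v n) = ell_prod B (nsupp v - \<Inter>N)"
proof -
  let ?r = "dim_col B" and ?e = "ell_prod B (nsupp v - \<Inter>N)"
  have "pos_part (0\<^sub>v n) = 0\<^sub>v n" "neg_part (0\<^sub>v n) = 0\<^sub>v n" by (auto simp: pos_part_def neg_part_def)
  moreover have "falling_s B c (0\<^sub>v n) = \<one>\<^bsub>mfps_ring ?r\<^esub>" for c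
  proof -
    have "falling_s B c (0\<^sub>v n) = \<one>\<^bsub>mpoly_ring ?r\<^esub>"
      unfolding falling_s_def Let_def by (rule mpoly.finprod_one_eqI) simp
    then show ?thesis by (simp add: mpoly_ring_simps(3) mfps_ring_simps(3))
  qed
  moreover have "?e \<in> carrier (mfps_ring ?r)" using ell_prod_closed mpoly_carrier_subset by blast
  ultimately show ?thesis
    unfolding scaled_a_def Let_def by (intro the_equality) auto
qed

context ex_gale_dual
begin

text \<open>The coefficient of x^v in the series carries the factor l^E, a multiple of s^2.\<close>

lemma Psi_vanish:
  assumes "\<gamma> \<in> carrier_vec 1" "\<gamma> $ 0 < 2"
  shows "Psi ex_A B ex_v ex_N (0\<^sub>v 5) \<gamma> p = 0"
proof -
  have "ell_prod B {0, 1} \<otimes>\<^bsub>mfps_ring 1\<^esub> h = (\<lambda>\<gamma>. (\<Prod>j\<in>{0, 1}. of_int (B $$ (j, 0))) * (s_pow 2 \<otimes>\<^bsub>mfps_ring 1\<^esub> h) \<gamma>)" for h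
    unfolding ell_prod_01 using scaled_mult[where f = "s_pow 2" and b = 1 and g = h] by simp
  moreover have "(s_pow 2 \<otimes>\<^bsub>mfps_ring 1\<^esub> h) \<gamma> = 0" for h
    unfolding s_pow_def mmonom_mult using assms by (auto simp: less_eq_vec_def)
  ultimately show ?thesis
    by (simp add: Psi_def scaled_a_0 ex_nsupp ex_Inter_N)
qed

text \<open>An operator q orthogonal to an ideal containing s^2 has degree at most 1, whereas the
  coefficient of x^v starts at s^2. Differentiating it by q at s = 0 gives zero.\<close>

lemma intrinsic_coefficients: "intrinsic_coefficients ex_A B ex_v ex_N = {\<zero>\<^bsub>mpoly_ring 5\<^esub>}"
proof -
  let ?I = "ideal_ell_H ex_A B ex_v ex_N"
  let ?f = "\<lambda>q p. diff_at_0 1 q (\<lambda>\<gamma>. Psi ex_A B ex_v ex_N (0\<^sub>v 5) \<gamma> p)"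
  have zero: "?f q = (\<lambda>p. 0)"
    if q: "q \<in> orthogonal 1 ?I" for q
  proof
    fix p
    have qc: "q \<in> carrier (mpoly_ring 1)" using q by (simp add: orthogonal_def)
    have "\<gamma> $ 0 < 2" if \<gamma>: "q \<gamma> \<noteq> 0" for \<gamma>
    proof (rule ccontr)
      assume ge: "\<not> \<gamma> $ 0 < 2"
      have \<gamma>c: "\<gamma> \<in> carrier_vec 1" using qc \<gamma> by (auto simp: mpoly_ring_simps)
      then have "vec 1 (\<lambda>_. 2) \<le> \<gamma>" using ge by (auto simp: less_eq_vec_def)
      then have "vec 1 (\<lambda>_. 2) \<le> p" if "mmonom \<gamma> p \<noteq> 0" for p
        using that by (simp add: mmonom_apply split: if_splits)
      with \<gamma>c have "mmonom \<gamma> \<in> ?I"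
        by (intro monom_multiple_in_ideal[OF ell_H_ideal ell_H_contains[unfolded s_pow_def]]) simp_all
      then have "diff_at_0 1 q (mmonom \<gamma>) = 0" using q by (simp add: orthogonal_def)
      \<comment> \<open>Pairing with the monomial s^\<gamma> isolates the coefficient of q at
        \<gamma>, up to the nonzero factorial.\<close>
      moreover have "diff_at_0 1 q (mmonom \<gamma>) = (\<Sum>\<gamma>'\<in>{\<gamma>. q \<gamma> \<noteq> 0}. if \<gamma>' = \<gamma> then q \<gamma> * fact (\<gamma> $ 0) else 0)"
        unfolding diff_at_0_one_variable[OF qc] by (rule sum.cong) (auto simp: mmonom_apply)
      moreover have "\<dots> = q \<gamma> * fact (\<gamma> $ 0)" using \<gamma> qc by (simp add: mpoly_ring_simps(1))
      ultimately show False using \<gamma> by simp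
    qed
    then show "diff_at_0 1 q (\<lambda>\<gamma>. Psi ex_A B ex_v ex_N (0\<^sub>v 5) \<gamma> p) = 0"
      unfolding diff_at_0_one_variable[OF qc]
      using qc by (intro sum.neutral) (auto simp: mpoly_ring_simps Psi_vanish)
  qed
  have "(\<lambda>p. 0) \<in> orthogonal 1 ?I"
    by (simp add: orthogonal_def diff_at_0_def mpoly_ring_simps)
  then have "orthogonal 1 ?I \<noteq> {}" by auto
  moreover have "?f ` orthogonal 1 ?I = (\<lambda>q p. 0) ` orthogonal 1 ?I"
    by (rule image_cong[OF refl zero])
  moreover have "intrinsic_coefficients ex_A B ex_v ex_N = ?f ` orthogonal 1 ?I"
    unfolding intrinsic_coefficients_def Let_def dims ex_A_simps by (rule Setcompr_eq_image)
  ultimately show ?thesis by (simp only: image_constant_conv if_False mpoly_ring_simps(4))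
qed

end

section \<open>The module F/Z and the ambient ideal\<close>

lemma abelian_subgroup_submodule:
  assumes "Module.module R M" "submodule R N M"
  shows "abelian_subgroup N M"
proof -
  interpret M: Module.module R M by fact
  interpret N: submodule R N M by fact
  have "subgroup N (add_monoid M)"
  proof (rule M.add.subgroupI)
    show "N \<noteq> {}" using N.zero_closed by blast
    fix x assume x: "x \<in> N"
    then have "\<ominus>\<^bsub>M\<^esub> x = (\<ominus>\<^bsub>R\<^esub> \<one>\<^bsub>R\<^esub>) \<odot>\<^bsub>M\<^esub> x"
      using M.smult_minus_1 N.subset by (metis subsetD)
    moreover have "\<ominus>\<^bsub>R\<^esub> \<one>\<^bsub>R\<^esub> \<in> carrier R" by simp
    ultimately show "\<ominus>\<^bsub>M\<^esub> x \<in> N" using N.smult_closed x by simp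
  qed (use N.subset N.zero_closed N.m_closed in auto)
  then show ?thesis
    by (intro abelian_subgroupI3 additive_subgroupI) (auto intro: M.abelian_group_axioms)
qed

text \<open>This is the submodule sF of F. It turns out to be Z.\<close>

definition vanishing_F :: "nat set set \<Rightarrow> (nat set \<Rightarrow> coeffs) set" where
  "vanishing_F N = {g \<in> carrier (free_F 1 N). \<forall>X\<in>min_G N. g X (0\<^sub>v 1) = 0}"

lemma free_F_simps:
  "carrier (free_F r N) = min_G N \<rightarrow>\<^sub>E carrier (mpoly_ring r)"
  "g \<oplus>\<^bsub>free_F r N\<^esub> h = (\<lambda>X\<in>min_G N. g X \<oplus>\<^bsub>mpoly_ring r\<^esub> h X)"
  "f \<odot>\<^bsub>free_F r N\<^esub> g = (\<lambda>X\<in>min_G N. f \<otimes>\<^bsub>mpoly_ring r\<^esub> g X)"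
  "\<zero>\<^bsub>free_F r N\<^esub> = (\<lambda>X\<in>min_G N. \<zero>\<^bsub>mpoly_ring r\<^esub>)"
  by (simp_all add: free_F_def mpoly.func_space_def)

lemma free_F_module: "Module.module (mpoly_ring r) (free_F r N)"
  unfolding free_F_def by (rule mpoly.func_space_is_module)

lemma vanishing_F_submodule: "submodule (mpoly_ring 1) (vanishing_F N) (free_F 1 N)"
proof (rule submodule.intro)
  show "Module.module (mpoly_ring 1) (free_F 1 N)" by (rule free_F_module)
  interpret F: Module.module "mpoly_ring 1" "free_F 1 N" by (rule free_F_module)
  show "vanishing_F N \<subseteq> carrier (free_F 1 N)" by (auto simp: vanishing_F_def)
  show "\<zero>\<^bsub>free_F 1 N\<^esub> \<in> vanishing_F N"
    using F.zero_closed by (auto simp: vanishing_F_def free_F_simps(4) mpoly_ring_simps(4))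
  show "g \<oplus>\<^bsub>free_F 1 N\<^esub> h \<in> vanishing_F N" if "g \<in> vanishing_F N" "h \<in> vanishing_F N" for g h
    using F.a_closed[of g h] that by (auto simp: vanishing_F_def free_F_simps(2) mpoly_ring_simps(5))
  show "f \<odot>\<^bsub>free_F 1 N\<^esub> g \<in> vanishing_F N" if "f \<in> carrier (mpoly_ring 1)" "g \<in> vanishing_F N" for f g
    using F.smult_closed[of f g] that
    by (auto simp: vanishing_F_def free_F_simps(3) mpoly_ring_simps(2) mult_at_0)
qed

lemma eta_closed: "eta r N G \<in> carrier (free_F r N)"
  by (auto simp: eta_def free_F_simps)

lemma smult_eta_vanishing:
  assumes "f \<in> carrier (mpoly_ring 1)" "G \<in> min_G N"
  shows "f \<odot>\<^bsub>free_F 1 N\<^esub> eta 1 N G \<in> vanishing_F N \<longleftrightarrow> f (0\<^sub>v 1) = 0"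
proof -
  interpret F: Module.module "mpoly_ring 1" "free_F 1 N" by (rule free_F_module)
  have "(f \<odot>\<^bsub>free_F 1 N\<^esub> eta 1 N G) X (0\<^sub>v 1) = (if X = G then f (0\<^sub>v 1) else 0)" if "X \<in> min_G N" for X
    using that by (simp add: free_F_simps(3) eta_def mpoly_ring_simps(2-4) mult_at_0 mmonom_apply)
  then show ?thesis
    using F.smult_closed[OF assms(1) eta_closed[of 1 N G]] assms(2) by (auto simp: vanishing_F_def)
qed

context ex_gale_dual
begin

text \<open>Every coefficient l^Y in a relation has nonempty Y, as {0, 1} and {2} are incomparable
  and no H equals its G; hence Z lies in sF. Conversely the differences H - G are {4} and {3}, and
  the corresponding relations are nonzero multiples of s times the two basis elements.\<close>

lemma relations_Z_eq:
  assumes \<iota>: "\<iota> {0, 1, 4} = {0, 1}" "\<iota> {2, 3} = {2}"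
  shows "relations_Z ex_A B ex_v ex_N \<iota> = vanishing_F ex_N"
proof -
  let ?F = "free_F 1 ex_N" and ?S = "mpoly_ring 1"
  interpret F: Module.module ?S ?F by (rule free_F_module)
  interpret V: submodule ?S "vanishing_F ex_N" ?F by (rule vanishing_F_submodule)
  interpret VA: abelian_subgroup "vanishing_F ex_N" ?F
    by (rule abelian_subgroup_submodule[OF free_F_module vanishing_F_submodule])
  define T where "T = {(ell_prod B (G' - G) \<odot>\<^bsub>?F\<^esub> eta 1 ex_N G) \<ominus>\<^bsub>?F\<^esub> (ell_prod B (G - G') \<odot>\<^bsub>?F\<^esub> eta 1 ex_N G')
         | G G'. G \<in> min_G ex_N \<and> G' \<in> min_G ex_N \<and> G \<noteq> G'} \<union>
        {ell_prod B (H - \<iota> H) \<odot>\<^bsub>?F\<^esub> eta 1 ex_N (\<iota> H) | H. H \<in> min_H ex_A ex_v ex_N}"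
  have Z: "relations_Z ex_A B ex_v ex_N \<iota> = F.span T"
    by (simp add: relations_Z_def Let_def T_def)
  have gen: "ell_prod B Y \<odot>\<^bsub>?F\<^esub> eta 1 ex_N G \<in> vanishing_F ex_N"
    if "finite Y" "Y \<noteq> {}" "G \<in> min_G ex_N" for Y G
    using that ell_prod_closed[of B Y] by (simp add: smult_eta_vanishing ell_prod_at_0)
  have "T \<subseteq> vanishing_F ex_N"
  proof
    fix x assume "x \<in> T"
    then consider (1) G G' where "G \<in> min_G ex_N" "G' \<in> min_G ex_N" "G \<noteq> G'"
        "x = (ell_prod B (G' - G) \<odot>\<^bsub>?F\<^esub> eta 1 ex_N G) \<ominus>\<^bsub>?F\<^esub> (ell_prod B (G - G') \<odot>\<^bsub>?F\<^esub> eta 1 ex_N G')"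
      | (2) H where "H \<in> min_H ex_A ex_v ex_N" "x = ell_prod B (H - \<iota> H) \<odot>\<^bsub>?F\<^esub> eta 1 ex_N (\<iota> H)"
      unfolding T_def by blast
    then show "x \<in> vanishing_F ex_N"
    proof cases
      case 1
      have fin: "finite G" "finite G'" using 1(1,2) by (auto simp: ex_min_G)
      have "x = a \<and> y = b \<or> x = b \<and> y = a" if "x \<in> {a, b}" "y \<in> {a, b}" "x \<noteq> y" for x y a b :: "nat set"
        using that by auto
      from this[OF 1(1,2)[unfolded ex_min_G] 1(3)]
      have GG': "G = {0, 1} \<and> G' = {2} \<or> G = {2} \<and> G' = {0, 1}" .
      have "{2} - {0, 1::nat} \<noteq> {}" "{0, 1} - {2::nat} \<noteq> {}" by (simp_all add: insert_Diff_if)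
      then have "G' - G \<noteq> {}" "G - G' \<noteq> {}" using GG' by (elim disjE conjE; simp only:)+
      then have "ell_prod B (G' - G) \<odot>\<^bsub>?F\<^esub> eta 1 ex_N G \<in> vanishing_F ex_N"
        "ell_prod B (G - G') \<odot>\<^bsub>?F\<^esub> eta 1 ex_N G' \<in> vanishing_F ex_N"
        using 1 fin by (auto intro!: gen)
      then show ?thesis unfolding 1(4) a_minus_def by (intro VA.a_closed VA.a_inv_closed)
    next
      case 2
      have d: "{0, 1, 4} - {0, 1} = {4::nat}" "{2, 3} - {2} = {3::nat}" by auto
      have "H = {0, 1, 4} \<or> H = {2, 3}" using 2(1) unfolding ex_min_H by blast
      then show ?thesis
        unfolding 2(2) by (elim disjE) (simp_all only: \<iota> d, (rule gen; simp add: ex_min_G)+)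
    qed
  qed
  then have sub: "F.span T \<subseteq> vanishing_F ex_N" by (rule F.span_is_subset[OF _ vanishing_F_submodule])
  have TC: "T \<subseteq> carrier ?F" using \<open>T \<subseteq> vanishing_F ex_N\<close> V.subset by blast
  interpret Z: submodule ?S "F.span T" ?F by (rule F.span_is_submodule[OF TC])
  have mem: "f \<odot>\<^bsub>?F\<^esub> eta 1 ex_N G \<in> F.span T"
    if G: "ell_prod B {j} \<odot>\<^bsub>?F\<^esub> eta 1 ex_N G \<in> T" "j < 5" and f: "f \<in> carrier ?S" "f (0\<^sub>v 1) = 0" for f G j
  proof -
    \<comment> \<open>The multipliers carrying this basis element into the span form an ideal of
      \<complex>[s]. It contains a nonzero multiple of s, hence every polynomial without constant
      term.\<close>
    let ?I = "{f \<in> carrier ?S. f \<odot>\<^bsub>?F\<^esub> eta 1 ex_N G \<in> F.span T}"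
    have I: "ideal ?I ?S"
    proof (rule mpoly.ideal_commI)
      show "\<zero>\<^bsub>?S\<^esub> \<in> ?I" using Z.zero_closed by (simp add: eta_closed)
      show "f \<oplus>\<^bsub>?S\<^esub> g \<in> ?I" if "f \<in> ?I" "g \<in> ?I" for f g
        using that Z.m_closed by (auto simp: F.smult_l_distr eta_closed)
      show "x \<otimes>\<^bsub>?S\<^esub> f \<in> ?I" if "x \<in> carrier ?S" "f \<in> ?I" for x f
        using that Z.smult_closed by (auto simp: F.smult_assoc1 eta_closed)
    qed auto
    have "ell_prod B {j} \<in> ?I" using G(1) F.in_own_span[OF TC] ell_prod_closed[of B "{j}"] by auto
    then have "s_pow (card {j}) \<in> ?I"
      by (rule s_pow_in_ideal[OF dims(2) I]) (use entries_nonzero[OF G(2)] in simp_all)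
    moreover have "card {j} = 1" by simp
    ultimately have "s_pow 1 \<in> ?I" by (simp only:)
    then have "Idl\<^bsub>?S\<^esub> {s_pow 1} \<subseteq> ?I" by (intro mpoly.genideal_minimal[OF I]) blast
    then show ?thesis
      using f unfolding s_pow_1 maximal_ideal_one_variable residue_class_def by blast
  qed
  have d: "{0, 1, 4} - {0, 1} = {4::nat}" "{2, 3} - {2} = {3::nat}" by auto
  have "ell_prod B ({0, 1, 4} - \<iota> {0, 1, 4}) \<odot>\<^bsub>?F\<^esub> eta 1 ex_N (\<iota> {0, 1, 4}) \<in> T"
    "ell_prod B ({2, 3} - \<iota> {2, 3}) \<odot>\<^bsub>?F\<^esub> eta 1 ex_N (\<iota> {2, 3}) \<in> T"
    unfolding T_def ex_min_H by blast+
  then have T: "ell_prod B {4} \<odot>\<^bsub>?F\<^esub> eta 1 ex_N {0, 1} \<in> T" "ell_prod B {3} \<odot>\<^bsub>?F\<^esub> eta 1 ex_N {2} \<in> T"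
    unfolding \<iota> d .
  have "vanishing_F ex_N \<subseteq> F.span T"
  proof
    fix g assume g: "g \<in> vanishing_F ex_N"
    then have gX: "g X \<in> carrier ?S" "g X (0\<^sub>v 1) = 0" if "X \<in> min_G ex_N" for X
      using that by (auto simp: vanishing_F_def free_F_simps(1))
    have G: "{0, 1} \<in> min_G ex_N" "{2} \<in> min_G ex_N" by (simp_all add: ex_min_G)
    have ne: "{2} \<noteq> {0, 1::nat}" by auto
    have "g = (g {0, 1} \<odot>\<^bsub>?F\<^esub> eta 1 ex_N {0, 1}) \<oplus>\<^bsub>?F\<^esub> (g {2} \<odot>\<^bsub>?F\<^esub> eta 1 ex_N {2})" (is "_ = ?h")
    proof (rule extensionalityI[of _ "min_G ex_N"])
      show "g \<in> extensional (min_G ex_N)"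
        using g by (auto simp: vanishing_F_def free_F_simps(1) PiE_def)
      show "?h \<in> extensional (min_G ex_N)" by (simp add: free_F_simps(2))
      fix X assume X: "X \<in> min_G ex_N"
      then have "X = {0, 1} \<or> X = {2}" unfolding ex_min_G by blast
      then show "g X = ?h X"
        using X gX G ne ne[symmetric] by (elim disjE) (simp_all add: free_F_simps(2,3) eta_def)
    qed
    also have "\<dots> \<in> F.span T"
      using mem[OF T(1) _ gX[OF G(1)]] mem[OF T(2) _ gX[OF G(2)]] by (intro Z.m_closed) auto
    finally show "g \<in> F.span T" .
  qed
  with sub show ?thesis unfolding Z by blast
qed

text \<open>The forced choice G = E makes the class in question that of the basis element of {0, 1}.
  Modulo sF, a polynomial multiplies it to zero exactly when its constant term is 0.\<close>

lemma J_amb: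
  assumes "admissible_choice ex_A ex_v ex_N \<iota> G"
  shows "ideal_J_amb ex_A B ex_v ex_N \<iota> G = Idl\<^bsub>mpoly_ring 1\<^esub> {mmonom (unit_vec 1 0)}"
proof -
  let ?F = "free_F 1 ex_N" and ?S = "mpoly_ring 1" and ?Z = "vanishing_F ex_N"
  interpret F: Module.module ?S ?F by (rule free_F_module)
  interpret V: submodule ?S ?Z ?F by (rule vanishing_F_submodule)
  interpret VA: abelian_subgroup ?Z ?F
    by (rule abelian_subgroup_submodule[OF free_F_module vanishing_F_submodule])
  let ?\<eta> = "eta 1 ex_N {0, 1}"
  have \<iota>: "\<iota> {0, 1, 4} = {0, 1}" "\<iota> {2, 3} = {2}" and G: "G = {0, 1}"
    using assms by (simp_all add: ex_admissible)
  have Z: "relations_Z ex_A B ex_v ex_N \<iota> = ?Z" by (rule relations_Z_eq[OF \<iota>])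
  have "ell_prod B {} = \<one>\<^bsub>?S\<^esub>" by (simp add: ell_prod_def)
  then have \<epsilon>: "epsilon ex_A B ex_v ex_N \<iota> G = ?Z +>\<^bsub>?F\<^esub> ?\<eta>"
    by (simp add: epsilon_def Let_def Z G ex_nsupp ex_Inter_N eta_closed)
  have GG: "{0, 1} \<in> min_G ex_N" by (simp add: ex_min_G)
  have "(\<Union>x\<in>?Z +>\<^bsub>?F\<^esub> ?\<eta>. ?Z +>\<^bsub>?F\<^esub> (f \<odot>\<^bsub>?F\<^esub> x)) = ?Z \<longleftrightarrow> f (0\<^sub>v 1) = 0" if f: "f \<in> carrier ?S" for f
  proof
    have \<eta>: "?\<eta> \<in> ?Z +>\<^bsub>?F\<^esub> ?\<eta>" by (rule VA.a_rcos_self[OF eta_closed])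
    {
      assume *: "(\<Union>x\<in>?Z +>\<^bsub>?F\<^esub> ?\<eta>. ?Z +>\<^bsub>?F\<^esub> (f \<odot>\<^bsub>?F\<^esub> x)) = ?Z"
      have "f \<odot>\<^bsub>?F\<^esub> ?\<eta> \<in> ?Z +>\<^bsub>?F\<^esub> (f \<odot>\<^bsub>?F\<^esub> ?\<eta>)"
        by (rule VA.a_rcos_self) (simp add: f eta_closed)
      with * \<eta> have "f \<odot>\<^bsub>?F\<^esub> ?\<eta> \<in> ?Z" by blast
      then show "f (0\<^sub>v 1) = 0" using smult_eta_vanishing[OF f GG] by simp
    next
      assume f0: "f (0\<^sub>v 1) = 0"
      have "f \<odot>\<^bsub>?F\<^esub> x \<in> ?Z" if "x \<in> ?Z +>\<^bsub>?F\<^esub> ?\<eta>" for x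
      proof -
        obtain z where z: "z \<in> ?Z" "x = z \<oplus>\<^bsub>?F\<^esub> ?\<eta>" using \<open>x \<in> ?Z +>\<^bsub>?F\<^esub> ?\<eta>\<close> unfolding a_r_coset_def' by blast
        then have "f \<odot>\<^bsub>?F\<^esub> x = f \<odot>\<^bsub>?F\<^esub> z \<oplus>\<^bsub>?F\<^esub> f \<odot>\<^bsub>?F\<^esub> ?\<eta>"
          using V.subset f eta_closed by (auto intro!: F.smult_r_distr)
        then show ?thesis using z f f0 smult_eta_vanishing[OF f GG] by simp
      qed
      then have "?Z +>\<^bsub>?F\<^esub> (f \<odot>\<^bsub>?F\<^esub> x) = ?Z" if "x \<in> ?Z +>\<^bsub>?F\<^esub> ?\<eta>" for x
        using that VA.a_rcos_const by blast
      then show "(\<Union>x\<in>?Z +>\<^bsub>?F\<^esub> ?\<eta>. ?Z +>\<^bsub>?F\<^esub> (f \<odot>\<^bsub>?F\<^esub> x)) = ?Z" using \<eta> by blast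
    }
  qed
  then show ?thesis
    unfolding ideal_J_amb_def Let_def dims Z \<epsilon> maximal_ideal_one_variable
    by (auto simp: quot_module_def residue_class_def)
qed

end

declare One_nat_def [simp]

section \<open>The action of the Weyl algebra on \<open>x\<^sup>v\<close>\<close>

text \<open>The single term c x^(v + z) free of logarithms; exponents of series are recorded
  relative to v.\<close>

definition monomial_series :: "nat \<Rightarrow> int vec \<Rightarrow> complex \<Rightarrow> log_series" where
  "monomial_series n z c = (\<lambda>u. if u = z then mconst n c else (\<lambda>_. 0))"

lemma mderiv_mconst: "j < n \<Longrightarrow> mderiv j (mconst n c) p = 0"
proof -
  assume j: "j < n"
  have "p + unit_vec (dim_vec p) j \<noteq> 0\<^sub>v n"
  proof
    assume eq: "p + unit_vec (dim_vec p) j = 0\<^sub>v n"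
    have "dim_vec (p + unit_vec (dim_vec p) j) = dim_vec p" by simp
    then have dim: "dim_vec p = n" unfolding eq by simp
    have "(p + unit_vec (dim_vec p) j) $ j = p $ j + 1" using j dim by simp
    then show False unfolding eq using j by simp
  qed
  then show ?thesis by (simp add: mderiv_def mconst_def)
qed

lemma series_deriv_monomial:
  assumes "z \<in> carrier_vec n" "j < n"
  shows "series_deriv v j (monomial_series n z c)
    = monomial_series n (z - unit_vec n j) (c * (v $ j + of_int (z $ j)))"
proof
  fix u :: "int vec"
  have iff: "u + unit_vec (dim_vec u) j = z \<longleftrightarrow> u = z - unit_vec n j"
  proof
    assume eq: "u + unit_vec (dim_vec u) j = z"
    have "dim_vec (u + unit_vec (dim_vec u) j) = dim_vec u" by simp
    then have "dim_vec u = n" unfolding eq using assms by simp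
    then show "u = z - unit_vec n j" using eq assms by (intro eq_vecI) auto
  next
    assume "u = z - unit_vec n j"
    then show "u + unit_vec (dim_vec u) j = z" using assms by (intro eq_vecI) auto
  qed
  show "series_deriv v j (monomial_series n z c) u
    = monomial_series n (z - unit_vec n j) (c * (v $ j + of_int (z $ j))) u"
  proof (cases "u = z - unit_vec n j")
    case True
    then have eq: "u + unit_vec (dim_vec u) j = z" using iff by blast
    have m: "monomial_series n z c z = mconst n c" by (simp add: monomial_series_def)
    have "series_deriv v j (monomial_series n z c) u
        = (\<lambda>p. (v $ j + of_int (z $ j)) * mconst n c p)"
      unfolding series_deriv_def Let_def eq m mderiv_mconst[OF assms(2)] by simp
    also have "\<dots> = mconst n (c * (v $ j + of_int (z $ j)))" by (auto simp: mconst_def)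
    finally show ?thesis using True by (simp add: monomial_series_def)
  next
    case False
    then have m: "monomial_series n z c (u + unit_vec (dim_vec u) j) = (\<lambda>_. 0)"
      using iff by (simp add: monomial_series_def)
    show ?thesis using False unfolding series_deriv_def Let_def m by (simp add: mderiv_def monomial_series_def)
  qed
qed

lemma series_deriv_funpow_monomial:
  assumes "z \<in> carrier_vec n" "j < n"
  shows "(series_deriv v j ^^ k) (monomial_series n z c)
    = monomial_series n (z - int k \<cdot>\<^sub>v unit_vec n j) (c * (\<Prod>i<k. v $ j + of_int (z $ j) - of_nat i))"
proof (induction k)
  case 0
  have "z - int 0 \<cdot>\<^sub>v unit_vec n j = z" using assms by (intro eq_vecI) auto
  then show ?case by simp
next
  case (Suc k)
  have "z - int k \<cdot>\<^sub>v unit_vec n j - unit_vec n j = z - int (Suc k) \<cdot>\<^sub>v unit_vec n j"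
    using assms by (intro eq_vecI) (auto simp: algebra_simps)
  moreover have "(z - int k \<cdot>\<^sub>v unit_vec n j) $ j = z $ j - int k" using assms by simp
  moreover have "z - int k \<cdot>\<^sub>v unit_vec n j \<in> carrier_vec n" using assms by (intro carrier_vecI) simp
  ultimately show ?case
    using series_deriv_monomial[of "z - int k \<cdot>\<^sub>v unit_vec n j" n j v] assms(2)
    by (simp add: Suc.IH algebra_simps)
qed

text \<open>Differentiating one variable after another produces one falling product each, and since
  the variables are distinct every one starts from its original exponent v_j.\<close>

lemma multi_op_monomial:
  assumes "b \<in> carrier_vec n"
  shows "multi_op (series_deriv v) b (monomial_series n (0\<^sub>v n) c)
    = monomial_series n (- map_vec int b) (c * falling v b)"
proof -
  have "fold (\<lambda>j. series_deriv v j ^^ (b $ j)) [0..<m] (monomial_series n (0\<^sub>v n) c)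
    = monomial_series n (vec n (\<lambda>j. if j < m then - int (b $ j) else 0)) (c * (\<Prod>j<m. \<Prod>k<b $ j. v $ j - of_nat k))"
    if "m \<le> n" for m
    using that
  proof (induction m)
    case 0
    have "vec n (\<lambda>j. if j < 0 then - int (b $ j) else 0) = 0\<^sub>v n" by (intro eq_vecI) auto
    then show ?case by simp
  next
    case (Suc m)
    let ?z = "vec n (\<lambda>j. if j < m then - int (b $ j) else 0)"
    have "?z - int (b $ m) \<cdot>\<^sub>v unit_vec n m = vec n (\<lambda>j. if j < Suc m then - int (b $ j) else 0)"
      using Suc.prems by (intro eq_vecI) (auto simp: less_Suc_eq)
    moreover have "?z $ m = 0" using Suc.prems by simp
    ultimately show ?case
      using Suc series_deriv_funpow_monomial[of ?z n m "b $ m" v] by (simp add: mult.assoc)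
  qed
  from this[of n] have "multi_op (series_deriv v) b (monomial_series n (0\<^sub>v n) c) =
    monomial_series n (vec n (\<lambda>j. if j < n then - int (b $ j) else 0)) (c * falling v b)"
    using assms by (simp add: multi_op_def falling_def)
  also have "vec n (\<lambda>j. if j < n then - int (b $ j) else 0) = - map_vec int b"
    using assms by (intro eq_vecI) auto
  finally show ?thesis .
qed

text \<open>The coefficient of \<open>x\<^sup>v\<^sup>+\<^sup>z\<close> in \<open>P x\<^sup>v\<close> is \<open>\<Sum>\<^sub>m P m * monomial_symbol v z m\<close>.\<close>

definition monomial_symbol :: "complex vec \<Rightarrow> int vec \<Rightarrow> nat vec \<times> nat vec \<Rightarrow> complex" where
  "monomial_symbol v z m = (if map_vec int (fst m) - map_vec int (snd m) = z then falling v (snd m) else 0)"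

definition monomial_action :: "complex vec \<Rightarrow> weyl \<Rightarrow> int vec \<Rightarrow> complex" where
  "monomial_action v P z = (\<Sum>m\<in>{m. P m \<noteq> 0}. P m * monomial_symbol v z m)"

lemma monomial_action_superset:
  assumes "finite F" "{m. P m \<noteq> 0} \<subseteq> F"
  shows "monomial_action v P z = (\<Sum>m\<in>F. P m * monomial_symbol v z m)"
  unfolding monomial_action_def by (rule sum.mono_neutral_left) (use assms in auto)

lemma weyl_act_monomial:
  assumes P: "P \<in> carrier (weyl_ring n)" and u: "u \<in> carrier_vec n"
  shows "weyl_act v P (monomial_series n (0\<^sub>v n) c) u p = monomial_action v P u * mconst n c p"
proof -
  have "P (a, b) * multi_op (series_deriv v) b (monomial_series n (0\<^sub>v n) c) (u - map_vec int a) p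
      = P (a, b) * monomial_symbol v u (a, b) * mconst n c p" if "P (a, b) \<noteq> 0" for a b
  proof -
    have car: "a \<in> carrier_vec n" "b \<in> carrier_vec n" using P that by (auto simp: weyl_ring_simps)
    have "u - map_vec int a = - map_vec int b \<longleftrightarrow> map_vec int a - map_vec int b = u"
      using car u by (auto simp: vec_eq_iff algebra_simps)
    then show ?thesis
      unfolding multi_op_monomial[OF car(2)]
      by (simp add: monomial_series_def monomial_symbol_def mconst_def)
  qed
  then show ?thesis
    unfolding weyl_act_def monomial_action_def sum_distrib_right
    by (intro sum.cong) auto
qed

text \<open>This is Vandermonde's identity [x + c]_b = \<Sum> (b choose k) [c]_k [x]_(b - k), with
  [c]_k = k! (c choose k). The terms with k > c vanish, which accounts for the range up to the
  minimum.\<close>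

lemma falling_factorial_sum:
  fixes x :: complex
  shows "(\<Sum>k\<le>min b c. of_nat (fact k * (b choose k) * (c choose k)) * (\<Prod>i<b - k. x - of_nat i))
    = (\<Prod>i<b. x + of_nat c - of_nat i)"
proof -
  have ff: "(\<Prod>i<k. y - of_nat i) = fact k * (y gchoose k)" for y :: complex and k
    by (simp add: gbinomial_prod_rev atLeast0LessThan)
  have "(\<Sum>k\<le>min b c. of_nat (fact k * (b choose k) * (c choose k)) * (\<Prod>i<b - k. x - of_nat i))
    = (\<Sum>k\<le>b. of_nat (fact k * (b choose k) * (c choose k)) * (\<Prod>i<b - k. x - of_nat i))"
    by (rule sum.mono_neutral_left) auto
  also have "\<dots> = (\<Sum>k\<le>b. fact b * ((of_nat c gchoose k) * (x gchoose (b - k))))"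
  proof (rule sum.cong[OF refl])
    fix k assume "k \<in> {..b}"
    then have "(fact k * fact (b - k) * (b choose k) :: nat) = fact b" by (simp add: binomial_fact_lemma)
    then have "of_nat (fact k * fact (b - k) * (b choose k)) = (fact b :: complex)" by simp
    then show "of_nat (fact k * (b choose k) * (c choose k)) * (\<Prod>i<b - k. x - of_nat i)
      = fact b * ((of_nat c gchoose k) * (x gchoose (b - k)))"
      unfolding ff by (simp add: binomial_gbinomial algebra_simps)
  qed
  also have "\<dots> = fact b * ((of_nat c + x) gchoose b)"
    unfolding sum_distrib_left[symmetric] gbinomial_Vandermonde[symmetric] atLeast0AtMost ..
  also have "\<dots> = (\<Prod>i<b. x + of_nat c - of_nat i)"
    unfolding ff by (simp add: add.commute)
  finally show ?thesis .
qed

lemma falling_add: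
  fixes x :: complex
  shows "(\<Prod>i<m + e. x - of_nat i) = (\<Prod>i<e. x - of_nat i) * (\<Prod>i<m. x - of_nat e - of_nat i)"
  by (induction m) (auto simp: algebra_simps)

text \<open>The identity behind \<open>\<partial>\<^sup>b x\<^sup>c \<partial>\<^sup>e\<close>
  applied to x^v: on the left the operator is normally ordered before it acts, on the right its
  factors act in turn.\<close>

lemma falling_vandermonde:
  assumes "b \<in> carrier_vec n" "c \<in> carrier_vec n" "e \<in> carrier_vec n"
  shows "(\<Sum>k\<in>{k. k \<le> b \<and> k \<le> c}.
      (\<Prod>i<dim_vec k. of_nat (fact (k $ i) * (b $ i choose k $ i) * (c $ i choose k $ i))) * falling v ((b - k) + e))
    = falling v e * falling (vec n (\<lambda>i. v $ i - of_nat (e $ i) + of_nat (c $ i))) b"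
proof -
  let ?f = "\<lambda>i k. (\<Prod>l<e $ i. v $ i - of_nat l) *
    (of_nat (fact k * (b $ i choose k) * (c $ i choose k)) * (\<Prod>l<b $ i - k. (v $ i - of_nat (e $ i)) - of_nat l))"
  have "(\<Sum>k\<in>{k. k \<le> b \<and> k \<le> c}.
      (\<Prod>i<dim_vec k. of_nat (fact (k $ i) * (b $ i choose k $ i) * (c $ i choose k $ i))) * falling v ((b - k) + e))
    = (\<Sum>k\<in>{k. k \<le> b \<and> k \<le> c}. \<Prod>i<n. ?f i (k $ i))"
  proof (rule sum.cong[OF refl])
    fix k assume k: "k \<in> {k. k \<le> b \<and> k \<le> c}"
    then have "dim_vec k = n" using assms le_vec_dim[of k b] by simp
    note dim = this
    have "falling v ((b - k) + e) = (\<Prod>i<n. (\<Prod>l<e $ i. v $ i - of_nat l) *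
        (\<Prod>l<b $ i - k $ i. v $ i - of_nat (e $ i) - of_nat l))"
      unfolding falling_def using assms dim by (intro prod.cong) (simp_all add: falling_add)
    then show "(\<Prod>i<dim_vec k. of_nat (fact (k $ i) * (b $ i choose k $ i) * (c $ i choose k $ i))) * falling v ((b - k) + e)
      = (\<Prod>i<n. ?f i (k $ i))"
      unfolding dim by (simp only: prod.distrib[symmetric] mult.left_commute)
  qed
  \<comment> \<open>A vector k below b and c is a free choice of a number in each coordinate, so the
    sum of products factors into a product of sums.\<close>
  also have "\<dots> = (\<Sum>g\<in>(\<Pi>\<^sub>E i\<in>{..<n}. {..min (b $ i) (c $ i)}). \<Prod>i<n. ?f i (g i))"
    by (rule sum.reindex_bij_witness[of _ "vec n" "\<lambda>k. \<lambda>i\<in>{..<n}. k $ i"])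
      (use assms in \<open>auto simp: less_eq_vec_def PiE_iff extensional_def fun_eq_iff\<close>)
  also have "\<dots> = (\<Prod>i<n. \<Sum>k\<le>min (b $ i) (c $ i). ?f i k)"
    by (rule prod_sum_PiE[symmetric]) auto
  also have "\<dots> = (\<Prod>i<n. (\<Prod>l<e $ i. v $ i - of_nat l) *
      (\<Prod>l<b $ i. (v $ i - of_nat (e $ i)) + of_nat (c $ i) - of_nat l))"
    unfolding sum_distrib_left[symmetric] falling_factorial_sum ..
  also have "\<dots> = falling v e * falling (vec n (\<lambda>i. v $ i - of_nat (e $ i) + of_nat (c $ i))) b"
    using assms by (simp add: falling_def prod.distrib)
  finally show ?thesis .
qed

text \<open>Both sides compute the coefficient of x^(v + z) in the product of two monomial operators
  applied to x^v. The operator with exponents a and b reaches x^(v + z) only from x^(v + z - a + b),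
  which explains the shifted exponent on the right.\<close>

lemma weyl_coeff_symbol_sum:
  assumes car: "{a, b, c, e} \<subseteq> carrier_vec n" and z: "z \<in> carrier_vec n"
    and F: "finite F" "\<And>k. k \<le> b \<Longrightarrow> k \<le> c \<Longrightarrow> (a + (c - k), (b - k) + e) \<in> F"
  shows "(\<Sum>m\<in>F. weyl_coeff (a, b) (c, e) m * monomial_symbol v z m)
    = falling (v + map_vec of_int (z - map_vec int a + map_vec int b)) b
      * monomial_symbol v (z - map_vec int a + map_vec int b) (c, e)"
proof -
  let ?K = "{k. k \<le> b \<and> k \<le> c}"
  let ?p = "\<lambda>k. \<Prod>i<dim_vec k. complex_of_nat (fact (k $ i) * (b $ i choose k $ i) * (c $ i choose k $ i))"
  let ?m = "\<lambda>k. (a + (c - k), (b - k) + e)"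
  have finK: "finite ?K" by (rule finite_subset[OF _ finite_le_vec[of b]]) auto
  have wc: "weyl_coeff (a, b) (c, e) m = (\<Sum>k\<in>?K. if ?m k = m then ?p k else 0)" for m
  proof -
    have "{k. k \<le> b \<and> k \<le> c \<and> ?m k = m} = ?K \<inter> {k. ?m k = m}" by auto
    then show ?thesis
      by (simp only: weyl_coeff_def prod.case sum.inter_restrict[OF finK] mem_Collect_eq)
  qed
  have "(\<Sum>m\<in>F. weyl_coeff (a, b) (c, e) m * monomial_symbol v z m)
    = (\<Sum>k\<in>?K. \<Sum>m\<in>F. if ?m k = m then ?p k * monomial_symbol v z (?m k) else 0)"
  proof -
    have if_mult: "(if C then x else 0) * y = (if C then x * y else 0)" for C and x y :: complex
      by simp
    have "(\<Sum>m\<in>F. weyl_coeff (a, b) (c, e) m * monomial_symbol v z m)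
      = (\<Sum>m\<in>F. \<Sum>k\<in>?K. if ?m k = m then ?p k * monomial_symbol v z m else 0)"
      by (simp only: wc sum_distrib_right if_mult)
    also have "\<dots> = (\<Sum>k\<in>?K. \<Sum>m\<in>F. if ?m k = m then ?p k * monomial_symbol v z m else 0)"
      by (rule sum.swap)
    also have "\<dots> = (\<Sum>k\<in>?K. \<Sum>m\<in>F. if ?m k = m then ?p k * monomial_symbol v z (?m k) else 0)"
    proof (intro sum.cong[OF refl])
      fix k m
      show "(if ?m k = m then ?p k * monomial_symbol v z m else 0)
        = (if ?m k = m then ?p k * monomial_symbol v z (?m k) else 0)" by (cases "?m k = m") simp_all
    qed
    finally show ?thesis .
  qed
  also have "\<dots> = (\<Sum>k\<in>?K. ?p k * monomial_symbol v z (?m k))"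
    using F by (intro sum.cong refl) simp
  also have "\<dots> = (\<Sum>k\<in>?K. ?p k * (if map_vec int c - map_vec int e = z - map_vec int a + map_vec int b
      then falling v ((b - k) + e) else 0))"
  proof (intro sum.cong refl)
    fix k assume "k \<in> ?K"
    then have k: "k \<le> b" "k \<le> c" by auto
    have "map_vec int (a + (c - k)) - map_vec int ((b - k) + e) = z \<longleftrightarrow>
      map_vec int c - map_vec int e = z - map_vec int a + map_vec int b"
    proof -
      have "(map_vec int (a + (c - k)) - map_vec int ((b - k) + e)) $ i = z $ i \<longleftrightarrow>
          (map_vec int c - map_vec int e) $ i = (z - map_vec int a + map_vec int b) $ i" if i: "i < n" for i
      proof -
        have "k $ i \<le> b $ i" "k $ i \<le> c $ i" "dim_vec k = n" using k car i by (auto simp: less_eq_vec_def)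
        moreover have "dim_vec a = n" "dim_vec b = n" "dim_vec c = n" "dim_vec e = n" "dim_vec z = n"
          using car z by auto
        ultimately show ?thesis using i by (simp add: of_nat_diff) linarith
      qed
      moreover have "dim_vec (map_vec int (a + (c - k)) - map_vec int ((b - k) + e)) = n"
        "dim_vec (map_vec int c - map_vec int e) = n" "dim_vec (z - map_vec int a + map_vec int b) = n" "dim_vec z = n"
        using car z by auto
      ultimately show ?thesis by (simp only: vec_eq_iff) blast
    qed
    then show "?p k * monomial_symbol v z (?m k) = ?p k * (if map_vec int c - map_vec int e = z - map_vec int a + map_vec int b
      then falling v ((b - k) + e) else 0)" by (simp add: monomial_symbol_def)
  qed
  also have "\<dots> = falling (v + map_vec of_int (z - map_vec int a + map_vec int b)) b
      * monomial_symbol v (z - map_vec int a + map_vec int b) (c, e)"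
  proof (cases "map_vec int c - map_vec int e = z - map_vec int a + map_vec int b")
    case True
    have "falling (v + map_vec of_int (map_vec int c - map_vec int e)) b
      = falling (vec n (\<lambda>i. v $ i - of_nat (e $ i) + of_nat (c $ i))) b"
      unfolding falling_def using car by (intro prod.cong refl) auto
    then show ?thesis
      using falling_vandermonde[of b n c e v] car by (simp add: monomial_symbol_def flip: True)
  next
    case False
    then show ?thesis by (simp add: monomial_symbol_def)
  qed
  finally show ?thesis .
qed

text \<open>This is the multiplicativity of the action on x^v. The right side involves P only
  through its action, so operators annihilating x^v are closed under left multiplication.\<close>

lemma monomial_action_mult:
  assumes x: "x \<in> carrier (weyl_ring n)" and P: "P \<in> carrier (weyl_ring n)" and z: "z \<in> carrier_vec n"
  shows "monomial_action v (weyl_mult x P) z = (\<Sum>(a, b)\<in>{m. x m \<noteq> 0}. x (a, b) *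
    falling (v + map_vec of_int (z - map_vec int a + map_vec int b)) b
      * monomial_action v P (z - map_vec int a + map_vec int b))"
proof -
  let ?X = "{m. x m \<noteq> 0}" and ?Y = "{m. P m \<noteq> 0}"
  have fin: "finite ?X" "finite ?Y" using x P by (auto simp: weyl_ring_simps)
  \<comment> \<open>A finite index set that contains the support of the product and all monomials of
    pairwise products, some of which may cancel.\<close>
  define F where "F = {m. weyl_mult x P m \<noteq> 0} \<union> (\<lambda>((a, b), (c, e), k). (a + (c - k), (b - k) + e)) `
    (SIGMA (a, b) : ?X. SIGMA (c, e) : ?Y. {k. k \<le> b})"
  have finF: "finite F"
    unfolding F_def using weyl_mult_closed[OF x P] fin
    by (intro finite_UnI finite_imageI finite_SigmaI) (auto simp: finite_le_vec weyl_ring_simps)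
  have "monomial_action v (weyl_mult x P) z = (\<Sum>m\<in>F. \<Sum>m1\<in>?X. \<Sum>m2\<in>?Y. x m1 * P m2 * weyl_coeff m1 m2 m * monomial_symbol v z m)"
    unfolding monomial_action_superset[OF finF, of "weyl_mult x P", unfolded F_def, OF Un_upper1, folded F_def]
      weyl_mult_sum[OF fin subset_refl subset_refl] sum_distrib_right ..
  also have "\<dots> = (\<Sum>m1\<in>?X. \<Sum>m2\<in>?Y. x m1 * P m2 * (\<Sum>m\<in>F. weyl_coeff m1 m2 m * monomial_symbol v z m))"
  proof -
    have "(\<Sum>m\<in>F. \<Sum>m1\<in>?X. \<Sum>m2\<in>?Y. x m1 * P m2 * weyl_coeff m1 m2 m * monomial_symbol v z m)
      = (\<Sum>m1\<in>?X. \<Sum>m\<in>F. \<Sum>m2\<in>?Y. x m1 * P m2 * weyl_coeff m1 m2 m * monomial_symbol v z m)"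
      by (rule sum.swap)
    also have "\<dots> = (\<Sum>m1\<in>?X. \<Sum>m2\<in>?Y. \<Sum>m\<in>F. x m1 * P m2 * weyl_coeff m1 m2 m * monomial_symbol v z m)"
      by (rule sum.cong[OF refl], rule sum.swap)
    finally show ?thesis by (simp add: sum_distrib_left mult.assoc)
  qed
  also have "\<dots> = (\<Sum>(a, b)\<in>?X. \<Sum>m2\<in>?Y. x (a, b) * P m2 *
      (falling (v + map_vec of_int (z - map_vec int a + map_vec int b)) b
      * monomial_symbol v (z - map_vec int a + map_vec int b) m2))"
  proof (intro sum.cong refl, clarify, intro sum.cong refl, clarify)
    fix a b c e assume m: "x (a, b) \<noteq> 0" "P (c, e) \<noteq> 0"
    have "{a, b, c, e} \<subseteq> carrier_vec n" using m x P by (auto simp: weyl_ring_simps)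
    moreover have "(a + (c - k), (b - k) + e) \<in> F" if "k \<le> b" "k \<le> c" for k
      unfolding F_def using m that by (intro UnI2 image_eqI[of _ _ "((a, b), (c, e), k)"]) auto
    ultimately show "x (a, b) * P (c, e) * (\<Sum>m\<in>F. weyl_coeff (a, b) (c, e) m * monomial_symbol v z m) =
      x (a, b) * P (c, e) * (falling (v + map_vec of_int (z - map_vec int a + map_vec int b)) b
      * monomial_symbol v (z - map_vec int a + map_vec int b) (c, e))"
      using weyl_coeff_symbol_sum[of a b c e n z F v] z finF by simp
  qed
  also have "\<dots> = (\<Sum>(a, b)\<in>?X. x (a, b) * falling (v + map_vec of_int (z - map_vec int a + map_vec int b)) b
      * monomial_action v P (z - map_vec int a + map_vec int b))"
    unfolding monomial_action_def sum_distrib_left by (intro sum.cong refl) (auto intro!: sum.cong)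
  finally show ?thesis .
qed

lemma monomial_annihilator_left_ideal:
  "left_ideal {P \<in> carrier (weyl_ring n). \<forall>z\<in>carrier_vec n. monomial_action v P z = 0} (weyl_ring n)" (is "left_ideal ?I _")
proof (rule left_ideal_weylI)
  fix P Q assume PQ: "P \<in> ?I"
    "Q \<in> ?I"
  let ?F = "{m. P m \<noteq> 0} \<union> {m. Q m \<noteq> 0}"
  have fin: "finite ?F" using PQ by (auto simp: weyl_ring_simps)
  have sub: "{m. P m + Q m \<noteq> 0} \<subseteq> ?F" by auto
  have "monomial_action v (\<lambda>m. P m + Q m) z = monomial_action v P z + monomial_action v Q z" for z
    unfolding monomial_action_superset[OF fin sub] monomial_action_superset[OF fin Un_upper1]
      monomial_action_superset[OF fin Un_upper2] by (simp add: algebra_simps sum.distrib)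
  with PQ show "(\<lambda>m. P m + Q m) \<in> ?I"
    by (auto intro: weyl_add_closed)
next
  fix P assume "P \<in> ?I"
  then show "(\<lambda>m. - P m) \<in> ?I"
    by (auto simp: weyl_ring_simps monomial_action_def sum_negf)
next
  fix x P assume x: "x \<in> carrier (weyl_ring n)"
    and P: "P \<in> ?I"
  have "monomial_action v (weyl_mult x P) z = 0" if z: "z \<in> carrier_vec n" for z
  proof -
    have Pc: "P \<in> carrier (weyl_ring n)" using P by simp
    show ?thesis
      unfolding monomial_action_mult[OF x Pc z]
    proof (rule sum.neutral, clarify)
      fix a b assume "x (a, b) \<noteq> 0"
      then have "z - map_vec int a + map_vec int b \<in> carrier_vec n"
        using x z by (auto simp: weyl_ring_simps)
      then show "x (a, b) * falling (v + map_vec of_int (z - map_vec int a + map_vec int b)) b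
        * monomial_action v P (z - map_vec int a + map_vec int b) = 0" using P by simp
    qed
  qed
  with x P show "weyl_mult x P \<in> ?I"
    by (auto intro: weyl_mult_closed)
qed (auto simp: weyl_ring_simps monomial_action_def)

text \<open>The functional \<open>\<Lambda>\<close> on monomials is left open because the Euler
  operators are evaluated twice: on x^v and on an arbitrary logarithmic series.\<close>

lemma euler_op_sum:
  fixes A :: "int mat" and \<Lambda> :: "nat vec \<times> nat vec \<Rightarrow> complex"
  defines "n \<equiv> dim_col A"
  shows "(\<Sum>m\<in>{m. euler_op A \<beta> i m \<noteq> 0}. euler_op A \<beta> i m * \<Lambda> m)
    = (\<Sum>j<n. of_int (A $$ (i, j)) * \<Lambda> (unit_vec n j, unit_vec n j)) - \<beta> $ i * \<Lambda> (0\<^sub>v n, 0\<^sub>v n)"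
proof -
  let ?F = "insert (0\<^sub>v n, 0\<^sub>v n) ((\<lambda>j. (unit_vec n j, unit_vec n j)) ` {..<n})"
  have if_mult: "(if C then x else 0) * y = (if C then x * y else 0)" for C and x y :: complex
    by simp
  have "euler_op A \<beta> i m = 0" if "m \<notin> ?F" for m
    using that unfolding euler_op_def Let_def n_def[symmetric] by (auto intro!: sum.neutral)
  then have "(\<Sum>m\<in>{m. euler_op A \<beta> i m \<noteq> 0}. euler_op A \<beta> i m * \<Lambda> m) = (\<Sum>m\<in>?F. euler_op A \<beta> i m * \<Lambda> m)"
    by (intro sum.mono_neutral_left) auto
  also have "\<dots> = (\<Sum>m\<in>?F. \<Sum>j<n. if m = (unit_vec n j, unit_vec n j) then of_int (A $$ (i, j)) * \<Lambda> m else 0)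
      - (\<Sum>m\<in>?F. if m = (0\<^sub>v n, 0\<^sub>v n) then \<beta> $ i * \<Lambda> m else 0)"
    unfolding sum_subtractf[symmetric] euler_op_def Let_def n_def[symmetric]
    by (simp only: left_diff_distrib sum_distrib_right if_mult)
  also have "(\<Sum>m\<in>?F. \<Sum>j<n. if m = (unit_vec n j, unit_vec n j) then of_int (A $$ (i, j)) * \<Lambda> m else 0)
      = (\<Sum>j<n. of_int (A $$ (i, j)) * \<Lambda> (unit_vec n j, unit_vec n j))"
    by (subst sum.swap) (intro sum.cong refl, simp)
  also have "(\<Sum>m\<in>?F. if m = (0\<^sub>v n, 0\<^sub>v n) then \<beta> $ i * \<Lambda> m else 0) = \<beta> $ i * \<Lambda> (0\<^sub>v n, 0\<^sub>v n)"
    by (subst sum.delta) auto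
  finally show ?thesis .
qed

lemma falling_zero: "falling v (0\<^sub>v n) = 1"
  by (simp add: falling_def)

lemma falling_unit: "j < n \<Longrightarrow> falling v (unit_vec n j) = v $ j"
proof -
  assume j: "j < n"
  have "falling v (unit_vec n j) = (\<Prod>i<n. if i = j then v $ j else 1)"
    using j unfolding falling_def by (intro prod.cong) (auto simp: One_nat_def)
  then show ?thesis using j by simp
qed

lemma euler_annihilates:
  assumes "map_mat of_int A *\<^sub>v v = \<beta>" "v \<in> carrier_vec (dim_col A)" "i < dim_row A"
  shows "monomial_action v (euler_op A \<beta> i) z = 0"
proof -
  let ?n = "dim_col A"
  have "(\<Sum>j<?n. of_int (A $$ (i, j)) * v $ j) = \<beta> $ i"
    using assms by (auto simp: scalar_prod_def atLeast0LessThan)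
  moreover have "monomial_symbol v z (unit_vec ?n j, unit_vec ?n j) = v $ j * monomial_symbol v z (0\<^sub>v ?n, 0\<^sub>v ?n)"
    if "j < ?n" for j
    using that by (auto simp: monomial_symbol_def falling_zero falling_unit vec_eq_iff)
  ultimately show ?thesis
    unfolding monomial_action_def euler_op_sum
    by (simp add: sum_distrib_right[symmetric] mult.assoc[symmetric])
qed

lemma weyl_of_d_annihilates:
  assumes "\<And>q. f q \<noteq> 0 \<Longrightarrow> falling v q = 0"
  shows "monomial_action v (weyl_of_d n f) z = 0"
  unfolding monomial_action_def
proof (rule sum.neutral, clarify)
  fix a b assume "weyl_of_d n f (a, b) \<noteq> 0"
  then have "f b \<noteq> 0" by (simp add: weyl_of_d_def split: if_splits)
  then have "falling v b = 0" by (rule assms)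
  then show "weyl_of_d n f (a, b) * monomial_symbol v z (a, b) = 0" by (simp add: monomial_symbol_def)
qed

section \<open>The ambient coefficient space of the example\<close>

text \<open>In the binomial of k b with k nonzero, b_4 > 0 > b_2 puts the variable of index 4 into
  one monomial and that of index 2 into the other. So every monomial of I_A involves one of them,
  and v_2 = v_4 = 0 makes its falling factorial vanish.\<close>

lemma ex_toric_annihilates:
  assumes f: "f \<in> toric_ideal ex_A" and q: "f q \<noteq> 0"
  shows "falling ex_v q = 0"
proof -
  let ?D = "\<lambda>p. 1 \<le> p $ 4 \<or> 1 \<le> p $ 2"
  let ?I = "{f \<in> carrier (mpoly_ring 5). \<forall>p. f p \<noteq> 0 \<longrightarrow> ?D p}"
  have I: "ideal ?I (mpoly_ring (dim_col ex_A))"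
    unfolding ex_A_simps by (rule mpoly_support_ideal) auto
  have "(\<lambda>p. mmonom (pos_part u) p - mmonom (neg_part u) p) \<in> ?I" (is "?g \<in> ?I") if u: "u \<in> mat_kernel ex_A" for u
  proof -
    obtain k where k: "u = k \<cdot>\<^sub>v ex_b" using u ex_kernel by auto
    have gc: "?g \<in> carrier (mpoly_ring 5)" using toric_ideal_carrier[OF toric_binomial[OF u]] by simp
    have parts: "pos_part u $ 4 = nat k" "pos_part u $ 2 = nat (- 2 * k)" "neg_part u $ 4 = nat (- k)" "neg_part u $ 2 = nat (2 * k)"
      by (simp_all add: pos_part_def neg_part_def k)
    have "?D p" if "?g p \<noteq> 0" for p
    proof -
      have p: "p = pos_part u \<or> p = neg_part u"
        using that by (auto simp: mmonom_apply split: if_splits)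
      have "k \<noteq> 0"
      proof
        assume "k = 0"
        then have "pos_part u = neg_part u" by (auto simp: pos_part_def neg_part_def k)
        with that show False by simp
      qed
      with p parts show ?thesis by (cases "k > 0") auto
    qed
    with gc show ?thesis by simp
  qed
  then have "f \<in> ?I" by (rule toric_ideal_induct[OF f I])
  then have D: "?D q" and qc: "q \<in> carrier_vec 5" using q by (auto simp: mpoly_ring_simps)
  from D show ?thesis
  proof
    assume "1 \<le> q $ 4"
    then show ?thesis using qc by (intro falling_eq_0[of 4 _ 0]) auto
  next
    assume "1 \<le> q $ 2"
    then show ?thesis using qc by (intro falling_eq_0[of 2 _ 0]) auto
  qed
qed

lemma ex_hypergeometric_annihilates:
  assumes P: "P \<in> hypergeometric_ideal ex_A ex_beta" and u: "u \<in> carrier_vec 5"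
  shows "weyl_act ex_v P (monomial_series 5 (0\<^sub>v 5) c) u = (\<lambda>_. 0)"
proof -
  let ?I = "{P \<in> carrier (weyl_ring 5). \<forall>z\<in>carrier_vec 5. monomial_action ex_v P z = 0}"
  have v: "map_mat of_int ex_A *\<^sub>v ex_v = ex_beta" "ex_v \<in> carrier_vec 5"
    using ex_fake_exponent by (auto simp: fake_exponent_def)
  note gens = hypergeometric_generators_closed[of ex_A ex_beta, unfolded ex_A_simps]
  have "weyl_of_d 5 ` toric_ideal ex_A \<union> euler_op ex_A ex_beta ` {..<4} \<subseteq> ?I"
  proof (intro Un_least image_subsetI)
    fix f assume f: "f \<in> toric_ideal ex_A"
    have "weyl_of_d 5 f \<in> carrier (weyl_ring 5)" by (rule subsetD[OF gens UnI1[OF imageI[OF f]]])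
    moreover have "monomial_action ex_v (weyl_of_d 5 f) z = 0" for z
      by (rule weyl_of_d_annihilates[OF ex_toric_annihilates[OF f]])
    ultimately show "weyl_of_d 5 f \<in> ?I" by simp
  next
    fix i :: nat assume i: "i \<in> {..<4}"
    have "euler_op ex_A ex_beta i \<in> carrier (weyl_ring 5)"
      by (rule subsetD[OF gens UnI2[OF imageI[OF i]]])
    moreover have "monomial_action ex_v (euler_op ex_A ex_beta i) z = 0" for z
      by (rule euler_annihilates) (use v i in auto)
    ultimately show "euler_op ex_A ex_beta i \<in> ?I" by simp
  qed
  then have "P \<in> ?I"
    using P monomial_annihilator_left_ideal unfolding hypergeometric_ideal_def ex_A_simps
    by (rule lgenideal_memberD[rotated 2])
  then show ?thesis using weyl_act_monomial[of P 5 u ex_v c] u by auto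
qed

section \<open>Derivatives of polynomials in log x\<close>

lemma mderiv_closed:
  assumes "f \<in> carrier (mpoly_ring n)" "j < n"
  shows "mderiv j f \<in> carrier (mpoly_ring n)"
proof -
  have nz: "f (p + unit_vec (dim_vec p) j) \<noteq> 0" if "mderiv j f p \<noteq> 0" for p
    using that by (auto simp: mderiv_def)
  then have car: "p \<in> carrier_vec n" if "mderiv j f p \<noteq> 0" for p
  proof -
    have "p + unit_vec (dim_vec p) j \<in> carrier_vec n" using assms(1) nz[OF that] by (auto simp: mpoly_ring_simps)
    then have "dim_vec (p + unit_vec (dim_vec p) j) = n" by (rule carrier_vecD)
    then show ?thesis by (intro carrier_vecI) simp
  qed
  have "inj_on (\<lambda>p. p + unit_vec (dim_vec p) j) {p. mderiv j f p \<noteq> 0}"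
  proof (rule inj_onI)
    fix p q assume "p \<in> {p. mderiv j f p \<noteq> 0}" "q \<in> {p. mderiv j f p \<noteq> 0}"
      and eq: "p + unit_vec (dim_vec p) j = q + unit_vec (dim_vec q) j"
    then have pq: "p \<in> carrier_vec n" "q \<in> carrier_vec n" using car by auto
    have "p $ i = q $ i" if "i < n" for i
      using arg_cong[OF eq, of "\<lambda>v. v $ i"] pq that by simp
    then show "p = q" using pq by (intro eq_vecI) auto
  qed
  moreover have "(\<lambda>p. p + unit_vec (dim_vec p) j) ` {p. mderiv j f p \<noteq> 0} \<subseteq> {p. f p \<noteq> 0}" using nz by blast
  moreover have "finite {p. f p \<noteq> 0}" using assms by (simp add: mpoly_ring_simps)
  ultimately have "finite {p. mderiv j f p \<noteq> 0}" by (rule inj_on_finite)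
  with car show ?thesis by (simp add: mpoly_ring_simps(1))
qed

text \<open>Among the monomials of g take one of maximal exponent in the variable j. Being a fixed
  point, g would have to contain a monomial of larger exponent to produce it.\<close>

lemma mderiv_no_fixpoint:
  assumes g: "g \<in> carrier (mpoly_ring n)" and j: "j < n" and fp: "\<And>p. p \<in> carrier_vec n \<Longrightarrow> g p = mderiv j g p"
  shows "g p = 0"
proof (rule ccontr)
  assume p: "g p \<noteq> 0"
  let ?S = "{p. g p \<noteq> 0}"
  have fin: "finite ((\<lambda>p. p $ j) ` ?S)" using g by (simp add: mpoly_ring_simps)
  have "Max ((\<lambda>p. p $ j) ` ?S) \<in> (\<lambda>p. p $ j) ` ?S" using p fin by (intro Max_in) auto
  then obtain q where q: "g q \<noteq> 0" "q $ j = Max ((\<lambda>p. p $ j) ` ?S)" by auto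
  have qc: "q \<in> carrier_vec n" using g q by (auto simp: mpoly_ring_simps)
  then have "g (q + unit_vec n j) \<noteq> 0" using fp[OF qc] q(1) by (auto simp: mderiv_def)
  then have "(q + unit_vec n j) $ j \<le> Max ((\<lambda>p. p $ j) ` ?S)" using fin by (intro Max_ge) auto
  then show False using q(2) qc j by simp
qed

text \<open>The operator \<open>\<partial>\<^sub>j - 1\<close> is injective on polynomials and commutes with \<open>\<partial>\<^sub>l\<close>.\<close>

lemma mderiv_shift_cancel:
  assumes f: "f \<in> carrier (mpoly_ring n)" and j: "j < n" "l < n" "j \<noteq> l"
    and zero: "mderiv l (\<lambda>p. - f p + mderiv j f p) = (\<lambda>_. 0)"
  shows "mderiv l f = (\<lambda>_. 0)"
proof
  fix p
  show "mderiv l f p = 0"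
  proof (rule mderiv_no_fixpoint[OF mderiv_closed[OF f j(2)] j(1)])
    fix p :: "nat vec" assume p: "p \<in> carrier_vec n"
    have swap: "p + unit_vec n l + unit_vec n j = p + unit_vec n j + unit_vec n l" using p by auto
    have "0 = - mderiv l f p + mderiv j (mderiv l f) p"
      using fun_cong[OF zero, of p] p j by (simp add: mderiv_def algebra_simps swap)
    then show "mderiv l f p = mderiv j (mderiv l f) p" by simp
  qed
qed

lemma mpoly_constant:
  assumes f: "f \<in> carrier (mpoly_ring n)" and zero: "\<And>j. j < n \<Longrightarrow> mderiv j f = (\<lambda>_. 0)"
  shows "f = mconst n (f (0\<^sub>v n))"
proof
  fix q
  show "f q = mconst n (f (0\<^sub>v n)) q"
  proof (cases "q \<in> carrier_vec n \<and> q \<noteq> 0\<^sub>v n")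
    case True
    then obtain j where j: "j < n" "q $ j \<noteq> 0" by (auto simp: vec_eq_iff)
    then have le: "unit_vec n j \<le> q" using True by (auto simp: less_eq_vec_def unit_vec_def)
    have dim: "dim_vec (q - unit_vec n j) = n" by simp
    have "of_nat ((q - unit_vec n j) $ j + 1) * f q = 0"
      using fun_cong[OF zero[OF j(1)], of "q - unit_vec n j"] unfolding mderiv_def dim minus_add_vec[OF le] .
    then have "f q = 0" by (simp only: mult_eq_0_iff of_nat_eq_0_iff) simp
    then show ?thesis using True by (simp add: mconst_def)
  next
    case False
    have supp: "q \<in> carrier_vec n" if "f q \<noteq> 0" using f that by (simp add: mpoly_ring_simps)
    show ?thesis
    proof (cases "q = 0\<^sub>v n")
      case True
      then show ?thesis unfolding True by (simp add: mconst_def)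
    next
      case nonzero: False
      then have "f q = 0" using False supp by blast
      with nonzero show ?thesis by (simp add: mconst_def)
    qed
  qed
qed

lemma multi_op_unit:
  assumes "j < n"
  shows "multi_op D (unit_vec n j) \<phi> = D j \<phi>"
proof -
  have "fold (\<lambda>i. D i ^^ (unit_vec n j $ i)) [0..<m] \<phi> = (if j < m then D j \<phi> else \<phi>)" if "m \<le> n" for m
    using that
  proof (induction m)
    case (Suc m)
    let ?g = "\<lambda>i. D i ^^ (unit_vec n j $ i)"
    have ih: "fold ?g [0..<m] \<phi> = (if j < m then D j \<phi> else \<phi>)" using Suc by simp
    have u: "unit_vec n j $ m = (if m = j then 1 else 0)" using assms Suc.prems by simp
    have "fold ?g [0..<Suc m] \<phi> = ?g m (fold ?g [0..<m] \<phi>)" by simp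
    also have "\<dots> = (if j < Suc m then D j \<phi> else \<phi>)"
      unfolding ih u by (cases j m rule: linorder_cases) (simp_all add: One_nat_def)
    finally show ?case .
  qed simp
  from this[of n] show ?thesis using assms by (simp add: multi_op_def)
qed

lemma multi_op_zero: "multi_op D (0\<^sub>v n) \<phi> = \<phi>"
proof -
  have "fold (\<lambda>i. D i ^^ (0\<^sub>v n $ i)) [0..<m] \<phi> = \<phi>" if "m \<le> n" for m
    using that by (induction m) auto
  from this[of n] show ?thesis by (simp add: multi_op_def)
qed

lemma series_deriv_at:
  assumes "dim_vec u = n" "u + unit_vec n j = u'"
  shows "series_deriv v j \<phi> u = (\<lambda>p. (v $ j + of_int (u' $ j)) * \<phi> u' p + mderiv j (\<phi> u') p)"
  using assms by (simp add: series_deriv_def Let_def)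

lemma weyl_act_binomial:
  "weyl_act v (weyl_of_d n (\<lambda>p. mmonom r p - mmonom s p)) \<phi> u p
    = multi_op (series_deriv v) r \<phi> (u - map_vec int (0\<^sub>v n)) p
      - multi_op (series_deriv v) s \<phi> (u - map_vec int (0\<^sub>v n)) p"
proof -
  let ?P = "weyl_of_d n (\<lambda>p. mmonom r p - mmonom s p)" and ?z = "0\<^sub>v n"
  let ?L = "\<lambda>m. multi_op (series_deriv v) (snd m) \<phi> (u - map_vec int (fst m)) p"
  have "weyl_act v ?P \<phi> u p = (\<Sum>m\<in>{m. ?P m \<noteq> 0}. ?P m * ?L m)"
    unfolding weyl_act_def by (simp add: split_def)
  also have "\<dots> = (\<Sum>m\<in>{(?z, r), (?z, s)}. ?P m * ?L m)"
    by (rule sum.mono_neutral_left) (auto simp: weyl_of_d_def mmonom_apply split: if_splits)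
  also have "\<dots> = ?L (?z, r) - ?L (?z, s)"
    by (cases "r = s") (auto simp: weyl_of_d_def mmonom_apply)
  finally show ?thesis by simp
qed

text \<open>At x^(v - b_+) the binomial of b compares two terms. The second comes from x^(v - b),
  whose support is outside the family, so it is zero. The first is (D_0 - 1)(D_1 - 1) D_4 p_0, where
  p_0 is the coefficient of x^v and D_j differentiates by log x_j. Cancelling the injective factors
  gives D_4 p_0 = 0, and the Euler equations express the other derivatives by this one.\<close>

lemma ex_solution_constant:
  assumes poly: "\<And>u. \<phi> u \<in> carrier (mpoly_ring 5)"
    and supp: "\<And>u. \<phi> u \<noteq> (\<lambda>_. 0) \<Longrightarrow> u \<in> mat_kernel ex_A \<and> nsupp_at ex_v u \<in> ex_N"
    and ann: "\<And>P u. P \<in> hypergeometric_ideal ex_A ex_beta \<Longrightarrow> u \<in> carrier_vec 5 \<Longrightarrow> weyl_act ex_v P \<phi> u = (\<lambda>_. 0)"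
  shows "\<phi> (0\<^sub>v 5) = mconst 5 (\<phi> (0\<^sub>v 5) (0\<^sub>v 5))"
proof -
  let ?p0 = "\<phi> (0\<^sub>v 5)" and ?D = "series_deriv ex_v"
  \<comment> \<open>In the Euler equation at x^v the terms with v_j cancel against \<beta> because A
    v = \<beta>. What remains is that A annihilates the gradient of p_0.\<close>
  have euler: "mderiv i ?p0 p = of_int (ex_b $ i) * mderiv 4 ?p0 p" if i: "i < 4" for i p
  proof -
    let ?L = "\<lambda>m. multi_op ?D (snd m) \<phi> (0\<^sub>v 5 - map_vec int (fst m)) p"
    have L: "?L (unit_vec 5 j, unit_vec 5 j) = ex_v $ j * ?p0 p + mderiv j ?p0 p" if j: "j < 5" for j
    proof -
      have "0\<^sub>v 5 - map_vec int (unit_vec 5 j) + unit_vec 5 j = 0\<^sub>v 5"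
        using j by (intro eq_vecI) auto
      then show ?thesis
        unfolding fst_conv snd_conv multi_op_unit[OF j]
        by (subst series_deriv_at[where n = 5]) (use j in auto)
    qed
    have "0\<^sub>v 5 - map_vec int (0\<^sub>v 5) = 0\<^sub>v 5" by (intro eq_vecI) auto
    then have L0: "?L (0\<^sub>v 5, 0\<^sub>v 5) = ?p0 p" by (simp add: multi_op_zero)
    have "0 = weyl_act ex_v (euler_op ex_A ex_beta i) \<phi> (0\<^sub>v 5) p"
      using ann[OF euler_in_hypergeometric] i by simp
    also have "\<dots> = (\<Sum>m\<in>{m. euler_op ex_A ex_beta i m \<noteq> 0}. euler_op ex_A ex_beta i m * ?L m)"
      unfolding weyl_act_def by (simp add: split_def)
    also have "\<dots> = (\<Sum>j<5. of_int (ex_A $$ (i, j)) * (ex_v $ j * ?p0 p + mderiv j ?p0 p)) - ex_beta $ i * ?p0 p"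
      unfolding euler_op_sum ex_A_simps L0 by (intro arg_cong2[of _ _ _ _ "(-)"] sum.cong refl) (simp only: lessThan_iff L)
    also have "\<dots> = mderiv i ?p0 p - of_int (ex_b $ i) * mderiv 4 ?p0 p"
      using i by (simp only: sum_less_5 less_4) (auto simp: ex_A_index)
    finally show ?thesis by simp
  qed
  let ?u = "- map_vec int (pos_part ex_b)"
  have up: "[0..<5] = [0, 1, 2, 3, 4::nat]" by (simp add: upt_rec One_nat_def)
  have pos: "pos_part ex_b $ 0 = 1" "pos_part ex_b $ 1 = 1" "pos_part ex_b $ 2 = 0" "pos_part ex_b $ 3 = 0"
    "pos_part ex_b $ 4 = 1" "dim_vec (pos_part ex_b) = 5" "pos_part ex_b $ Suc 0 = 1" by (simp_all add: pos_part_def)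
  have neg: "neg_part ex_b $ 0 = 0" "neg_part ex_b $ 1 = 0" "neg_part ex_b $ 2 = 2" "neg_part ex_b $ 3 = 1"
    "neg_part ex_b $ 4 = 0" "dim_vec (neg_part ex_b) = 5" "neg_part ex_b $ Suc 0 = 0" by (simp_all add: neg_part_def)
  have mpos: "multi_op ?D (pos_part ex_b) \<phi> = ?D 4 (?D 1 (?D 0 \<phi>))"
    unfolding multi_op_def pos(6) up by (simp add: pos)
  have mneg: "multi_op ?D (neg_part ex_b) \<phi> = ?D 3 (?D 2 (?D 2 \<phi>))"
    unfolding multi_op_def neg(6) up by (simp add: neg) (simp add: numeral_2_eq_2)
  \<comment> \<open>A derivative in x_j contributes the current exponent plus D_j. At the indices 0
    and 1 this exponent is -1, which gives the two shifts; at index 4 it is 0, so that D_4 appears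
    unshifted.\<close>
  define Y where "Y = (\<lambda>p. - ?p0 p + mderiv 0 ?p0 p)"
  define X where "X = (\<lambda>p. - Y p + mderiv 1 Y p)"
  have "?D 0 \<phi> (- unit_vec 5 0) = Y"
    unfolding Y_def by (subst series_deriv_at[where n = 5 and u' = "0\<^sub>v 5"]) auto
  then have "?D 1 (?D 0 \<phi>) (- unit_vec 5 0 - unit_vec 5 1) = X"
    unfolding X_def by (subst series_deriv_at[where n = 5 and u' = "- unit_vec 5 0"]) auto
  then have Dpos: "?D 4 (?D 1 (?D 0 \<phi>)) ?u = mderiv 4 X"
    by (subst series_deriv_at[where n = 5 and u' = "- unit_vec 5 0 - unit_vec 5 1"])
      (auto simp: less_5 pos_part_def intro!: eq_vecI)
  \<comment> \<open>The other monomial of the binomial lowers exponents by b_-, and -b - b_- = -b_+.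
    It thus starts from the term at -b, which the family excludes.\<close>
  have "nsupp_at ex_v (-1 \<cdot>\<^sub>v ex_b) \<notin> ex_N"
  proof -
    have "{0, 1, 4} \<noteq> {0, 1::nat}" "{0, 1, 4} \<noteq> {2::nat}"
      by (rule notI, drule arg_cong[of _ _ "\<lambda>X. 4 \<in> X"], simp)+
    then show ?thesis unfolding ex_nsupp_at by (simp add: ex_N_def)
  qed
  then have "\<phi> (-1 \<cdot>\<^sub>v ex_b) = (\<lambda>_. 0)" using supp by blast
  then have "?D 2 \<phi> (-1 \<cdot>\<^sub>v ex_b - unit_vec 5 2) = (\<lambda>_. 0)"
    by (subst series_deriv_at[where n = 5 and u' = "-1 \<cdot>\<^sub>v ex_b"]) (auto simp: mderiv_def)
  then have "?D 2 (?D 2 \<phi>) (-1 \<cdot>\<^sub>v ex_b - unit_vec 5 2 - unit_vec 5 2) = (\<lambda>_. 0)"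
    by (subst series_deriv_at[where n = 5 and u' = "-1 \<cdot>\<^sub>v ex_b - unit_vec 5 2"]) (auto simp: mderiv_def)
  then have Dneg: "?D 3 (?D 2 (?D 2 \<phi>)) ?u = (\<lambda>_. 0)"
    by (subst series_deriv_at[where n = 5 and u' = "-1 \<cdot>\<^sub>v ex_b - unit_vec 5 2 - unit_vec 5 2"])
      (auto simp: less_5 pos_part_def mderiv_def intro!: eq_vecI)
  have "ex_b \<in> mat_kernel ex_A" unfolding ex_kernel by (rule range_eqI[of _ _ 1]) auto
  then have H: "weyl_of_d 5 (\<lambda>p. mmonom (pos_part ex_b) p - mmonom (neg_part ex_b) p) \<in> hypergeometric_ideal ex_A ex_beta"
    using toric_in_hypergeometric[OF toric_binomial, of ex_b ex_A] by simp
  have u0: "?u - map_vec int (0\<^sub>v 5) = ?u" by (intro eq_vecI) (auto simp: pos_part_def)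
  have uc: "?u \<in> carrier_vec 5" by (intro carrier_vecI) (simp add: pos_part_def)
  have "mderiv 4 X = (\<lambda>_. 0)"
  proof
    fix p
    show "mderiv 4 X p = 0"
      using fun_cong[OF ann[OF H uc], of p] unfolding weyl_act_binomial u0 mpos mneg Dpos Dneg by simp
  qed
  moreover have Yc: "Y \<in> carrier (mpoly_ring 5)"
  proof -
    have "\<ominus>\<^bsub>mpoly_ring 5\<^esub> ?p0 \<oplus>\<^bsub>mpoly_ring 5\<^esub> mderiv 0 ?p0 \<in> carrier (mpoly_ring 5)"
      using poly[of "0\<^sub>v 5"] mderiv_closed[of ?p0 5 0] by simp
    then show ?thesis by (simp add: Y_def mpoly_ring_simps(5) mpoly_a_inv[OF poly])
  qed
  ultimately have "mderiv 4 Y = (\<lambda>_. 0)"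
    using mderiv_shift_cancel[OF Yc, of 1 4] by (simp add: X_def)
  then have d4: "mderiv 4 ?p0 = (\<lambda>_. 0)"
    using mderiv_shift_cancel[OF poly, of 0 4] by (simp add: Y_def)
  have "mderiv j ?p0 = (\<lambda>_. 0)" if "j < 5" for j
    using euler[of j] d4 that by (cases "j = 4") auto
  then show ?thesis by (rule mpoly_constant[OF poly])
qed

lemma ex_ambient_coefficients: "ambient_coefficients ex_A ex_beta ex_v ex_N = range (mconst 5)"
proof
  show "ambient_coefficients ex_A ex_beta ex_v ex_N \<subseteq> range (mconst 5)"
  proof
    fix f assume "f \<in> ambient_coefficients ex_A ex_beta ex_v ex_N"
    then obtain \<phi> where "f = \<phi> (0\<^sub>v 5)" "\<And>u. \<phi> u \<in> carrier (mpoly_ring 5)"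
      "\<And>u. \<phi> u \<noteq> (\<lambda>_. 0) \<Longrightarrow> u \<in> mat_kernel ex_A \<and> nsupp_at ex_v u \<in> ex_N"
      "\<And>P u. P \<in> hypergeometric_ideal ex_A ex_beta \<Longrightarrow> u \<in> carrier_vec 5 \<Longrightarrow> weyl_act ex_v P \<phi> u = (\<lambda>_. 0)"
      unfolding ambient_coefficients_def Let_def ex_A_simps by blast
    then show "f \<in> range (mconst 5)" using ex_solution_constant[of \<phi>] by (metis rangeI)
  qed
  show "range (mconst 5) \<subseteq> ambient_coefficients ex_A ex_beta ex_v ex_N"
  proof
    fix f assume "f \<in> range (mconst 5)"
    then obtain c where c: "f = mconst 5 c" by auto
    let ?\<phi> = "monomial_series 5 (0\<^sub>v 5) c"
    have "f = ?\<phi> (0\<^sub>v 5)" by (simp add: c monomial_series_def)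
    moreover have "\<forall>u. ?\<phi> u \<in> carrier (mpoly_ring 5)"
      using mconst_in_mpoly[of 5 c] mpoly.zero_closed[of 5] by (simp add: monomial_series_def mpoly_ring_simps(4))
    moreover have "0\<^sub>v 5 \<in> mat_kernel ex_A"
      unfolding ex_kernel by (rule range_eqI[of _ _ 0]) auto
    moreover have "nsupp_at ex_v (0\<^sub>v 5) \<in> ex_N"
    proof -
      have "ex_v + map_vec of_int (0\<^sub>v 5) = ex_v" by (intro eq_vecI) auto
      then show ?thesis by (simp add: nsupp_at_def ex_nsupp ex_N_def)
    qed
    then have "\<forall>u. ?\<phi> u \<noteq> (\<lambda>_. 0) \<longrightarrow> u \<in> mat_kernel ex_A \<and> nsupp_at ex_v u \<in> ex_N"
      using \<open>0\<^sub>v 5 \<in> mat_kernel ex_A\<close> by (auto simp: monomial_series_def)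
    moreover have "\<forall>P\<in>hypergeometric_ideal ex_A ex_beta. \<forall>u\<in>carrier_vec 5. weyl_act ex_v P ?\<phi> u = (\<lambda>_. 0)"
      using ex_hypergeometric_annihilates by blast
    ultimately show "f \<in> ambient_coefficients ex_A ex_beta ex_v ex_N"
      unfolding ambient_coefficients_def Let_def ex_A_simps by blast
  qed
qed

lemma ex_ambient_dim: "has_complex_dim (ambient_space ex_A ex_beta ex_v ex_N) 1"
proof (rule has_complex_dim_one[where \<psi> = "mconst 5"])
  have "c = d" if "mconst 5 c = mconst 5 d" for c d
    using fun_cong[OF that, of "0\<^sub>v 5"] by (simp add: mconst_def)
  then show "bij_betw (mconst 5) UNIV (carrier (ambient_space ex_A ex_beta ex_v ex_N))"
    by (auto simp: bij_betw_def inj_def ambient_space_def complex_space_def ideal_module_def ex_ambient_coefficients)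
  show "mconst 5 x \<oplus>\<^bsub>ambient_space ex_A ex_beta ex_v ex_N\<^esub> mconst 5 y = mconst 5 (x + y)" for x y
    by (auto simp: ambient_space_def complex_space_def ideal_module_def mpoly_ring_simps(5) mconst_def)
  show "\<zero>\<^bsub>ambient_space ex_A ex_beta ex_v ex_N\<^esub> = mconst 5 0"
    by (auto simp: ambient_space_def complex_space_def ideal_module_def mpoly_ring_simps(4) mconst_def)
  have "mconst 5 c \<otimes>\<^bsub>mfps_ring 5\<^esub> mconst 5 x = mconst 5 (c * x)" for c x
    unfolding mconst_mult[OF mconst_in_mfps] by (auto simp: mconst_def)
  then show "c \<odot>\<^bsub>ambient_space ex_A ex_beta ex_v ex_N\<^esub> mconst 5 x = mconst 5 (c * x)" for c x
    by (simp add: ambient_space_def complex_space_def ideal_module_def mpoly_ring_simps(2))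
qed

theorem theorem4p1:
  "\<exists>(d::nat) (n::nat) (A::int mat) (\<beta>::complex vec) (w::nat \<Rightarrow> real) (v::complex vec)
     (N::nat set set).
     homogeneous_matrix d n A \<and> \<beta> \<in> carrier_vec d \<and> lattice_rank A 1 \<and>
     generic_direction A \<beta> w \<and> fake_exponent A \<beta> w v \<and>
     neg_support_family A w v N \<and> ordered_family A v N \<and> N \<noteq> distinguished A w v \<and>
     (\<exists>\<iota> G. admissible_choice A v N \<iota> G) \<and>
     (\<forall>B \<in> carrier_mat n 1. gale_dual A B \<longrightarrow>
        (let S\<^sub>0 = mpoly_ring 1; s = mmonom (unit_vec 1 0) in
         (\<forall>\<iota> G. admissible_choice A v N \<iota> G \<longrightarrow> ideal_J_amb A B v N \<iota> G = Idl\<^bsub>S\<^sub>0\<^esub> {s}) \<and>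
         ideal_J_intr A B v N = carrier S\<^sub>0 \<and>
         isomorphic_over (carrier (mpoly_ring n)) (gale_subst B) (obstruction A v N)
           (quot_module (ideal_module S\<^sub>0 (carrier S\<^sub>0)) (Idl\<^bsub>S\<^sub>0\<^esub> {s})) \<and>
         intrinsic_coefficients A B v N = {\<zero>\<^bsub>mpoly_ring n\<^esub>})) \<and>
     has_complex_dim (complex_space n (obstruction A v N)) 1 \<and>
     has_complex_dim (ambient_space A \<beta> v N) 1"
proof (intro exI conjI ballI impI)
  show "homogeneous_matrix 4 5 ex_A" by (rule ex_homogeneous)
  show "ex_beta \<in> carrier_vec 4" by (rule carrier_vecI) simp
  show "lattice_rank ex_A 1" by (rule ex_lattice_rank)
  show "generic_direction ex_A ex_beta ex_w" by (rule ex_generic)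
  show "fake_exponent ex_A ex_beta ex_w ex_v" by (rule ex_fake_exponent)
  show "neg_support_family ex_A ex_w ex_v ex_N" "ordered_family ex_A ex_v ex_N"
    "ex_N \<noteq> distinguished ex_A ex_w ex_v" by (rule ex_family)+
  \<comment> \<open>The else branch of the choice below has to be the one taken at {2, 3}.\<close>
  have "{2, 3} \<noteq> {0, 1, 4::nat}" by (rule notI, drule arg_cong[of _ _ "\<lambda>X. 3 \<in> X"], simp)
  then show "admissible_choice ex_A ex_v ex_N (\<lambda>H. if H = {0, 1, 4} then {0, 1} else {2}) {0, 1}"
    unfolding ex_admissible by (simp only: if_True if_False simp_thms)
  show "has_complex_dim (complex_space 5 (obstruction ex_A ex_v ex_N)) 1" by (rule ex_obstruction_dim)
  show "has_complex_dim (ambient_space ex_A ex_beta ex_v ex_N) 1" by (rule ex_ambient_dim)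
  fix B :: "int mat" assume B: "B \<in> carrier_mat 5 1" "gale_dual ex_A B"
  interpret ex_gale_dual B using B by unfold_locales
  show "let S\<^sub>0 = mpoly_ring 1; s = mmonom (unit_vec 1 0) in
      (\<forall>\<iota> G. admissible_choice ex_A ex_v ex_N \<iota> G \<longrightarrow> ideal_J_amb ex_A B ex_v ex_N \<iota> G = Idl\<^bsub>S\<^sub>0\<^esub> {s}) \<and>
      ideal_J_intr ex_A B ex_v ex_N = carrier S\<^sub>0 \<and>
      isomorphic_over (carrier (mpoly_ring 5)) (gale_subst B) (obstruction ex_A ex_v ex_N)
        (quot_module (ideal_module S\<^sub>0 (carrier S\<^sub>0)) (Idl\<^bsub>S\<^sub>0\<^esub> {s})) \<and>
      intrinsic_coefficients ex_A B ex_v ex_N = {\<zero>\<^bsub>mpoly_ring 5\<^esub>}"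
    unfolding Let_def
    using J_amb J_intr ex_obstruction_isomorphic[OF B(1)] intrinsic_coefficients by blast
qed

end
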